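(* Let $\mathcal{M}$ be the set of weak equivalence classes of Markov graphops. Then $(\mathcal{M},d_M)$ is a compact metric space.
   Context: For a probability space $(\Omega,\mathcal{A},\mu)$, a $P$-operator on $\Omega$ is a linear map $A:L^\infty(\Omega)\to L^1(\Omega)$, $v\mapsto vA$, with $\|A\|_{\infty\to1}:=\sup_{v}\|vA\|_1/\|v\|_\infty<\infty$. Write $(f,g)_A:=\int_\Omega (fA)g\,d\mu$. $A$ is self-adjoint if $(v,w)_A=(w,v)_A$ for all $v,w\in L^\infty(\Omega)$; positivity-preserving if $v\ge0$ a.e. implies $vA\ge0$ a.e.; $1$-regular if $1_\Omega A=1_\Omega$. A Markov graphop is a self-adjoint, positivity-preserving, $1$-regular $P$-operator. The $k$-profile $\mathcal{S}_k(A)$ is the set of joint distributions (on $\mathbb{R}^{2k}$) of $(v_1,\dots,v_k,v_1A,\dots,v_kA)$ for measurable $v_i:\Omega\to[-1,1]$. With $d_{\rm LP}$ the Lévy–Prokhorov metric and $d_H$ the induced Hausdorff distance between sets of probability measures, $d_M(A,B):=\sum_{k\ge1}2^{-k}d_H(\mathcal{S}_k(A),\mathcal{S}_k(B))$ for $P$-operators on possibly different spaces. $A,B$ are weakly equivalent if $d_M(A,B)=0$. *)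

theory Defs
  imports "HOL-Probability.Probability"
begin

text \<open>A P-operator on a probability space M is represented by a function
  A acting on real functions on the carrier, considered only on (representatives of)
  L-infinity elements and up to almost-everywhere equality.\<close>

definition linf :: "'a measure \<Rightarrow> ('a \<Rightarrow> real) set" where
  "linf M = {v \<in> borel_measurable M. \<exists>c. AE x in M. \<bar>v x\<bar> \<le> c}"

definition P_operator :: "'a measure \<Rightarrow> (('a \<Rightarrow> real) \<Rightarrow> ('a \<Rightarrow> real)) \<Rightarrow> bool" where
  "P_operator M A \<longleftrightarrow>
     prob_space M \<and>
     (\<forall>v\<in>linf M. A v \<in> borel_measurable M \<and> integrable M (A v)) \<and>
     (\<forall>v\<in>linf M. \<forall>w\<in>linf M. (AE x in M. v x = w x) \<longrightarrow> (AE x in M. A v x = A w x)) \<and>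
     (\<forall>v\<in>linf M. \<forall>w\<in>linf M. \<forall>a b::real.
        AE x in M. A (\<lambda>y. a * v y + b * w y) x = a * A v x + b * A w x) \<and>
     (\<exists>C::real. \<forall>v\<in>linf M. \<forall>c::real. (AE x in M. \<bar>v x\<bar> \<le> c) \<longrightarrow>
        (\<integral>x. \<bar>A v x\<bar> \<partial>M) \<le> C * c)"

definition self_adjoint_op :: "'a measure \<Rightarrow> (('a \<Rightarrow> real) \<Rightarrow> ('a \<Rightarrow> real)) \<Rightarrow> bool" where
  "self_adjoint_op M A \<longleftrightarrow>
     (\<forall>v\<in>linf M. \<forall>w\<in>linf M. (\<integral>x. A v x * w x \<partial>M) = (\<integral>x. A w x * v x \<partial>M))"

definition positivity_preserving :: "'a measure \<Rightarrow> (('a \<Rightarrow> real) \<Rightarrow> ('a \<Rightarrow> real)) \<Rightarrow> bool" where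
  "positivity_preserving M A \<longleftrightarrow>
     (\<forall>v\<in>linf M. (AE x in M. 0 \<le> v x) \<longrightarrow> (AE x in M. 0 \<le> A v x))"

definition one_regular :: "'a measure \<Rightarrow> (('a \<Rightarrow> real) \<Rightarrow> ('a \<Rightarrow> real)) \<Rightarrow> bool" where
  "one_regular M A \<longleftrightarrow> (AE x in M. A (\<lambda>_. 1) x = 1)"

definition markov_graphop :: "'a measure \<Rightarrow> (('a \<Rightarrow> real) \<Rightarrow> ('a \<Rightarrow> real)) \<Rightarrow> bool" where
  "markov_graphop M A \<longleftrightarrow> P_operator M A \<and> self_adjoint_op M A \<and>
     positivity_preserving M A \<and> one_regular M A"

text \<open>A point of R^(2k) is represented as a function nat => real whose coordinates
  at indices >= 2k are 0; Borel probability measures on R^(2k) are thus measures on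
  borel :: (nat => real) measure concentrated on that subspace. Distances on R^(2k)
  are Euclidean in the first 2k coordinates.\<close>

definition dist_k :: "nat \<Rightarrow> (nat \<Rightarrow> real) \<Rightarrow> (nat \<Rightarrow> real) \<Rightarrow> real" where
  "dist_k k x y = sqrt (\<Sum>i<2*k. (x i - y i)^2)"

definition nbhd_k :: "nat \<Rightarrow> real \<Rightarrow> (nat \<Rightarrow> real) set \<Rightarrow> (nat \<Rightarrow> real) set" where
  "nbhd_k k e U = {y. \<exists>x\<in>U. dist_k k x y < e}"

definition levy_prokhorov :: "nat \<Rightarrow> (nat \<Rightarrow> real) measure \<Rightarrow> (nat \<Rightarrow> real) measure \<Rightarrow> real" where
  "levy_prokhorov k \<mu> \<nu> = Inf {e. 0 < e \<and> (\<forall>U\<in>sets borel.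
       measure \<mu> U \<le> measure \<nu> (nbhd_k k e U) + e \<and>
       measure \<nu> U \<le> measure \<mu> (nbhd_k k e U) + e)}"

definition hausdorff_LP :: "nat \<Rightarrow> (nat \<Rightarrow> real) measure set \<Rightarrow> (nat \<Rightarrow> real) measure set \<Rightarrow> real" where
  "hausdorff_LP k X Y = max (SUP \<mu>\<in>X. INF \<nu>\<in>Y. levy_prokhorov k \<mu> \<nu>)
                           (SUP \<nu>\<in>Y. INF \<mu>\<in>X. levy_prokhorov k \<mu> \<nu>)"

definition profile :: "nat \<Rightarrow> 'a measure \<Rightarrow> (('a \<Rightarrow> real) \<Rightarrow> ('a \<Rightarrow> real)) \<Rightarrow> (nat \<Rightarrow> real) measure set" where
  "profile k M A = {distr M borel (\<lambda>x i. if i < k then vs i x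
                                        else if i < 2*k then A (vs (i - k)) x else 0) | vs.
      \<forall>i<k. vs i \<in> borel_measurable M \<and> (\<forall>x\<in>space M. \<bar>vs i x\<bar> \<le> 1)}"

definition dM :: "'a measure \<Rightarrow> (('a \<Rightarrow> real) \<Rightarrow> ('a \<Rightarrow> real)) \<Rightarrow>
                  'b measure \<Rightarrow> (('b \<Rightarrow> real) \<Rightarrow> ('b \<Rightarrow> real)) \<Rightarrow> real" where
  "dM M A N B = (\<Sum>k. (1/2)^(Suc k) *
      hausdorff_LP (Suc k) (profile (Suc k) M A) (profile (Suc k) N B))"

definition weakly_equivalent :: "'a measure \<Rightarrow> (('a \<Rightarrow> real) \<Rightarrow> ('a \<Rightarrow> real)) \<Rightarrow>
                  'b measure \<Rightarrow> (('b \<Rightarrow> real) \<Rightarrow> ('b \<Rightarrow> real)) \<Rightarrow> bool" where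
  "weakly_equivalent M A N B \<longleftrightarrow> dM M A N B = 0"

end

theory Submission
  imports Defs "HOL-Complex_Analysis.Great_Picard"
begin

text \<open>The laws in the \<open>k\<close>-profiles live on the cube, hence are totally bounded: up to \<open>\<epsilon>\<close> there are
  finitely many types. For each operator of the sequence choose tuples realising all its types, and
  code a point of its space by its membership in countably many sets: the rational threshold sets
  of the chosen functions and, recursively, those of the images of cylinders. This maps every space
  to the Cantor space of sets of codes. Along a subsequence the forms \<open>(1\<^sub>C, 1\<^sub>D)\<^sub>A\<close> converge for all
  cylinders, and Kolmogorov's theorem turns the limits into a symmetric measure on pairs of sets,
  i.e. into the Markov graphop \<open>v \<mapsto> E[v(y) | x]\<close>. Cylinder tuples and their images then converge in
  law; every tuple on the limit space is approximated by cylinder tuples in \<open>L\<^sup>1\<close>, and the chosen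
  tuples are uniformly approximated by cylinder tuples, so the profiles converge. Finally the limit
  space is moved to the reals along an injection.\<close>

section \<open>The Levy-Prokhorov distance\<close>

text \<open>The forms converge only weakly, whereas a profile records the joint law of
  \<open>v\<close> and \<open>vA\<close>, which is not linear in \<open>vA\<close>: weak limits can
  lose oscillation of the images. Coding the threshold sets of images prevents this. Up to any
  uniform error the image of a cylinder function is again a cylinder function, the same one for
  every operator of the sequence, and an inequality \<open>|A f - g| \<le> e\<close> with
  \<open>f\<close>, \<open>g\<close> cylinder functions survives the weak limit. Joint laws then
  reduce to finitely many atom probabilities. The second obstacle is uniformity: a subsequence
  controls countably many sequences of tuples, while the Hausdorff distance speaks of all tuples at
  once. Types leave finitely many tuples per operator and precision. The operators live on unrelated
  spaces, so laws are compared through labels in a common finite set instead of a coupling. The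
  quotient by weak equivalence is expressed by the pseudometric laws, compactness by convergent
  subsequences, and the limit sits on the reals because its carrier type has to be named in
  advance.\<close>

lemma dist_k_refl [simp]: "dist_k k x x = 0"
  by (simp add: dist_k_def)

lemma dist_k_commute: "dist_k k x y = dist_k k y x"
  by (simp add: dist_k_def power2_commute)

lemma dist_k_triangle: "dist_k k x z \<le> dist_k k x y + dist_k k y z"
proof -
  have "L2_set (\<lambda>i. (x i - y i) + (y i - z i)) {..<2*k}
      \<le> L2_set (\<lambda>i. x i - y i) {..<2*k} + L2_set (\<lambda>i. y i - z i) {..<2*k}"
    by (rule L2_set_triangle_ineq)
  then show ?thesis by (simp add: dist_k_def L2_set_def)
qed

lemma dist_k_le_sum: "dist_k k x y \<le> (\<Sum>i<2*k. \<bar>x i - y i\<bar>)"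
  using L2_set_le_sum_abs[of "\<lambda>i. x i - y i" "{..<2*k}"] by (simp add: dist_k_def L2_set_def)

lemma dist_k_le_const:
  assumes "\<And>i. i < 2*k \<Longrightarrow> \<bar>x i - y i\<bar> \<le> c"
  shows "dist_k k x y \<le> 2 * real k * c"
proof -
  have "(\<Sum>i<2*k. \<bar>x i - y i\<bar>) \<le> (\<Sum>i<2*k. c)"
    using assms by (intro sum_mono) auto
  with dist_k_le_sum[of k x y] show ?thesis by simp
qed

text \<open>The strict inequality makes a neighbourhood of any set a union of open balls, and
  \<open>dist_k\<close> is continuous for the product topology because it reads finitely many
  coordinates. So neighbourhoods are Borel and can be iterated in the triangle inequality.\<close>

lemma open_nbhd_k: "open (nbhd_k k e U)"
proof -
  have "open {y. dist_k k x y < e}" for x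
  proof -
    have "continuous_on UNIV (\<lambda>y::nat\<Rightarrow>real. dist_k k x y)"
      unfolding dist_k_def by (intro continuous_intros continuous_on_product_coordinates)
    then show ?thesis by (rule open_Collect_less[OF _ continuous_on_const])
  qed
  moreover have "nbhd_k k e U = (\<Union>x\<in>U. {y. dist_k k x y < e})" by (auto simp: nbhd_k_def)
  ultimately show ?thesis by auto
qed

lemma nbhd_k_sets [measurable, simp]: "nbhd_k k e U \<in> sets borel"
  by (simp add: open_nbhd_k)

lemma subset_nbhd_k: "0 < e \<Longrightarrow> U \<subseteq> nbhd_k k e U"
  by (force simp: nbhd_k_def)

lemma nbhd_k_mono: "e \<le> e' \<Longrightarrow> nbhd_k k e U \<subseteq> nbhd_k k e' U"
  by (force simp: nbhd_k_def)

lemma nbhd_k_nbhd_k: "nbhd_k k b (nbhd_k k a U) \<subseteq> nbhd_k k (a + b) U"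
  unfolding nbhd_k_def by clarsimp (meson add_strict_mono dist_k_triangle order_le_less_trans)

definition borel_prob :: "(nat \<Rightarrow> real) measure set" where
  "borel_prob = {\<mu>. prob_space \<mu> \<and> sets \<mu> = sets borel}"

lemma borel_probD: "\<mu> \<in> borel_prob \<Longrightarrow> prob_space \<mu>" "\<mu> \<in> borel_prob \<Longrightarrow> sets \<mu> = sets borel"
  by (auto simp: borel_prob_def)

lemma borel_prob_mono:
  assumes "\<mu> \<in> borel_prob" "U \<subseteq> V" "V \<in> sets borel"
  shows "measure \<mu> U \<le> measure \<mu> V"
proof -
  interpret prob_space \<mu> using assms borel_probD by auto
  show ?thesis using assms borel_probD by (intro finite_measure_mono) auto
qed

text \<open>The condition under the infimum. For probability measures it is upward closed in
  \<open>e\<close>, so every \<open>e\<close> strictly above the distance satisfies it; arguments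
  run on \<open>LP_le\<close> and touch the infimum only at their ends.\<close>

definition LP_le :: "nat \<Rightarrow> real \<Rightarrow> (nat \<Rightarrow> real) measure \<Rightarrow> (nat \<Rightarrow> real) measure \<Rightarrow> bool" where
  "LP_le k e \<mu> \<nu> \<longleftrightarrow> (\<forall>U\<in>sets borel.
       measure \<mu> U \<le> measure \<nu> (nbhd_k k e U) + e \<and>
       measure \<nu> U \<le> measure \<mu> (nbhd_k k e U) + e)"

lemma levy_prokhorov_eq: "levy_prokhorov k \<mu> \<nu> = Inf {e. 0 < e \<and> LP_le k e \<mu> \<nu>}"
  by (simp add: levy_prokhorov_def LP_le_def)

lemma LP_le_commute: "LP_le k e \<mu> \<nu> \<longleftrightarrow> LP_le k e \<nu> \<mu>"
  by (auto simp: LP_le_def)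

lemma LP_le_mono:
  assumes "\<mu> \<in> borel_prob" "\<nu> \<in> borel_prob" "e \<le> e'" "LP_le k e \<mu> \<nu>"
  shows "LP_le k e' \<mu> \<nu>"
  unfolding LP_le_def
proof (intro ballI)
  fix U :: "(nat \<Rightarrow> real) set" assume "U \<in> sets borel"
  with assms(4) have "measure \<mu> U \<le> measure \<nu> (nbhd_k k e U) + e"
       "measure \<nu> U \<le> measure \<mu> (nbhd_k k e U) + e"
    by (auto simp: LP_le_def)
  then show "measure \<mu> U \<le> measure \<nu> (nbhd_k k e' U) + e' \<and>
       measure \<nu> U \<le> measure \<mu> (nbhd_k k e' U) + e'"
    using borel_prob_mono[OF assms(1) nbhd_k_mono[OF assms(3), of k U] nbhd_k_sets]
      borel_prob_mono[OF assms(2) nbhd_k_mono[OF assms(3), of k U] nbhd_k_sets] assms(3)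
    by linarith
qed

lemma LP_le_one:
  assumes "\<mu> \<in> borel_prob" "\<nu> \<in> borel_prob" shows "LP_le k 1 \<mu> \<nu>"
proof -
  interpret \<mu>: prob_space \<mu> using assms borel_probD by auto
  interpret \<nu>: prob_space \<nu> using assms borel_probD by auto
  show ?thesis unfolding LP_le_def
    using \<mu>.prob_le_1 \<nu>.prob_le_1 by (simp add: add_increasing)
qed

lemma LP_le_imp_levy_prokhorov_le:
  assumes "0 < e" "LP_le k e \<mu> \<nu>" shows "levy_prokhorov k \<mu> \<nu> \<le> e"
  unfolding levy_prokhorov_eq using assms
  by (intro cInf_lower bdd_belowI[of _ 0]) auto

lemma levy_prokhorov_less_imp_LP_le:
  assumes "\<mu> \<in> borel_prob" "\<nu> \<in> borel_prob" "levy_prokhorov k \<mu> \<nu> < e"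
  shows "LP_le k e \<mu> \<nu>"
proof -
  have "{e. 0 < e \<and> LP_le k e \<mu> \<nu>} \<noteq> {}" using LP_le_one[OF assms(1,2), of k] zero_less_one by blast
  from cInf_lessD[OF this assms(3)[unfolded levy_prokhorov_eq]]
  obtain a where "LP_le k a \<mu> \<nu>" "a < e" by auto
  then show ?thesis using LP_le_mono[OF assms(1,2), of a e k] by simp
qed

lemma levy_prokhorov_nonneg:
  assumes "\<mu> \<in> borel_prob" "\<nu> \<in> borel_prob"
  shows "0 \<le> levy_prokhorov k \<mu> \<nu>"
proof -
  have "{e. 0 < e \<and> LP_le k e \<mu> \<nu>} \<noteq> {}" using LP_le_one[OF assms(1,2), of k] zero_less_one by blast
  then show ?thesis unfolding levy_prokhorov_eq by (intro cInf_greatest) auto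
qed

lemma levy_prokhorov_le_one:
  assumes "\<mu> \<in> borel_prob" "\<nu> \<in> borel_prob"
  shows "levy_prokhorov k \<mu> \<nu> \<le> 1"
  by (intro LP_le_imp_levy_prokhorov_le LP_le_one assms) simp

lemma levy_prokhorov_commute: "levy_prokhorov k \<mu> \<nu> = levy_prokhorov k \<nu> \<mu>"
  unfolding levy_prokhorov_eq by (simp add: LP_le_commute[of _ _ \<mu>])

lemma levy_prokhorov_self:
  assumes "\<mu> \<in> borel_prob" shows "levy_prokhorov k \<mu> \<mu> = 0"
proof (rule antisym)
  show "levy_prokhorov k \<mu> \<mu> \<le> 0"
  proof (rule field_le_epsilon)
    fix e :: real assume "0 < e"
    have "measure \<mu> U \<le> measure \<mu> (nbhd_k k e U) + e" for U
      using borel_prob_mono[OF assms subset_nbhd_k[OF \<open>0 < e\<close>, of U k] nbhd_k_sets] \<open>0 < e\<close> by linarith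
    then have "LP_le k e \<mu> \<mu>" unfolding LP_le_def by blast
    with \<open>0 < e\<close> show "levy_prokhorov k \<mu> \<mu> \<le> 0 + e"
      by (simp add: LP_le_imp_levy_prokhorov_le)
  qed
qed (simp add: levy_prokhorov_nonneg assms)

lemma LP_le_trans_half:
  assumes "\<rho> \<in> borel_prob" and bnd1: "LP_le k a \<mu> \<nu>" and bnd2: "LP_le k b \<nu> \<rho>" and U: "U \<in> sets borel"
  shows "measure \<mu> U \<le> measure \<rho> (nbhd_k k (a + b) U) + (a + b)"
proof -
  have "measure \<mu> U \<le> measure \<nu> (nbhd_k k a U) + a" using bnd1 U by (auto simp: LP_le_def)
  also have "measure \<nu> (nbhd_k k a U) \<le> measure \<rho> (nbhd_k k b (nbhd_k k a U)) + b"
    using bnd2 nbhd_k_sets by (auto simp: LP_le_def)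
  also have "measure \<rho> (nbhd_k k b (nbhd_k k a U)) \<le> measure \<rho> (nbhd_k k (a + b) U)"
    by (intro borel_prob_mono assms nbhd_k_nbhd_k nbhd_k_sets)
  finally show ?thesis by simp
qed

lemma LP_le_trans:
  assumes "\<mu> \<in> borel_prob" "\<rho> \<in> borel_prob" "LP_le k a \<mu> \<nu>" "LP_le k b \<nu> \<rho>"
  shows "LP_le k (a + b) \<mu> \<rho>"
  unfolding LP_le_def
proof (intro ballI conjI)
  fix U :: "(nat \<Rightarrow> real) set" assume U: "U \<in> sets borel"
  show "measure \<mu> U \<le> measure \<rho> (nbhd_k k (a + b) U) + (a + b)"
    by (rule LP_le_trans_half[OF assms(2-4) U])
  have "LP_le k b \<rho> \<nu>" "LP_le k a \<nu> \<mu>"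
    using assms(3,4) by (auto intro: LP_le_commute[THEN iffD1])
  from LP_le_trans_half[OF assms(1) this U]
  show "measure \<rho> U \<le> measure \<mu> (nbhd_k k (a + b) U) + (a + b)" by (simp add: add.commute)
qed

lemma levy_prokhorov_triangle:
  assumes "\<mu> \<in> borel_prob" "\<nu> \<in> borel_prob" "\<rho> \<in> borel_prob"
  shows "levy_prokhorov k \<mu> \<rho> \<le> levy_prokhorov k \<mu> \<nu> + levy_prokhorov k \<nu> \<rho>"
proof (rule field_le_epsilon)
  fix e :: real assume "0 < e"
  let ?a = "levy_prokhorov k \<mu> \<nu> + e/2" and ?b = "levy_prokhorov k \<nu> \<rho> + e/2"
  have "LP_le k ?a \<mu> \<nu>" "LP_le k ?b \<nu> \<rho>"
    using assms \<open>0 < e\<close> by (auto intro!: levy_prokhorov_less_imp_LP_le)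
  then have "LP_le k (?a + ?b) \<mu> \<rho>" by (rule LP_le_trans[OF assms(1,3)])
  moreover have "0 < ?a + ?b" using levy_prokhorov_nonneg[OF assms(1,2), of k] levy_prokhorov_nonneg[OF assms(2,3), of k] \<open>0 < e\<close>
    by linarith
  ultimately have "levy_prokhorov k \<mu> \<rho> \<le> ?a + ?b" by (intro LP_le_imp_levy_prokhorov_le)
  then show "levy_prokhorov k \<mu> \<rho> \<le> levy_prokhorov k \<mu> \<nu> + levy_prokhorov k \<nu> \<rho> + e" by simp
qed

section \<open>Bounding distances of laws by finite labels and by closeness in probability\<close>

lemma borel_prob_distr:
  "prob_space M \<Longrightarrow> f \<in> measurable M borel \<Longrightarrow> distr M borel f \<in> borel_prob"
  by (simp add: borel_prob_def prob_space.prob_space_distr)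

text \<open>\<open>M\<close> and \<open>N\<close> share only the label set \<open>J\<close>, and
  each map stays within \<open>e\<close> of the point \<open>h j\<close> of its label. If
  \<open>F x\<close> lies in \<open>U\<close>, the label of \<open>x\<close> is near
  \<open>U\<close>, and points of \<open>N\<close> with such a label land within
  \<open>2 * e\<close> of \<open>U\<close>; the l1 distance of the label distributions pays the
  additive term.\<close>

lemma LP_le_labels_half:
  assumes "prob_space M" "prob_space N"
    and F: "F \<in> measurable M borel" and G: "G \<in> measurable N borel"
    and P: "P \<in> measurable M (count_space UNIV)" and Q: "Q \<in> measurable N (count_space UNIV)"
    and J: "finite J" "\<And>x. x \<in> space M \<Longrightarrow> P x \<in> J"
    and FP: "AE x in M. dist_k k (F x) (h (P x)) < e"
    and GQ: "AE x in N. dist_k k (G x) (h (Q x)) < e"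
    and close: "(\<Sum>j\<in>J. \<bar>measure M {x\<in>space M. P x = j} - measure N {x\<in>space N. Q x = j}\<bar>) \<le> 2 * e"
    and U: "U \<in> sets borel"
  shows "measure (distr M borel F) U \<le> measure (distr N borel G) (nbhd_k k (2 * e) U) + 2 * e"
proof -
  interpret M: prob_space M by fact
  interpret N: prob_space N by fact
  \<comment> \<open>Labels whose point comes within \<open>e\<close> of \<open>U\<close>: almost
    every \<open>x\<close> with \<open>F x\<close> in \<open>U\<close> carries one.\<close>
  define J' where "J' = {j\<in>J. \<exists>u\<in>U. dist_k k u (h j) < e}"
  have fin: "finite J'" "J' \<subseteq> J" using J by (auto simp: J'_def)
  have Psets: "{x\<in>space M. P x \<in> A} \<in> sets M" for A
    using measurable_sets[OF P, of A] by (simp add: vimage_def Int_def conj_commute)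
  have Qsets: "{x\<in>space N. Q x \<in> A} \<in> sets N" for A
    using measurable_sets[OF Q, of A] by (simp add: vimage_def Int_def conj_commute)
  have "measure (distr M borel F) U = measure M (F -` U \<inter> space M)"
    by (rule measure_distr[OF F U])
  also have "\<dots> \<le> measure M {x\<in>space M. P x \<in> J'}"
  proof (rule M.finite_measure_mono_AE)
    show "AE x in M. x \<in> F -` U \<inter> space M \<longrightarrow> x \<in> {x \<in> space M. P x \<in> J'}"
      using FP AE_space by eventually_elim (auto simp: J'_def J)
  qed (rule Psets)
  also have "{x\<in>space M. P x \<in> J'} = (\<Union>j\<in>J'. {x\<in>space M. P x = j})" by auto
  also have "measure M \<dots> = (\<Sum>j\<in>J'. measure M {x\<in>space M. P x = j})"
    using fin Psets[of "{_}"] by (intro M.finite_measure_finite_Union) (auto simp: disjoint_family_on_def)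
  also have "\<dots> \<le> (\<Sum>j\<in>J'. measure N {x\<in>space N. Q x = j} + \<bar>measure M {x\<in>space M. P x = j} - measure N {x\<in>space N. Q x = j}\<bar>)"
    by (intro sum_mono) auto
  also have "\<dots> = (\<Sum>j\<in>J'. measure N {x\<in>space N. Q x = j}) + (\<Sum>j\<in>J'. \<bar>measure M {x\<in>space M. P x = j} - measure N {x\<in>space N. Q x = j}\<bar>)"
    by (rule sum.distrib)
  also have "(\<Sum>j\<in>J'. \<bar>measure M {x\<in>space M. P x = j} - measure N {x\<in>space N. Q x = j}\<bar>) \<le> 2 * e"
    using close sum_mono2[OF J(1) fin(2), of "\<lambda>j. \<bar>measure M {x\<in>space M. P x = j} - measure N {x\<in>space N. Q x = j}\<bar>"] by simp
  also have "(\<Sum>j\<in>J'. measure N {x\<in>space N. Q x = j}) = measure N (\<Union>j\<in>J'. {x\<in>space N. Q x = j})"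
    using fin Qsets[of "{_}"] by (intro N.finite_measure_finite_Union[symmetric]) (auto simp: disjoint_family_on_def)
  also have "\<dots> \<le> measure N (G -` nbhd_k k (2 * e) U \<inter> space N)"
  proof (rule N.finite_measure_mono_AE)
    show "AE x in N. x \<in> (\<Union>j\<in>J'. {x\<in>space N. Q x = j}) \<longrightarrow> x \<in> G -` nbhd_k k (2 * e) U \<inter> space N"
      using GQ
    proof eventually_elim
      case (elim x)
      have "G x \<in> nbhd_k k (2 * e) U" if "u \<in> U" "dist_k k u (h (Q x)) < e" for u
        using elim that dist_k_triangle[of k u "G x" "h (Q x)"] dist_k_commute[of k "G x" "h (Q x)"]
        by (force simp: nbhd_k_def)
      then show ?case by (auto simp: J'_def)
    qed
  qed (use G in \<open>auto intro: measurable_sets\<close>)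
  also have "\<dots> = measure (distr N borel G) (nbhd_k k (2 * e) U)"
    by (rule measure_distr[OF G nbhd_k_sets, symmetric])
  finally show ?thesis by simp
qed

lemma levy_prokhorov_labels:
  assumes "0 < e" "prob_space M" "prob_space N"
    and "F \<in> measurable M borel" "G \<in> measurable N borel"
    and "P \<in> measurable M (count_space UNIV)" "Q \<in> measurable N (count_space UNIV)"
    and "finite J" "\<And>x. x \<in> space M \<Longrightarrow> P x \<in> J" "\<And>x. x \<in> space N \<Longrightarrow> Q x \<in> J"
    and "AE x in M. dist_k k (F x) (h (P x)) < e"
    and "AE x in N. dist_k k (G x) (h (Q x)) < e"
    and "(\<Sum>j\<in>J. \<bar>measure M {x\<in>space M. P x = j} - measure N {x\<in>space N. Q x = j}\<bar>) \<le> 2 * e"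
  shows "levy_prokhorov k (distr M borel F) (distr N borel G) \<le> 2 * e"
proof (rule LP_le_imp_levy_prokhorov_le)
  have "(\<Sum>j\<in>J. \<bar>measure N {x\<in>space N. Q x = j} - measure M {x\<in>space M. P x = j}\<bar>) \<le> 2 * e"
    using assms(13) by (simp add: abs_minus_commute)
  then show "LP_le k (2 * e) (distr M borel F) (distr N borel G)"
    unfolding LP_le_def
    using LP_le_labels_half[of M N F G P Q J k h e] LP_le_labels_half[of N M G F Q P J k h e] assms by blast
qed (use assms in simp)

text \<open>The Ky Fan bound: off a set of mass at most \<open>e\<close> the two maps differ by less
  than \<open>e\<close>, so the preimage of \<open>U\<close> under one lies in the preimage of its
  neighbourhood under the other, up to that set.\<close>

lemma levy_prokhorov_prob_le:
  assumes "0 < e" "prob_space M"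
    and F: "F \<in> measurable M borel" and G: "G \<in> measurable M borel"
    and le: "measure M {x\<in>space M. dist_k k (F x) (G x) \<ge> e} \<le> e"
  shows "levy_prokhorov k (distr M borel F) (distr M borel G) \<le> e"
proof (rule LP_le_imp_levy_prokhorov_le)
  interpret M: prob_space M by fact
  have coord: "(\<lambda>x. H x i) \<in> borel_measurable M" if "H \<in> measurable M borel" for H :: "'a \<Rightarrow> nat \<Rightarrow> real" and i
    by (rule measurable_compose[OF that borel_measurable_continuous_onI])
       (auto intro: continuous_on_product_coordinates)
  note coord[OF F, measurable] coord[OF G, measurable]
  let ?B = "{x\<in>space M. dist_k k (F x) (G x) \<ge> e}"
  have B: "?B \<in> sets M" unfolding dist_k_def by measurable
  have half: "measure (distr M borel F') U \<le> measure (distr M borel G') (nbhd_k k e U) + e"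
    if U: "U \<in> sets borel" and m: "F' \<in> measurable M borel" "G' \<in> measurable M borel"
      and eq: "\<And>x. dist_k k (F' x) (G' x) = dist_k k (F x) (G x)" for U F' G'
  proof -
    have "measure (distr M borel F') U = measure M (F' -` U \<inter> space M)"
      by (rule measure_distr[OF m(1) U])
    also have "\<dots> \<le> measure M ((G' -` nbhd_k k e U \<inter> space M) \<union> ?B)"
    proof (rule M.finite_measure_mono)
      show "F' -` U \<inter> space M \<subseteq> (G' -` nbhd_k k e U \<inter> space M) \<union> ?B"
        using eq by (force simp: nbhd_k_def not_le)
    qed (use B m in \<open>auto intro: measurable_sets\<close>)
    also have "\<dots> \<le> measure M (G' -` nbhd_k k e U \<inter> space M) + measure M ?B"
      using B m by (intro measure_Un_le) (auto intro: measurable_sets)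
    also have "measure M (G' -` nbhd_k k e U \<inter> space M) = measure (distr M borel G') (nbhd_k k e U)"
      by (rule measure_distr[OF m(2) nbhd_k_sets, symmetric])
    finally show ?thesis using le by simp
  qed
  show "LP_le k e (distr M borel F) (distr M borel G)"
    unfolding LP_le_def using half[OF _ F G] half[OF _ G F] by (auto simp: dist_k_commute)
qed fact

section \<open>Hausdorff distance of profiles and the metric dM\<close>

text \<open>Distance from a law to a set of laws. By symmetry of \<open>levy_prokhorov\<close> both
  halves of the Hausdorff distance are suprema of it, so each fact is proved once and used with the
  sets exchanged.\<close>

definition "LP_inf k Y \<mu> = (INF \<nu>\<in>Y. levy_prokhorov k \<mu> \<nu>)"

lemma hausdorff_LP_eq:
  "hausdorff_LP k X Y = max (SUP \<mu>\<in>X. LP_inf k Y \<mu>) (SUP \<nu>\<in>Y. LP_inf k X \<nu>)"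
  unfolding hausdorff_LP_def LP_inf_def by (simp add: levy_prokhorov_commute)

lemma hausdorff_LP_commute: "hausdorff_LP k X Y = hausdorff_LP k Y X"
  by (simp add: hausdorff_LP_eq max.commute)

context
  fixes X Y :: "(nat \<Rightarrow> real) measure set" and k :: nat
  assumes X: "X \<subseteq> borel_prob" "X \<noteq> {}" and Y: "Y \<subseteq> borel_prob" "Y \<noteq> {}"
begin

lemma LP_inf_le:
  assumes "\<mu> \<in> X" "\<nu> \<in> Y" shows "LP_inf k Y \<mu> \<le> levy_prokhorov k \<mu> \<nu>"
  unfolding LP_inf_def using assms X Y
  by (intro cINF_lower bdd_belowI2[of _ 0] levy_prokhorov_nonneg) auto

lemma LP_inf_nonneg:
  assumes "\<mu> \<in> X" shows "0 \<le> LP_inf k Y \<mu>"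
  unfolding LP_inf_def using assms X Y by (intro cINF_greatest levy_prokhorov_nonneg) auto

text \<open>Real suprema say something only about bounded families; the universal bound 1 supplies
  this boundedness.\<close>

lemma LP_inf_le_one:
  assumes "\<mu> \<in> X" shows "LP_inf k Y \<mu> \<le> 1"
proof -
  obtain \<nu> where "\<nu> \<in> Y" using Y by auto
  with assms X Y show ?thesis
    by (intro order_trans[OF LP_inf_le levy_prokhorov_le_one]) auto
qed

lemma LP_inf_lessD:
  assumes "LP_inf k Y \<mu> < e" shows "\<exists>\<nu>\<in>Y. levy_prokhorov k \<mu> \<nu> < e"
  using cInf_lessD[of "levy_prokhorov k \<mu> ` Y" e] Y assms by (auto simp: LP_inf_def)

lemma LP_inf_le_SUP:
  assumes "\<mu> \<in> X" shows "LP_inf k Y \<mu> \<le> (SUP \<mu>\<in>X. LP_inf k Y \<mu>)"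
  using assms LP_inf_le_one by (intro cSUP_upper bdd_aboveI2[of _ _ 1]) auto

end

lemma hausdorff_LP_leI:
  assumes "X \<subseteq> borel_prob" "X \<noteq> {}" "Y \<subseteq> borel_prob" "Y \<noteq> {}"
    and "\<And>\<mu>. \<mu> \<in> X \<Longrightarrow> \<exists>\<nu>\<in>Y. levy_prokhorov k \<mu> \<nu> \<le> e"
    and "\<And>\<nu>. \<nu> \<in> Y \<Longrightarrow> \<exists>\<mu>\<in>X. levy_prokhorov k \<mu> \<nu> \<le> e"
  shows "hausdorff_LP k X Y \<le> e"
  unfolding hausdorff_LP_eq
proof (intro max.boundedI cSUP_least)
  show "LP_inf k Y \<mu> \<le> e" if "\<mu> \<in> X" for \<mu>
    using assms(5)[OF that] LP_inf_le[OF assms(1-4) that, of _ k] by force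
  show "LP_inf k X \<nu> \<le> e" if "\<nu> \<in> Y" for \<nu>
    using assms(6)[OF that] LP_inf_le[OF assms(3,4,1,2) that, of _ k]
    by (force simp: levy_prokhorov_commute[of k \<nu>])
qed (use assms in auto)

lemma hausdorff_LP_lessD:
  assumes "X \<subseteq> borel_prob" "X \<noteq> {}" "Y \<subseteq> borel_prob" "Y \<noteq> {}"
    and "hausdorff_LP k X Y < e" "\<mu> \<in> X"
  shows "\<exists>\<nu>\<in>Y. levy_prokhorov k \<mu> \<nu> < e"
  using LP_inf_le_SUP[OF assms(1-4,6), of k] assms(5)
  by (intro LP_inf_lessD[OF assms(1-4)]) (auto simp: hausdorff_LP_eq)

lemma hausdorff_LP_bounds:
  assumes "X \<subseteq> borel_prob" "X \<noteq> {}" "Y \<subseteq> borel_prob" "Y \<noteq> {}"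
  shows "0 \<le> hausdorff_LP k X Y" "hausdorff_LP k X Y \<le> 1"
proof -
  obtain \<mu> where "\<mu> \<in> X" using assms by auto
  then have "0 \<le> (SUP \<mu>\<in>X. LP_inf k Y \<mu>)"
    using LP_inf_nonneg[OF assms] LP_inf_le_SUP[OF assms] order_trans by blast
  then show "0 \<le> hausdorff_LP k X Y" by (simp add: hausdorff_LP_eq)
  have "\<exists>\<nu>\<in>Y. levy_prokhorov k \<mu> \<nu> \<le> 1" if "\<mu> \<in> X" for \<mu>
    using assms that levy_prokhorov_le_one by (meson ex_in_conv subsetD)
  moreover have "\<exists>\<mu>\<in>X. levy_prokhorov k \<mu> \<nu> \<le> 1" if "\<nu> \<in> Y" for \<nu>
    using assms that levy_prokhorov_le_one by (meson ex_in_conv subsetD)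
  ultimately show "hausdorff_LP k X Y \<le> 1"
    by (rule hausdorff_LP_leI[OF assms])
qed

lemma hausdorff_LP_self:
  assumes "X \<subseteq> borel_prob" "X \<noteq> {}" shows "hausdorff_LP k X X = 0"
proof (rule antisym)
  have *: "levy_prokhorov k \<mu> \<mu> \<le> 0" if "\<mu> \<in> X" for \<mu>
    using assms that levy_prokhorov_self by (metis order_refl subsetD)
  show "hausdorff_LP k X X \<le> 0"
    by (rule hausdorff_LP_leI[OF assms assms]) (use * in blast)+
qed (rule hausdorff_LP_bounds[OF assms assms])

lemma hausdorff_LP_triangle:
  assumes X: "X \<subseteq> borel_prob" "X \<noteq> {}" and Y: "Y \<subseteq> borel_prob" "Y \<noteq> {}"
    and Z: "Z \<subseteq> borel_prob" "Z \<noteq> {}"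
  shows "hausdorff_LP k X Z \<le> hausdorff_LP k X Y + hausdorff_LP k Y Z"
proof (rule field_le_epsilon)
  fix e :: real assume "0 < e"
  \<comment> \<open>Infima need not be attained, hence the slack \<open>e/2\<close> in each
    leg.\<close>
  let ?a = "hausdorff_LP k X Y + e/2" and ?b = "hausdorff_LP k Y Z + e/2"
  have a: "hausdorff_LP k X Y < ?a" "hausdorff_LP k Y X < ?a"
    and b: "hausdorff_LP k Y Z < ?b" "hausdorff_LP k Z Y < ?b"
    using \<open>0 < e\<close> by (simp_all add: hausdorff_LP_commute[of k Y X] hausdorff_LP_commute[of k Z Y])
  have "hausdorff_LP k X Z \<le> ?a + ?b"
  proof (rule hausdorff_LP_leI[OF X Z])
    fix \<mu> assume \<mu>: "\<mu> \<in> X"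
    obtain \<nu> where \<nu>: "\<nu> \<in> Y" "levy_prokhorov k \<mu> \<nu> < ?a" using hausdorff_LP_lessD[OF X Y a(1) \<mu>] by auto
    obtain \<rho> where \<rho>: "\<rho> \<in> Z" "levy_prokhorov k \<nu> \<rho> < ?b" using hausdorff_LP_lessD[OF Y Z b(1) \<nu>(1)] by auto
    have "levy_prokhorov k \<mu> \<rho> \<le> ?a + ?b"
      using levy_prokhorov_triangle[of \<mu> \<nu> \<rho> k] \<mu> \<nu> \<rho> X Y Z by fastforce
    then show "\<exists>\<rho>\<in>Z. levy_prokhorov k \<mu> \<rho> \<le> ?a + ?b" using \<rho> by auto
  next
    fix \<rho> assume \<rho>: "\<rho> \<in> Z"
    obtain \<nu> where \<nu>: "\<nu> \<in> Y" "levy_prokhorov k \<rho> \<nu> < ?b" using hausdorff_LP_lessD[OF Z Y b(2) \<rho>(1)] by auto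
    obtain \<mu> where \<mu>: "\<mu> \<in> X" "levy_prokhorov k \<nu> \<mu> < ?a" using hausdorff_LP_lessD[OF Y X a(2) \<nu>(1)] by auto
    have "levy_prokhorov k \<mu> \<rho> \<le> ?a + ?b"
      using levy_prokhorov_triangle[of \<mu> \<nu> \<rho> k] \<mu> \<nu> \<rho> X Y Z
        levy_prokhorov_commute[of k \<rho> \<nu>] levy_prokhorov_commute[of k \<nu> \<mu>] by fastforce
    then show "\<exists>\<mu>\<in>X. levy_prokhorov k \<mu> \<rho> \<le> ?a + ?b" using \<mu> by auto
  qed
  then show "hausdorff_LP k X Z \<le> hausdorff_LP k X Y + hausdorff_LP k Y Z + e" by simp
qed

section \<open>Profiles as sets of laws, and the pseudometric \<open>dM\<close>\<close>

definition tuple :: "nat \<Rightarrow> (nat \<Rightarrow> 'a \<Rightarrow> real) \<Rightarrow> (nat \<Rightarrow> 'a \<Rightarrow> real) \<Rightarrow> 'a \<Rightarrow> nat \<Rightarrow> real" where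
  "tuple k vs ws = (\<lambda>x i. if i < k then vs i x else if i < 2*k then ws (i - k) x else 0)"

definition admissible :: "nat \<Rightarrow> 'a measure \<Rightarrow> (nat \<Rightarrow> 'a \<Rightarrow> real) \<Rightarrow> bool" where
  "admissible k M vs \<longleftrightarrow> (\<forall>i<k. vs i \<in> borel_measurable M \<and> (\<forall>x\<in>space M. \<bar>vs i x\<bar> \<le> 1))"

definition law :: "nat \<Rightarrow> 'a measure \<Rightarrow> (('a \<Rightarrow> real) \<Rightarrow> 'a \<Rightarrow> real) \<Rightarrow> (nat \<Rightarrow> 'a \<Rightarrow> real) \<Rightarrow> (nat \<Rightarrow> real) measure" where
  "law k M A vs = distr M borel (tuple k vs (\<lambda>i. A (vs i)))"

lemma profile_eq: "profile k M A = {law k M A vs | vs. admissible k M vs}"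
  by (simp add: profile_def law_def tuple_def admissible_def)

lemma tuple_measurable:
  assumes "\<And>i. i < k \<Longrightarrow> vs i \<in> borel_measurable M" "\<And>i. i < k \<Longrightarrow> ws i \<in> borel_measurable M"
  shows "tuple k vs ws \<in> measurable M borel"
  unfolding tuple_def
proof (rule measurable_coordinatewise_then_product)
  fix i show "(\<lambda>x. if i < k then vs i x else if i < 2*k then ws (i - k) x else 0) \<in> borel_measurable M"
    using assms by (cases "i < k"; cases "i < 2*k") auto
qed

lemma markov_graphopD:
  assumes "markov_graphop M A"
  shows "prob_space M"
    and "\<And>v. v \<in> linf M \<Longrightarrow> A v \<in> borel_measurable M"
    and "\<And>v. v \<in> linf M \<Longrightarrow> integrable M (A v)"
    and "\<And>v w. v \<in> linf M \<Longrightarrow> w \<in> linf M \<Longrightarrow> AE x in M. v x = w x \<Longrightarrow> AE x in M. A v x = A w x"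
    and "\<And>v w a b. v \<in> linf M \<Longrightarrow> w \<in> linf M \<Longrightarrow>
        AE x in M. A (\<lambda>y. a * v y + b * w y) x = a * A v x + b * A w x"
    and "\<And>v w. v \<in> linf M \<Longrightarrow> w \<in> linf M \<Longrightarrow> (\<integral>x. A v x * w x \<partial>M) = (\<integral>x. A w x * v x \<partial>M)"
    and "\<And>v. v \<in> linf M \<Longrightarrow> AE x in M. 0 \<le> v x \<Longrightarrow> AE x in M. 0 \<le> A v x"
    and "AE x in M. A (\<lambda>_. 1) x = 1"
  using assms by (auto simp: markov_graphop_def P_operator_def self_adjoint_op_def
      positivity_preserving_def one_regular_def)

lemma linfI: "v \<in> borel_measurable M \<Longrightarrow> (\<And>x. x \<in> space M \<Longrightarrow> \<bar>v x\<bar> \<le> c) \<Longrightarrow> v \<in> linf M"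
  by (auto simp: linf_def)

lemma linfI_AE: "v \<in> borel_measurable M \<Longrightarrow> (AE x in M. \<bar>v x\<bar> \<le> c) \<Longrightarrow> v \<in> linf M"
  by (auto simp: linf_def)

lemma linfE:
  assumes "v \<in> linf M"
  obtains c where "AE x in M. \<bar>v x\<bar> \<le> c" "v \<in> borel_measurable M"
  using assms by (auto simp: linf_def)

lemma linf_measurable: "v \<in> linf M \<Longrightarrow> v \<in> borel_measurable M"
  by (simp add: linf_def)

lemma linf_const [simp]: "(\<lambda>_. c) \<in> linf M"
  by (rule linfI[where c="\<bar>c\<bar>"]) auto

lemma linf_lincomb: "v \<in> linf M \<Longrightarrow> w \<in> linf M \<Longrightarrow> (\<lambda>x. a * v x + b * w x) \<in> linf M"
proof (elim linfE)
  fix c d assume *: "AE x in M. \<bar>v x\<bar> \<le> c" "v \<in> borel_measurable M" "AE x in M. \<bar>w x\<bar> \<le> d" "w \<in> borel_measurable M"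
  show ?thesis
  proof (rule linfI_AE[where c="\<bar>a\<bar> * c + \<bar>b\<bar> * d"])
    show "AE x in M. \<bar>a * v x + b * w x\<bar> \<le> \<bar>a\<bar> * c + \<bar>b\<bar> * d"
      using *(1,3)
    proof eventually_elim
      case (elim x)
      have "\<bar>a * v x + b * w x\<bar> \<le> \<bar>a\<bar> * \<bar>v x\<bar> + \<bar>b\<bar> * \<bar>w x\<bar>"
        by (metis abs_mult abs_triangle_ineq)
      also have "\<dots> \<le> \<bar>a\<bar> * c + \<bar>b\<bar> * d" using elim by (intro add_mono mult_left_mono) auto
      finally show ?case .
    qed
  qed (use * in measurable)
qed

lemma admissible_linf: "admissible k M vs \<Longrightarrow> i < k \<Longrightarrow> vs i \<in> linf M"
  by (rule linfI[where c=1]) (auto simp: admissible_def)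

lemma tuple_op_measurable:
  assumes "markov_graphop M A" "\<And>i. i < k \<Longrightarrow> vs i \<in> linf M"
  shows "tuple k vs (\<lambda>i. A (vs i)) \<in> measurable M borel"
  using assms markov_graphopD(2)[OF assms(1)] by (intro tuple_measurable) (auto simp: linf_measurable)

lemma law_borel_prob:
  assumes "markov_graphop M A" "\<And>i. i < k \<Longrightarrow> vs i \<in> linf M"
  shows "law k M A vs \<in> borel_prob"
  unfolding law_def using assms
  by (intro borel_prob_distr markov_graphopD(1)[OF assms(1)] tuple_op_measurable)

lemma profile_borel_prob:
  assumes "markov_graphop M A" shows "profile k M A \<subseteq> borel_prob" "profile k M A \<noteq> {}"
proof -
  show "profile k M A \<subseteq> borel_prob"
    using law_borel_prob[OF assms] admissible_linf by (force simp: profile_eq)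
  have "admissible k M (\<lambda>_ _. 0)" by (simp add: admissible_def)
  then show "profile k M A \<noteq> {}" by (auto simp: profile_eq)
qed

lemma dM_summable:
  assumes "markov_graphop M A" "markov_graphop N B"
  shows "summable (\<lambda>k. (1/2)^(Suc k) * hausdorff_LP (Suc k) (profile (Suc k) M A) (profile (Suc k) N B))"
proof (rule summable_comparison_test')
  show "summable (\<lambda>k. (1/2)^(Suc k) :: real)" using summable_geometric[of "1/2::real"] by (simp add: summable_mult)
  show "norm ((1/2)^(Suc k) * hausdorff_LP (Suc k) (profile (Suc k) M A) (profile (Suc k) N B)) \<le> (1/2)^(Suc k)"
    for k using hausdorff_LP_bounds[OF profile_borel_prob[OF assms(1)] profile_borel_prob[OF assms(2)]]
    by (auto simp: abs_mult intro!: mult_left_le)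
qed

lemma dM_nonneg:
  assumes "markov_graphop M A" "markov_graphop N B" shows "0 \<le> dM M A N B"
  unfolding dM_def
  by (intro suminf_nonneg dM_summable assms mult_nonneg_nonneg hausdorff_LP_bounds profile_borel_prob) auto

lemma dM_commute: "dM M A N B = dM N B M A"
  by (simp add: dM_def hausdorff_LP_commute)

lemma dM_self: "markov_graphop M A \<Longrightarrow> dM M A M A = 0"
  by (simp add: dM_def hausdorff_LP_self profile_borel_prob)

lemma dM_triangle:
  assumes "markov_graphop M A" "markov_graphop N B" "markov_graphop L C"
  shows "dM M A L C \<le> dM M A N B + dM N B L C"
proof -
  note s = dM_summable[OF assms(1,2)] dM_summable[OF assms(2,3)] dM_summable[OF assms(1,3)]
  have "dM M A L C \<le> (\<Sum>k. (1/2)^(Suc k) * hausdorff_LP (Suc k) (profile (Suc k) M A) (profile (Suc k) N B)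
     + (1/2)^(Suc k) * hausdorff_LP (Suc k) (profile (Suc k) N B) (profile (Suc k) L C))"
    unfolding dM_def
  proof (rule suminf_le[OF _ s(3) summable_add[OF s(1,2)]])
    fix k
    have "hausdorff_LP (Suc k) (profile (Suc k) M A) (profile (Suc k) L C)
      \<le> hausdorff_LP (Suc k) (profile (Suc k) M A) (profile (Suc k) N B)
        + hausdorff_LP (Suc k) (profile (Suc k) N B) (profile (Suc k) L C)"
      by (intro hausdorff_LP_triangle profile_borel_prob assms)
    then show "(1/2)^(Suc k) * hausdorff_LP (Suc k) (profile (Suc k) M A) (profile (Suc k) L C)
      \<le> (1/2)^(Suc k) * hausdorff_LP (Suc k) (profile (Suc k) M A) (profile (Suc k) N B)
     + (1/2)^(Suc k) * hausdorff_LP (Suc k) (profile (Suc k) N B) (profile (Suc k) L C)"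
      by (simp flip: distrib_left)
  qed
  also have "\<dots> = dM M A N B + dM N B L C"
    unfolding dM_def by (rule suminf_add[OF s(1,2), symmetric])
  finally show ?thesis .
qed

text \<open>Tannery's theorem: the geometric series dominates because every Hausdorff distance is at
  most 1, so convergence for each fixed \<open>k\<close> suffices.\<close>

lemma dM_tendsto_0:
  assumes "\<And>n. markov_graphop (M n) (A n)" "markov_graphop N B"
    and "\<And>k. (\<lambda>n. hausdorff_LP k (profile k (M n) (A n)) (profile k N B)) \<longlonglongrightarrow> 0"
  shows "(\<lambda>n. dM (M n) (A n) N B) \<longlonglongrightarrow> 0"
proof -
  let ?f = "\<lambda>k n. (1/2)^(Suc k) * hausdorff_LP (Suc k) (profile (Suc k) (M n) (A n)) (profile (Suc k) N B)"
  have "((\<lambda>n. suminf (\<lambda>k. ?f k n)) \<longlongrightarrow> suminf (\<lambda>k. 0)) sequentially"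
  proof (rule tannerys_theorem[where M="\<lambda>k. (1/2)^(Suc k)", THEN conjunct2, THEN conjunct2])
    show "(?f k \<longlongrightarrow> 0) sequentially" for k
      by (rule tendsto_mult_right_zero[OF assms(3)])
    show "summable (\<lambda>k. (1/2)^(Suc k) :: real)" using summable_geometric[of "1/2::real"] by (simp add: summable_mult)
    show "\<forall>\<^sub>F (k, n) in at_top \<times>\<^sub>F sequentially. norm (?f k n) \<le> (1/2)^(Suc k)"
      using hausdorff_LP_bounds[OF profile_borel_prob[OF assms(1)] profile_borel_prob[OF assms(2)]]
      by (intro always_eventually) (auto simp: abs_mult intro!: mult_left_le)
  qed auto
  then show ?thesis by (simp add: dM_def)
qed

section \<open>Markov graphops\<close>

locale markov_op =
  fixes M :: "'a measure" and A :: "('a \<Rightarrow> real) \<Rightarrow> 'a \<Rightarrow> real"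
  assumes markov: "markov_graphop M A"
begin

sublocale prob_space M by (rule markov_graphopD(1)[OF markov])

lemma op_measurable [measurable (raw)]: "v \<in> linf M \<Longrightarrow> A v \<in> borel_measurable M"
  by (rule markov_graphopD(2)[OF markov])

lemma linf_integrable: "v \<in> linf M \<Longrightarrow> integrable M v"
  by (elim linfE) (rule integrable_const_bound, auto)

lemma op_sum:
  assumes "finite I" "\<And>i. i \<in> I \<Longrightarrow> f i \<in> linf M"
  shows "(\<lambda>y. \<Sum>i\<in>I. c i * f i y) \<in> linf M \<and>
         (AE x in M. A (\<lambda>y. \<Sum>i\<in>I. c i * f i y) x = (\<Sum>i\<in>I. c i * A (f i) x))"
  using assms
proof (induction I)
  case empty
  show ?case using markov_graphopD(5)[OF markov linf_const linf_const, of 0 0 0 0] by simp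
next
  case (insert i I)
  then have lin: "f i \<in> linf M" "(\<lambda>y. \<Sum>i\<in>I. c i * f i y) \<in> linf M" by auto
  have "AE x in M. A (\<lambda>y. c i * f i y + 1 * (\<Sum>i\<in>I. c i * f i y)) x = c i * A (f i) x + 1 * A (\<lambda>y. \<Sum>i\<in>I. c i * f i y) x"
    by (rule markov_graphopD(5)[OF markov lin])
  moreover have "AE x in M. A (\<lambda>y. \<Sum>i\<in>I. c i * f i y) x = (\<Sum>i\<in>I. c i * A (f i) x)"
    using insert by auto
  ultimately have "AE x in M. A (\<lambda>y. \<Sum>i\<in>insert i I. c i * f i y) x = (\<Sum>i\<in>insert i I. c i * A (f i) x)"
    by eventually_elim (simp add: insert)
  then show ?case using linf_lincomb[OF lin, of "c i" 1] insert by simp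
qed

lemma op_diff:
  assumes "v \<in> linf M" "w \<in> linf M"
  shows "(\<lambda>y. v y - w y) \<in> linf M" "AE x in M. A (\<lambda>y. v y - w y) x = A v x - A w x"
  using linf_lincomb[OF assms, of 1 "-1"] markov_graphopD(5)[OF markov assms, of 1 "-1"] by simp_all

lemma op_mono:
  assumes "v \<in> linf M" "w \<in> linf M" "AE x in M. v x \<le> w x"
  shows "AE x in M. A v x \<le> A w x"
proof -
  have "AE x in M. 0 \<le> A (\<lambda>y. w y - v y) x"
    by (rule markov_graphopD(7)[OF markov op_diff(1)[OF assms(2,1)]]) (use assms in auto)
  then show ?thesis using op_diff(2)[OF assms(2,1)] by eventually_elim simp
qed

lemma op_const: "AE x in M. A (\<lambda>_. c) x = c"
  using markov_graphopD(5)[OF markov linf_const[of 1] linf_const[of 1], of c 0] markov_graphopD(8)[OF markov]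
  by (auto elim: eventually_elim2)

text \<open>Positivity and 1-regularity together give contraction in L-infinity: \<open>v\<close> is
  squeezed between the constants \<open>-c\<close> and \<open>c\<close>, which \<open>A\<close>
  fixes.\<close>

lemma op_bound:
  assumes "v \<in> linf M" "AE x in M. \<bar>v x\<bar> \<le> c"
  shows "AE x in M. \<bar>A v x\<bar> \<le> c"
proof -
  have "AE x in M. A v x \<le> A (\<lambda>_. c) x"
    by (rule op_mono) (use assms in auto)
  moreover have "AE x in M. A (\<lambda>_. -c) x \<le> A v x"
    by (rule op_mono) (use assms in auto)
  ultimately show ?thesis using op_const[of c] op_const[of "-c"] by eventually_elim auto
qed

lemma op_linf: "v \<in> linf M \<Longrightarrow> A v \<in> linf M"
  by (metis linfE linfI_AE op_bound op_measurable)

lemma linf_abs: "v \<in> linf M \<Longrightarrow> (\<lambda>x. \<bar>v x\<bar>) \<in> linf M"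
  by (auto simp: linf_def)

lemma linf_mult:
  assumes "v \<in> linf M" "w \<in> linf M" shows "(\<lambda>x. v x * w x) \<in> linf M"
  using assms
proof (elim linfE)
  fix c d assume *: "AE x in M. \<bar>v x\<bar> \<le> c" "v \<in> borel_measurable M" "AE x in M. \<bar>w x\<bar> \<le> d" "w \<in> borel_measurable M"
  show ?thesis
  proof (rule linfI_AE[where c="c * d"])
    show "AE x in M. \<bar>v x * w x\<bar> \<le> c * d"
      using *(1,3) by eventually_elim (auto simp: abs_mult intro!: mult_mono)
  qed (use * in measurable)
qed

text \<open>Self-adjointness against the constant 1, which \<open>A\<close> fixes. This is the
  source of the contraction in L1.\<close>

lemma op_integral:
  assumes "v \<in> linf M" shows "(\<integral>x. A v x \<partial>M) = (\<integral>x. v x \<partial>M)"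
proof -
  have "(\<integral>x. A v x * 1 \<partial>M) = (\<integral>x. A (\<lambda>_. 1) x * v x \<partial>M)"
    by (rule markov_graphopD(6)[OF markov assms linf_const])
  also have "\<dots> = (\<integral>x. v x \<partial>M)"
    using op_const[of 1] linf_measurable[OF assms] op_measurable[OF linf_const[of 1]]
    by (intro integral_cong_AE) auto
  finally show ?thesis by simp
qed

text \<open>Monotonicity gives \<open>|A v| \<le> A |v|\<close> almost everywhere, and
  \<open>A |v|\<close> has the integral of \<open>|v|\<close>.\<close>

lemma op_L1:
  assumes v: "v \<in> linf M" shows "(\<integral>x. \<bar>A v x\<bar> \<partial>M) \<le> (\<integral>x. \<bar>v x\<bar> \<partial>M)"
proof -
  have neg: "(\<lambda>x. - \<bar>v x\<bar>) \<in> linf M" "AE x in M. A (\<lambda>x. - \<bar>v x\<bar>) x = - A (\<lambda>x. \<bar>v x\<bar>) x"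
    using linf_lincomb[OF linf_abs[OF v] linf_abs[OF v], of "-1" 0] markov_graphopD(5)[OF markov linf_abs[OF v] linf_abs[OF v], of "-1" 0] by simp_all
  have "AE x in M. A v x \<le> A (\<lambda>x. \<bar>v x\<bar>) x" by (rule op_mono) (use v linf_abs in auto)
  moreover have "AE x in M. A (\<lambda>x. - \<bar>v x\<bar>) x \<le> A v x" by (rule op_mono) (use v neg in auto)
  ultimately have "AE x in M. \<bar>A v x\<bar> \<le> A (\<lambda>x. \<bar>v x\<bar>) x" using neg(2) by eventually_elim auto
  then have "(\<integral>x. \<bar>A v x\<bar> \<partial>M) \<le> (\<integral>x. A (\<lambda>x. \<bar>v x\<bar>) x \<partial>M)"
    using linf_integrable[OF op_linf[OF v]] linf_integrable[OF op_linf[OF linf_abs[OF v]]]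
    by (intro integral_mono_AE) auto
  then show ?thesis by (simp add: op_integral linf_abs v)
qed

lemma op_L1_close:
  assumes "v \<in> linf M" "w \<in> linf M"
  shows "(\<integral>x. \<bar>A v x - A w x\<bar> \<partial>M) \<le> (\<integral>x. \<bar>v x - w x\<bar> \<partial>M)"
proof -
  have "(\<integral>x. \<bar>A v x - A w x\<bar> \<partial>M) = (\<integral>x. \<bar>A (\<lambda>y. v y - w y) x\<bar> \<partial>M)"
    using op_diff[OF assms] assms by (intro integral_cong_AE) auto
  also have "\<dots> \<le> (\<integral>x. \<bar>v x - w x\<bar> \<partial>M)" by (rule op_L1[OF op_diff(1)[OF assms]])
  finally show ?thesis .
qed

text \<open>As \<open>A\<close> contracts L1, moving the inputs also controls the images: the
  \<open>2 * k\<close> coordinates deviate by at most \<open>2 * k * d\<close> in total expectation,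
  and Markov's inequality at level \<open>e\<close> leaves mass at most
  \<open>2 * k * d / e \<le> e\<close>.\<close>

lemma law_close_L1:
  assumes "0 < e" and vs: "\<And>i. i < k \<Longrightarrow> vs i \<in> linf M" and ws: "\<And>i. i < k \<Longrightarrow> ws i \<in> linf M"
    and le: "\<And>i. i < k \<Longrightarrow> (\<integral>x. \<bar>vs i x - ws i x\<bar> \<partial>M) \<le> d" and d: "2 * real k * d \<le> e\<^sup>2"
  shows "levy_prokhorov k (law k M A vs) (law k M A ws) \<le> e"
  unfolding law_def
proof (rule levy_prokhorov_prob_le[OF \<open>0 < e\<close> prob_space_axioms])
  let ?F = "tuple k vs (\<lambda>i. A (vs i))" and ?G = "tuple k ws (\<lambda>i. A (ws i))"
  show "?F \<in> measurable M borel" "?G \<in> measurable M borel"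
    by (rule tuple_op_measurable[OF markov vs] tuple_op_measurable[OF markov ws]; simp)+
  define D where "D x = (\<Sum>i<k. \<bar>vs i x - ws i x\<bar> + \<bar>A (vs i) x - A (ws i) x\<bar>)" for x
  have int: "integrable M (\<lambda>x. \<bar>vs i x - ws i x\<bar>)" "integrable M (\<lambda>x. \<bar>A (vs i) x - A (ws i) x\<bar>)" if "i < k" for i
    using vs[OF that] ws[OF that] by (auto intro!: linf_integrable linf_abs op_diff(1) op_linf)
  have D: "integrable M D" unfolding D_def using int by auto
  have split: "(\<Sum>i<k + n. f i) = (\<Sum>i<k. f i) + (\<Sum>i<n. f (i + k))" for f :: "nat \<Rightarrow> real" and n
    by (induction n) (auto simp: add.commute[of k])
  have le_D: "dist_k k (?F x) (?G x) \<le> D x" for x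
  proof -
    have "dist_k k (?F x) (?G x) \<le> (\<Sum>i<2*k. \<bar>?F x i - ?G x i\<bar>)" by (rule dist_k_le_sum)
    also have "\<dots> = (\<Sum>i<k. \<bar>?F x i - ?G x i\<bar>) + (\<Sum>i<k. \<bar>?F x (i + k) - ?G x (i + k)\<bar>)"
      unfolding mult_2 by (rule split)
    also have "\<dots> = D x" by (simp add: D_def tuple_def sum.distrib)
    finally show ?thesis .
  qed
  have "integral\<^sup>L M D = (\<Sum>i<k. (\<integral>x. \<bar>vs i x - ws i x\<bar> \<partial>M) + (\<integral>x. \<bar>A (vs i) x - A (ws i) x\<bar> \<partial>M))"
    unfolding D_def using int by (simp add: Bochner_Integration.integral_sum Bochner_Integration.integral_add)
  also have "\<dots> \<le> (\<Sum>i<k. d + d)"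
    using le vs ws by (intro sum_mono add_mono order_trans[OF op_L1_close le]) auto
  also have "\<dots> \<le> e\<^sup>2" using d by simp
  finally have "integral\<^sup>L M D \<le> e\<^sup>2" .
  have Dm: "D \<in> borel_measurable M" using D by auto
  have Dn: "0 \<le> D x" for x by (auto simp: D_def intro!: sum_nonneg)
  have "measure M {x\<in>space M. e \<le> dist_k k (?F x) (?G x)} \<le> measure M {x\<in>space M. e \<le> D x}"
    using Dm le_D by (intro finite_measure_mono) (auto intro: order_trans)
  also have "\<dots> \<le> integral\<^sup>L M D / e"
    by (rule integral_Markov_inequality_measure[where A="{}"])
       (use D Dn \<open>0 < e\<close> in auto)
  also have "\<dots> \<le> e" using \<open>integral\<^sup>L M D \<le> e\<^sup>2\<close> \<open>0 < e\<close> by (simp add: divide_le_eq power2_eq_square)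
  finally show "measure M {x\<in>space M. e \<le> dist_k k (?F x) (?G x)} \<le> e" .
qed

end

section \<open>Finitely many types of laws on the cube\<close>

text \<open>One set containing the \<open>k\<close>-profiles of all Markov graphops on all spaces.
  The bound is almost sure because images are controlled only almost everywhere.\<close>

definition cube_laws :: "nat \<Rightarrow> (nat \<Rightarrow> real) measure set" where
  "cube_laws k = {\<mu> \<in> borel_prob. AE x in \<mu>. \<forall>i<2*k. \<bar>x i\<bar> \<le> 1}"

lemma coordinate_measurable [measurable]: "(\<lambda>x::nat\<Rightarrow>real. x i) \<in> borel_measurable borel"
  by (rule borel_measurable_continuous_onI) (rule continuous_on_product_coordinates)

lemma (in markov_op) law_in_cube:
  assumes "admissible k M vs" shows "law k M A vs \<in> cube_laws k"
proof -
  have lin: "vs i \<in> linf M" if "i < k" for i using assms that by (rule admissible_linf)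
  have "AE x in M. \<forall>i\<in>{..<k}. \<bar>A (vs i) x\<bar> \<le> 1"
    using assms by (intro AE_finite_allI op_bound lin) (auto simp: admissible_def)
  then have "AE x in M. \<forall>i<2*k. \<bar>tuple k vs (\<lambda>i. A (vs i)) x i\<bar> \<le> 1"
    using AE_space by eventually_elim (use assms in \<open>auto simp: tuple_def admissible_def\<close>)
  then have "AE x in law k M A vs. \<forall>i<2*k. \<bar>x i\<bar> \<le> 1"
    unfolding law_def by (subst AE_distr_iff) (auto intro: tuple_op_measurable[OF markov lin])
  then show ?thesis using law_borel_prob[OF markov lin] by (simp add: cube_laws_def)
qed

text \<open>Labels are functions or sets and live in types that may be uncountable; with a finite
  range, measurability into the counting space still reduces to single values.\<close>

lemma measurable_finite_range:
  assumes "finite J" "\<And>x. x \<in> space M \<Longrightarrow> f x \<in> J" "\<And>j. j \<in> J \<Longrightarrow> {x\<in>space M. f x = j} \<in> sets M"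
  shows "f \<in> measurable M (count_space UNIV)"
proof (rule measurableI)
  fix S
  have "f -` S \<inter> space M = (\<Union>j\<in>S\<inter>J. {x\<in>space M. f x = j})" using assms(2) by auto
  also have "\<dots> \<in> sets M" using assms by (intro sets.finite_UN) auto
  finally show "f -` S \<inter> space M \<in> sets M" .
qed auto

text \<open>The type of a law lists its rounded masses on the cells of a grid. It is a
  classification and not a finite net because the compactness argument needs representatives from
  inside a given profile, and laws of equal type can stand in for each other.\<close>

lemma totally_bounded_cube_laws:
  assumes "0 < e"
  shows "\<exists>(L::nat) \<tau>. (\<forall>\<mu>. \<tau> \<mu> < L) \<and>
    (\<forall>\<mu>\<in>cube_laws k. \<forall>\<nu>\<in>cube_laws k. \<tau> \<mu> = \<tau> \<nu> \<longrightarrow> levy_prokhorov k \<mu> \<nu> \<le> e)"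
proof -
  define d where "d = e / 2"
  have "0 < d" using assms by (simp add: d_def)
  \<comment> \<open>Mesh \<open>1/m\<close> in each of \<open>2 * k\<close> coordinates keeps the
    distance to the grid point below \<open>d\<close>.\<close>
  obtain m :: nat where m: "2 * real k / d < m" using reals_Archimedean2 by blast
  have "0 \<le> 2 * real k / d" using \<open>0 < d\<close> by simp
  with m have "0 < real m" by linarith
  have m': "2 * real k * (1 / m) < d" using m \<open>0 < d\<close> \<open>0 < real m\<close> by (simp add: field_simps)
  \<comment> \<open>Clamping makes the range finite on the whole space; on the cube it changes
    nothing.\<close>
  define cell :: "(nat \<Rightarrow> real) \<Rightarrow> nat \<Rightarrow> int"
    where "cell x = restrict (\<lambda>i. max (- int m) (min (int m) \<lfloor>x i * m\<rfloor>)) {..<2*k}" for x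
  define C where "C = ({..<2*k} \<rightarrow>\<^sub>E {- int m..int m})"
  define h :: "(nat \<Rightarrow> int) \<Rightarrow> nat \<Rightarrow> real" where "h j i = real_of_int (j i) / m" for j i
  have finC: "finite C" unfolding C_def by (intro finite_PiE) auto
  have cellC: "cell x \<in> C" for x unfolding cell_def C_def by auto
  have cell_eq: "{x. cell x = j} \<in> sets borel" for j
  proof (cases "j \<in> extensional {..<2*k}")
    case True
    then have "{x. cell x = j} = {x. \<forall>i\<in>{..<2*k}. max (- int m) (min (int m) \<lfloor>(x i :: real) * m\<rfloor>) = j i}"
      unfolding cell_def by (force simp: extensional_def fun_eq_iff restrict_def)
    also have "\<dots> = {x \<in> space (borel :: (nat \<Rightarrow> real) measure). \<forall>i\<in>{..<2*k}. max (- int m) (min (int m) \<lfloor>(x i :: real) * m\<rfloor>) = j i}" by simp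
    also have "\<dots> \<in> sets borel"
    proof (intro sets.sets_Collect_finite_All)
      fix i
      have "(\<lambda>x::nat\<Rightarrow>real. \<lfloor>x i * m\<rfloor>) \<in> measurable borel (count_space UNIV)"
        by (rule measurable_compose[OF _ measurable_real_floor]) measurable
      from measurable_sets[OF this, of "{n. max (- int m) (min (int m) n) = j i}"]
      show "{x \<in> space (borel :: (nat \<Rightarrow> real) measure). max (- int m) (min (int m) \<lfloor>(x i :: real) * m\<rfloor>) = j i} \<in> sets borel"
        by (simp add: vimage_def)
    qed auto
    finally show ?thesis .
  next
    case False
    then have "{x. cell x = j} = {}" by (auto simp: cell_def)
    then show ?thesis by simp
  qed
  have cell_meas: "cell \<in> measurable \<mu> (count_space UNIV)" if "sets \<mu> = sets borel" for \<mu>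
    using cell_eq that sets_eq_imp_space_eq[OF that]
    by (intro measurable_finite_range[OF finC]) (auto simp: cellC)
  have dist: "dist_k k x (h (cell x)) < d" if "\<forall>i<2*k. \<bar>x i\<bar> \<le> 1" for x
  proof -
    have "dist_k k x (h (cell x)) \<le> 2 * real k * (1 / m)"
    proof (rule dist_k_le_const)
      fix i assume i: "i < 2*k"
      have a: "\<bar>x i * m\<bar> \<le> m" using that i \<open>0 < real m\<close> by (simp add: abs_mult mult_left_le_one_le)
      then have "- int m \<le> \<lfloor>x i * m\<rfloor>" "\<lfloor>x i * m\<rfloor> \<le> int m" by linarith+
      then have "h (cell x) i = \<lfloor>x i * m\<rfloor> / m" using i by (simp add: h_def cell_def)
      moreover have "\<bar>x i * m - \<lfloor>x i * m\<rfloor>\<bar> \<le> 1" by linarith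
      ultimately show "\<bar>x i - h (cell x) i\<bar> \<le> 1 / m"
        using \<open>0 < real m\<close> by (simp add: field_simps abs_le_iff) linarith
    qed
    then show ?thesis using m' by simp
  qed
  \<comment> \<open>Cell masses are rounded to precision \<open>1/R\<close>; over
    \<open>card C\<close> cells the total discrepancy is then at most
    \<open>e = 2 * d\<close>.\<close>
  obtain R :: nat where R: "real (card C) / e < R" using reals_Archimedean2 by blast
  have "0 \<le> real (card C) / e" using assms by simp
  with R have "0 < real R" by linarith
  have R': "real (card C) * (1 / R) \<le> e" using R assms \<open>0 < real R\<close> by (simp add: field_simps)
  define T where "T = (C \<rightarrow>\<^sub>E {0..int R})"
  define t :: "(nat \<Rightarrow> real) measure \<Rightarrow> (nat \<Rightarrow> int) \<Rightarrow> int"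
    where "t \<mu> = restrict (\<lambda>j. max 0 (min (int R) \<lfloor>R * measure \<mu> {x. cell x = j}\<rfloor>)) C" for \<mu>
  have finT: "finite T" unfolding T_def using finC by (intro finite_PiE) auto
  have tT: "t \<mu> \<in> T" for \<mu> unfolding t_def T_def by auto
  \<comment> \<open>The position of the rounded mass vector in an enumeration of the finite set
    \<open>T\<close>. Clamping in \<open>t\<close> puts every measure there, so the bound
    \<open>card T\<close> holds for all of them.\<close>
  define \<tau> where "\<tau> \<mu> = to_nat_on T (t \<mu>)" for \<mu>
  have "\<tau> \<mu> < card T" for \<mu>
    using to_nat_on_finite[OF finT] tT[of \<mu>] by (auto simp: \<tau>_def bij_betw_def)
  moreover have "levy_prokhorov k \<mu> \<nu> \<le> e" if \<mu>: "\<mu> \<in> cube_laws k" and \<nu>: "\<nu> \<in> cube_laws k" and eq: "\<tau> \<mu> = \<tau> \<nu>" for \<mu> \<nu>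
  proof -
    interpret \<mu>: prob_space \<mu> using \<mu> by (auto simp: cube_laws_def borel_prob_def)
    interpret \<nu>: prob_space \<nu> using \<nu> by (auto simp: cube_laws_def borel_prob_def)
    have sets: "sets \<mu> = sets borel" "sets \<nu> = sets borel" using \<mu> \<nu> by (auto simp: cube_laws_def borel_prob_def)
    note space = sets_eq_imp_space_eq[OF sets(1)] sets_eq_imp_space_eq[OF sets(2)]
    have teq: "t \<mu> = t \<nu>" using eq tT inj_onD[OF inj_on_to_nat_on[OF countable_finite[OF finT]]] by (auto simp: \<tau>_def)
    have diff: "\<bar>measure \<mu> {x. cell x = j} - measure \<nu> {x. cell x = j}\<bar> \<le> 1 / R" if "j \<in> C" for j
    proof -
      let ?a = "measure \<mu> {x. cell x = j}" and ?b = "measure \<nu> {x. cell x = j}"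
      have b: "0 \<le> R * ?a" "R * ?a \<le> R" "0 \<le> R * ?b" "R * ?b \<le> R"
        using \<mu>.prob_le_1 \<nu>.prob_le_1 by (auto simp: mult_left_le)
      then have fl: "0 \<le> \<lfloor>R * ?a\<rfloor>" "\<lfloor>R * ?a\<rfloor> \<le> int R" "0 \<le> \<lfloor>R * ?b\<rfloor>" "\<lfloor>R * ?b\<rfloor> \<le> int R" by linarith+
      have "t \<mu> j = t \<nu> j" using teq by simp
      then have "\<lfloor>R * ?a\<rfloor> = \<lfloor>R * ?b\<rfloor>" using fl that by (simp add: t_def)
      then have "\<bar>R * ?a - R * ?b\<bar> \<le> 1" by linarith
      then show ?thesis using \<open>0 < real R\<close> by (simp add: field_simps abs_le_iff)
    qed
    have "levy_prokhorov k (distr \<mu> borel (\<lambda>x. x)) (distr \<nu> borel (\<lambda>x. x)) \<le> 2 * d"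
    proof (rule levy_prokhorov_labels[where P=cell and Q=cell and J=C and h=h])
      show "AE x in \<mu>. dist_k k x (h (cell x)) < d" "AE x in \<nu>. dist_k k x (h (cell x)) < d"
        using \<mu> \<nu> dist by (auto simp: cube_laws_def elim!: eventually_mono)
      have "(\<Sum>j\<in>C. \<bar>measure \<mu> {x. cell x = j} - measure \<nu> {x. cell x = j}\<bar>) \<le> (\<Sum>j\<in>C. 1 / R)"
        by (intro sum_mono diff)
      also have "\<dots> \<le> 2 * d" using R' by (simp add: d_def)
      finally show "(\<Sum>j\<in>C. \<bar>measure \<mu> {x\<in>space \<mu>. cell x = j} - measure \<nu> {x\<in>space \<nu>. cell x = j}\<bar>) \<le> 2 * d"
        by (simp add: space)
    qed (use \<open>0 < d\<close> finC cellC cell_meas[OF sets(1)] cell_meas[OF sets(2)] measurable_ident_sets[OF sets(1)]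
        measurable_ident_sets[OF sets(2)] \<mu>.prob_space_axioms \<nu>.prob_space_axioms in auto)
    then show ?thesis using sets by (simp add: distr_id2 d_def)
  qed
  ultimately show ?thesis by blast
qed

section \<open>Moving a graphop along an injection\<close>

text \<open>The sigma-algebra on the target consists of preimages under the left inverse
  \<open>d\<close>. Therefore \<open>s\<close> is measurable whatever injection it is, and a point
  \<open>r\<close> outside its range lies in the same measurable sets as \<open>s (d r)\<close>. The
  two spaces thus carry the same measurable functions, and the profiles agree exactly.\<close>

lemma markov_graphop_transport:
  fixes \<Omega> :: "'z measure" and s :: "'z \<Rightarrow> 'r"
  assumes B: "markov_graphop \<Omega> B" and UNIV: "space \<Omega> = UNIV" and "inj s"
  shows "\<exists>(N::'r measure) B'. markov_graphop N B' \<and> (\<forall>k. profile k N B' = profile k \<Omega> B)"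
proof -
  define d where "d = inv s"
  have ds [simp]: "d (s z) = z" for z using \<open>inj s\<close> by (simp add: d_def)
  define N where "N = distr \<Omega> (vimage_algebra UNIV d \<Omega>) s"
  define B' where "B' v r = B (\<lambda>z. v (s z)) (d r)" for v r
  interpret \<Omega>: prob_space \<Omega> by (rule markov_graphopD(1)[OF B])
  have s': "s \<in> measurable \<Omega> (vimage_algebra UNIV d \<Omega>)"
    by (rule measurable_vimage_algebra2) (auto simp: UNIV)
  have s [measurable]: "s \<in> measurable \<Omega> N" using s' by (simp add: N_def)
  have d [measurable]: "d \<in> measurable N \<Omega>"
    unfolding N_def using measurable_vimage_algebra1[of d UNIV \<Omega>] by (simp add: UNIV)
  have spN: "space N = UNIV" by (simp add: N_def)
  have pN: "prob_space N" unfolding N_def by (rule \<Omega>.prob_space_distr[OF s'])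
  have N_eq: "N = distr \<Omega> N s" by (simp add: N_def cong: distr_cong)
  have dN: "distr N \<Omega> d = \<Omega>"
  proof -
    have "distr N \<Omega> d = distr \<Omega> \<Omega> (d \<circ> s)" unfolding N_def by (rule distr_distr) (use s' d in \<open>auto simp: N_def\<close>)
    then show ?thesis by (simp add: comp_def distr_id2)
  qed
  have AE_s: "AE z in \<Omega>. P (s z)" if "AE r in N. P r" for P
    using that by (subst (asm) N_eq) (rule AE_distrD[OF s])
  have AE_d: "AE r in N. P (d r)" if "AE z in \<Omega>. P z" for P
    using that by (subst (asm) dN[symmetric]) (rule AE_distrD[OF d])
  have linf_s: "(\<lambda>z. v (s z)) \<in> linf \<Omega>" if "v \<in> linf N" for v
    using that by (elim linfE) (rule linfI_AE[OF measurable_compose[OF s] AE_s])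
  have int_N: "(\<integral>r. f r \<partial>N) = (\<integral>z. f (s z) \<partial>\<Omega>)" if "f \<in> borel_measurable N" for f :: "'r \<Rightarrow> real"
    by (subst N_eq) (rule integral_distr[OF s that])
  have B'm: "B' v \<in> borel_measurable N" if "v \<in> linf N" for v
    unfolding B'_def using markov_graphopD(2)[OF B linf_s[OF that]] by measurable
  have B'i: "integrable N (B' v)" if "v \<in> linf N" for v
    using markov_graphopD(3)[OF B linf_s[OF that]]
    by (subst N_eq, subst integrable_distr_eq[OF s B'm[OF that]]) (simp add: B'_def)
  have "P_operator N B'"
    unfolding P_operator_def
  proof (intro conjI ballI allI impI pN B'm B'i)
    fix v w assume v: "v \<in> linf N" and w: "w \<in> linf N"
    { assume "AE x in N. v x = w x"
      from AE_s[OF this] show "AE x in N. B' v x = B' w x"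
        unfolding B'_def by (intro AE_d markov_graphopD(4)[OF B linf_s[OF v] linf_s[OF w]]) }
    fix a b :: real
    show "AE x in N. B' (\<lambda>y. a * v y + b * w y) x = a * B' v x + b * B' w x"
      unfolding B'_def by (rule AE_d[OF markov_graphopD(5)[OF B linf_s[OF v] linf_s[OF w]]])
  next
    obtain C where C: "\<forall>v\<in>linf \<Omega>. \<forall>c::real. (AE x in \<Omega>. \<bar>v x\<bar> \<le> c) \<longrightarrow> (\<integral>x. \<bar>B v x\<bar> \<partial>\<Omega>) \<le> C * c"
      using B by (auto simp: markov_graphop_def P_operator_def)
    show "\<exists>C. \<forall>v\<in>linf N. \<forall>c. (AE x in N. \<bar>v x\<bar> \<le> c) \<longrightarrow> (\<integral>x. \<bar>B' v x\<bar> \<partial>N) \<le> C * c"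
    proof (intro exI[of _ C] ballI allI impI)
      fix v c assume v: "v \<in> linf N" and "AE x in N. \<bar>v x\<bar> \<le> c"
      from C[rule_format, OF linf_s[OF v] AE_s[OF this(2)]]
      have "(\<integral>x. \<bar>B (\<lambda>z. v (s z)) x\<bar> \<partial>\<Omega>) \<le> C * c" .
      moreover have "(\<integral>x. \<bar>B' v x\<bar> \<partial>N) = (\<integral>x. \<bar>B' v (s x)\<bar> \<partial>\<Omega>)" using B'm[OF v] by (intro int_N) auto
      ultimately show "(\<integral>x. \<bar>B' v x\<bar> \<partial>N) \<le> C * c" by (simp add: B'_def)
    qed
  qed
  moreover have "self_adjoint_op N B'"
    unfolding self_adjoint_op_def
  proof (intro ballI)
    fix v w assume v: "v \<in> linf N" and w: "w \<in> linf N"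
    have "(\<integral>x. B' v x * w x \<partial>N) = (\<integral>z. B (\<lambda>z. v (s z)) z * w (s z) \<partial>\<Omega>)"
      unfolding int_N[OF borel_measurable_times[OF B'm[OF v] linf_measurable[OF w]]] by (simp add: B'_def)
    also have "\<dots> = (\<integral>z. B (\<lambda>z. w (s z)) z * v (s z) \<partial>\<Omega>)"
      by (rule markov_graphopD(6)[OF B linf_s[OF v] linf_s[OF w]])
    also have "\<dots> = (\<integral>x. B' w x * v x \<partial>N)"
      unfolding int_N[OF borel_measurable_times[OF B'm[OF w] linf_measurable[OF v]]] by (simp add: B'_def)
    finally show "(\<integral>x. B' v x * w x \<partial>N) = (\<integral>x. B' w x * v x \<partial>N)" .
  qed
  moreover have "positivity_preserving N B'"
    unfolding positivity_preserving_def B'_def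
    by (intro ballI impI AE_d markov_graphopD(7)[OF B linf_s] AE_s)
  moreover have "one_regular N B'"
    unfolding one_regular_def B'_def by (rule AE_d[OF markov_graphopD(8)[OF B]])
  ultimately have mN: "markov_graphop N B'" by (simp add: markov_graphop_def)
  have adm_s: "admissible k \<Omega> (\<lambda>i z. vs i (s z))" if "admissible k N vs" for k vs
    using that s by (auto simp: admissible_def spN intro: measurable_compose)
  have adm_d: "admissible k N (\<lambda>i r. us i (d r))" if "admissible k \<Omega> us" for k us
    using that d by (auto simp: admissible_def UNIV intro: measurable_compose)
  have law: "law k N B' vs = law k \<Omega> B (\<lambda>i z. vs i (s z))" if "admissible k N vs" for k vs
  proof -
    have t: "tuple k vs (\<lambda>i. B' (vs i)) \<in> measurable N borel"
      using admissible_linf[OF that] by (intro tuple_op_measurable[OF mN])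
    have "law k N B' vs = distr \<Omega> borel (tuple k vs (\<lambda>i. B' (vs i)) \<circ> s)"
      unfolding law_def by (subst N_eq, rule distr_distr[OF t s])
    also have "tuple k vs (\<lambda>i. B' (vs i)) \<circ> s = tuple k (\<lambda>i z. vs i (s z)) (\<lambda>i. B (\<lambda>z. vs i (s z)))"
      by (auto simp: tuple_def B'_def fun_eq_iff)
    finally show ?thesis by (simp add: law_def)
  qed
  have "profile k N B' = profile k \<Omega> B" for k
  proof (intro equalityI subsetI)
    fix \<mu> assume "\<mu> \<in> profile k N B'"
    then show "\<mu> \<in> profile k \<Omega> B" using law adm_s by (auto simp: profile_eq)
  next
    fix \<mu> assume "\<mu> \<in> profile k \<Omega> B"
    then obtain us where us: "\<mu> = law k \<Omega> B us" "admissible k \<Omega> us" by (auto simp: profile_eq)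
    with law[OF adm_d[OF us(2)]] have "\<mu> = law k N B' (\<lambda>i r. us i (d r))" by simp
    with adm_d[OF us(2)] show "\<mu> \<in> profile k N B'" by (auto simp: profile_eq)
  qed
  with mN show ?thesis by blast
qed

section \<open>Kolmogorov extension for pairs of sets\<close>

text \<open>Choosing \<open>S\<close> outside \<open>J\<close> gives the empty set, so the cylinders
  are closed under intersection.\<close>

definition cyl2 :: "('i set \<times> 'i set) set set" where
  "cyl2 = {{(x, y). x \<inter> J = S \<and> y \<inter> J = T} | J S T. finite J}"

text \<open>The weights \<open>p J\<close> are laws of pairs of subsets of \<open>J\<close>. Writing
  a pair of sets as its pair of indicators turns them into laws on finite powers of the plane, to
  which Kolmogorov extension for Polish factors applies; the limit is decoded back into pairs of
  sets.\<close>

lemma kolmogorov_set_pairs: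
  fixes p :: "'i set \<Rightarrow> 'i set \<Rightarrow> 'i set \<Rightarrow> real"
  assumes nonneg: "\<And>J S T. finite J \<Longrightarrow> S \<subseteq> J \<Longrightarrow> T \<subseteq> J \<Longrightarrow> 0 \<le> p J S T"
    and consistent: "\<And>H J S T. finite H \<Longrightarrow> J \<subseteq> H \<Longrightarrow> S \<subseteq> J \<Longrightarrow> T \<subseteq> J \<Longrightarrow>
      p J S T = (\<Sum>(S', T')\<in>{S'\<in>Pow H. S' \<inter> J = S} \<times> {T'\<in>Pow H. T' \<inter> J = T}. p H S' T')"
    and one: "p {} {} {} = 1"
  shows "\<exists>Q. prob_space Q \<and> sets Q = sigma_sets UNIV cyl2 \<and>
    (\<forall>J S T. finite J \<longrightarrow> S \<subseteq> J \<longrightarrow> T \<subseteq> J \<longrightarrow>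
      measure Q {(x, y). x \<inter> J = S \<and> y \<inter> J = T} = p J S T)"
proof -
  define K where "K J = Pow J \<times> Pow J" for J :: "'i set"
  \<comment> \<open>The value 0 off \<open>K J\<close> extends \<open>p J\<close> to a mass function
    on all pairs of sets.\<close>
  define w where "w J = (\<lambda>(S, T). if (S, T) \<in> K J then p J S T else 0)" for J
  define pm where "pm J = embed_pmf (w J)" for J
  have finK: "finite (K J)" if "finite J" for J using that by (simp add: K_def)
  have w_nonneg: "0 \<le> w J ST" if "finite J" for J ST
    using nonneg[OF that] by (auto simp: w_def K_def split: prod.split)
  have w_sum: "(\<Sum>ST\<in>K J. w J ST) = 1" if "finite J" for J
  proof -
    have "(\<Sum>ST\<in>K J. w J ST) = (\<Sum>(S, T)\<in>K J. p J S T)"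
      by (rule sum.cong) (auto simp: w_def)
    also have "\<dots> = p {} {} {}"
      using consistent[OF that, of "{}" "{}" "{}"] by (simp add: K_def Pow_def)
    finally show ?thesis by (simp add: one)
  qed
  have pm: "pmf (pm J) ST = w J ST" if "finite J" for J ST
    unfolding pm_def
  proof (rule pmf_embed_pmf)
    show "(\<integral>\<^sup>+ x. ennreal (w J x) \<partial>count_space UNIV) = 1"
    proof (subst nn_integral_count_space'[OF finK[OF that]])
      show "ennreal (w J x) = 0" if "x \<notin> K J" for x using that by (auto simp: w_def split: prod.split)
      show "(\<Sum>x\<in>K J. ennreal (w J x)) = 1"
        using w_nonneg[OF that] w_sum[OF that] by (simp add: sum_ennreal)
    qed auto
  qed (rule w_nonneg[OF that])
  have measure_pm: "measure (pm J) A = (\<Sum>ST\<in>A \<inter> K J. w J ST)" if J: "finite J" for J A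
  proof -
    have "measure (pm J) A = measure (pm J) (A \<inter> set_pmf (pm J))" by (simp add: measure_Int_set_pmf)
    also have "A \<inter> set_pmf (pm J) = (A \<inter> K J) \<inter> set_pmf (pm J)"
      using pm[OF J] by (auto simp: set_pmf_iff w_def split: if_splits)
    also have "measure (pm J) \<dots> = measure (pm J) (A \<inter> K J)" by (simp add: measure_Int_set_pmf)
    also have "\<dots> = (\<Sum>ST\<in>A \<inter> K J. pmf (pm J) ST)"
      using finK[OF J] by (intro measure_measure_pmf_finite) auto
    finally show ?thesis by (simp add: pm[OF J])
  qed
  \<comment> \<open>Restriction to a smaller index set; \<open>consistent\<close> says that it
    carries \<open>pm H\<close> to \<open>pm J\<close>.\<close>
  define r :: "'i set \<Rightarrow> 'i set \<times> 'i set \<Rightarrow> 'i set \<times> 'i set" where "r J = (\<lambda>(S, T). (S \<inter> J, T \<inter> J))" for J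
  have map_pm: "map_pmf (r J) (pm H) = pm J" if H: "finite H" and JH: "J \<subseteq> H" for J H
  proof (rule pmf_eqI)
    fix ST :: "'i set \<times> 'i set"
    obtain S T where ST: "ST = (S, T)" by (cases ST)
    have J: "finite J" using finite_subset[OF JH H] .
    have "pmf (map_pmf (r J) (pm H)) ST = (\<Sum>x\<in>(r J -` {ST}) \<inter> K H. w H x)"
      by (simp add: pmf_map measure_pm[OF H])
    also have "\<dots> = w J ST"
    proof (cases "ST \<in> K J")
      case True
      have "(r J -` {ST}) \<inter> K H = {S'\<in>Pow H. S' \<inter> J = S} \<times> {T'\<in>Pow H. T' \<inter> J = T}"
        by (auto simp: r_def K_def ST)
      moreover have "w H x = (case x of (S', T') \<Rightarrow> p H S' T')"
        if "x \<in> {S'\<in>Pow H. S' \<inter> J = S} \<times> {T'\<in>Pow H. T' \<inter> J = T}" for x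
        using that by (auto simp: w_def K_def)
      ultimately show ?thesis
        using True consistent[OF H JH, of S T] by (simp add: w_def K_def ST)
    next
      case False
      then have "(r J -` {ST}) \<inter> K H = {}" by (auto simp: r_def K_def ST)
      then show ?thesis using False by (simp add: w_def ST)
    qed
    finally show "pmf (map_pmf (r J) (pm H)) ST = pmf (pm J) ST" by (simp add: pm[OF J])
  qed
  define enc :: "'i set \<Rightarrow> 'i set \<times> 'i set \<Rightarrow> 'i \<Rightarrow> real \<times> real"
    where "enc J = (\<lambda>(S, T). restrict (\<lambda>i. (indicator S i, indicator T i)) J)" for J
  define P where "P J = distr (measure_pmf (pm J)) (PiM J (\<lambda>_. borel)) (enc J)" for J
  have enc: "enc J \<in> measurable (measure_pmf (pm H)) (PiM J (\<lambda>_. borel))" for J H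
    by (auto simp: enc_def space_PiM)
  interpret polish_projective UNIV P
  proof (intro polish_projective.intro projective_family.intro)
    fix J H :: "'i set" assume JH: "J \<subseteq> H" and H: "finite H"
    have "distr (P H) (PiM J (\<lambda>_. borel)) (\<lambda>f. restrict f J)
      = distr (measure_pmf (pm H)) (PiM J (\<lambda>_. borel)) ((\<lambda>f. restrict f J) \<circ> enc H)"
      unfolding P_def by (intro distr_distr measurable_restrict_subset enc JH)
    also have "(\<lambda>f. restrict f J) \<circ> enc H = enc J \<circ> r J"
      using JH by (auto simp: enc_def r_def fun_eq_iff indicator_def)
    also have "distr (measure_pmf (pm H)) (PiM J (\<lambda>_. borel)) (enc J \<circ> r J)
      = distr (distr (measure_pmf (pm H)) (count_space UNIV) (r J)) (PiM J (\<lambda>_. borel)) (enc J)"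
      using enc by (intro distr_distr[symmetric]) (auto simp: space_PiM enc_def)
    also have "distr (measure_pmf (pm H)) (count_space UNIV) (r J) = measure_pmf (pm J)"
      using map_pm[OF H JH] by (simp flip: map_pmf_rep_eq)
    finally have "distr (P H) (PiM J (\<lambda>_. borel)) (\<lambda>f. restrict f J) = P J" by (simp only: P_def)
    then show "P J = distr (P H) (PiM J (\<lambda>_. borel)) (\<lambda>f. restrict f J)" by (rule sym)
  next
    fix J :: "'i set"
    show "prob_space (P J)"
      unfolding P_def by (intro measure_pmf.prob_space_distr enc)
  qed
  define Z where "Z = sigma UNIV (cyl2 :: ('i set \<times> 'i set) set set)"
  have setsZ: "sets Z = sigma_sets UNIV cyl2" and spaceZ: "space Z = UNIV" by (simp_all add: Z_def)
  \<comment> \<open>Any value other than 1 is read as absence, so every path can be decoded.\<close>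
  define dec :: "('i \<Rightarrow> real \<times> real) \<Rightarrow> 'i set \<times> 'i set"
    where "dec f = ({i. fst (f i) = 1}, {i. snd (f i) = 1})" for f
  define X where "X J S T = {f\<in>space (PiM J (\<lambda>_. borel :: (real \<times> real) measure)). \<forall>i\<in>J. (fst (f i) = 1 \<longleftrightarrow> i \<in> S) \<and> (snd (f i) = 1 \<longleftrightarrow> i \<in> T)}"
    for J S T :: "'i set"
  have basic: "{z::real\<times>real. (fst z = 1 \<longleftrightarrow> a) \<and> (snd z = 1 \<longleftrightarrow> b)} \<in> sets borel" for a b
  proof -
    have [measurable]: "fst \<in> borel_measurable (borel :: (real \<times> real) measure)" "snd \<in> borel_measurable (borel :: (real \<times> real) measure)"
      by (auto intro!: borel_measurable_continuous_onI continuous_intros)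
    have "{z \<in> space (borel :: (real \<times> real) measure). (fst z = 1 \<longleftrightarrow> a) \<and> (snd z = 1 \<longleftrightarrow> b)} \<in> sets borel" by measurable
    then show ?thesis by simp
  qed
  have X: "X J S T \<in> sets (PiM J (\<lambda>_. borel))" if "finite J" for J S T
    unfolding X_def
  proof (intro sets.sets_Collect_finite_All that)
    fix i assume "i \<in> J"
    from measurable_sets[OF measurable_component_singleton[OF this, of "\<lambda>_. borel"] basic[of "i \<in> S" "i \<in> T"]]
    show "{f \<in> space (PiM J (\<lambda>_. borel)). (fst (f i) = 1 \<longleftrightarrow> i \<in> S) \<and> (snd (f i) = 1 \<longleftrightarrow> i \<in> T)} \<in> sets (PiM J (\<lambda>_. borel :: (real \<times> real) measure))"
      by (simp add: vimage_def Int_def conj_commute)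
  qed
  have dec_vimage: "dec -` {(x, y). x \<inter> J = S \<and> y \<inter> J = T} \<inter> space lim = emb UNIV J (X J S T)"
    if "S \<subseteq> J" "T \<subseteq> J" for J S T
  proof -
    have "V \<inter> J = U \<longleftrightarrow> (\<forall>i\<in>J. i \<in> V \<longleftrightarrow> i \<in> U)" if "U \<subseteq> J" for U V :: "'i set"
      using that by blast
    from this[OF that(1)] this[OF that(2)] show ?thesis
      by (auto simp: dec_def X_def prod_emb_def space_PiM)
  qed
  have dec: "dec \<in> measurable lim Z"
    unfolding Z_def
  proof (rule measurable_measure_of)
    fix C :: "('i set \<times> 'i set) set" assume "C \<in> cyl2"
    then obtain J S T where C: "C = {(x, y). x \<inter> J = S \<and> y \<inter> J = T}" "finite J" by (auto simp: cyl2_def)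
    show "dec -` C \<inter> space lim \<in> sets lim"
    proof (cases "S \<subseteq> J \<and> T \<subseteq> J")
      case True
      then have "dec -` C \<inter> space lim = emb UNIV J (X J S T)" using C dec_vimage by simp
      also have "\<dots> \<in> sets (PiM UNIV (\<lambda>_. borel))" using C X by (intro measurable_prod_emb) auto
      finally show ?thesis by simp
    next
      case False
      then have "C = {}" using C by auto
      then show ?thesis by simp
    qed
  qed (auto simp: Z_def)
  have "prob_space (distr lim Z dec)" by (rule P.prob_space_distr[OF dec])
  moreover have "measure (distr lim Z dec) {(x, y). x \<inter> J = S \<and> y \<inter> J = T} = p J S T"
    if J: "finite J" and ST: "S \<subseteq> J" "T \<subseteq> J" for J S T
  proof -
    have C: "{(x, y). x \<inter> J = S \<and> y \<inter> J = T} \<in> sets Z"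
      unfolding setsZ by (rule sigma_sets.Basic) (use J in \<open>auto simp: cyl2_def\<close>)
    have "measure (distr lim Z dec) {(x, y). x \<inter> J = S \<and> y \<inter> J = T} = measure lim (emb UNIV J (X J S T))"
      by (simp only: measure_distr[OF dec C] dec_vimage[OF ST])
    also have "\<dots> = measure (P J) (X J S T)" by (rule measure_lim_emb[OF _ J X[OF J]]) auto
    also have "\<dots> = measure (pm J) (enc J -` X J S T)"
      unfolding P_def by (subst measure_distr[OF enc X[OF J]]) simp
    also have "enc J -` X J S T \<inter> K J = {(S, T)}"
      using ST by (auto simp: enc_def X_def K_def space_PiM indicator_def split: if_splits)
    then have "measure (pm J) (enc J -` X J S T) = p J S T"
      using ST by (simp add: measure_pm[OF J] w_def K_def)
    finally show ?thesis .
  qed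
  ultimately show ?thesis using setsZ by (intro exI[of _ "distr lim Z dec"]) auto
qed

section \<open>Cylinder functions\<close>

text \<open>The limit space consists of pairs, but its measurable sets only depend on the first
  component: on this space the limit operator is a conditional expectation.\<close>

definition cyl1 :: "('i set \<times> 'i set) set set" where
  "cyl1 = {{z. fst z \<inter> J = S} | J S. finite J}"

definition depends_on :: "('i set \<Rightarrow> 'b) \<Rightarrow> 'i set \<Rightarrow> bool" where
  "depends_on f J \<longleftrightarrow> (\<forall>x. f x = f (x \<inter> J))"

lemma depends_onD: "depends_on f J \<Longrightarrow> f (x \<inter> J) = f x"
  by (simp add: depends_on_def)

lemma depends_on_mono: "depends_on f J \<Longrightarrow> J \<subseteq> J' \<Longrightarrow> depends_on f J'"
proof (unfold depends_on_def, rule allI)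
  fix x assume f: "\<forall>x. f x = f (x \<inter> J)" and "J \<subseteq> J'"
  have "f x = f (x \<inter> J)" "f (x \<inter> J') = f (x \<inter> J' \<inter> J)" using f by blast+
  moreover have "x \<inter> J' \<inter> J = x \<inter> J" using \<open>J \<subseteq> J'\<close> by blast
  ultimately show "f x = f (x \<inter> J')" by simp
qed

lemma depends_on_const: "depends_on (\<lambda>_. c) J"
  by (simp add: depends_on_def)

lemma depends_on_sum:
  assumes "\<And>i. i \<in> I \<Longrightarrow> depends_on (f i) J"
  shows "depends_on (\<lambda>x. \<Sum>i\<in>I. c i * f i x :: real) J"
  unfolding depends_on_def by (simp add: depends_onD[OF assms])

text \<open>A subset \<open>S\<close> of \<open>J\<close> represents the atom of all sets with trace
  \<open>S\<close>, so \<open>f S\<close> is the value on that atom. The expansion reduces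
  statements on cylinder functions to atom indicators.\<close>

lemma depends_on_atoms:
  assumes "depends_on f J" "finite J"
  shows "f x = (\<Sum>S\<in>Pow J. f S * of_bool (x \<inter> J = S) :: real)"
proof -
  have "(\<Sum>S\<in>Pow J. f S * of_bool (x \<inter> J = S)) = (\<Sum>S\<in>Pow J. if S = x \<inter> J then f S else 0)"
    by (rule sum.cong) auto
  also have "\<dots> = f (x \<inter> J)" using assms(2) by (subst sum.delta) auto
  also have "\<dots> = f x" using assms(1) by (simp add: depends_on_def)
  finally show ?thesis by simp
qed

lemma depends_on_atom: "depends_on (\<lambda>x. of_bool (x \<inter> J = S) :: real) J"
  by (simp add: depends_on_def)

section \<open>Rounding by thresholds\<close>

text \<open>Rounding down to the grid of mesh \<open>1/m\<close>, written as a count of thresholds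
  passed so that it can be read off from the sets where a function is at least \<open>q\<close>.
  Counting starts at \<open>j = 1\<close>: on \<open>[-1,1]\<close> the threshold -1 is always
  passed and is accounted for by the initial -1.\<close>

definition step :: "nat \<Rightarrow> real \<Rightarrow> real" where
  "step m r = -1 + (\<Sum>j=1..2*m. of_bool (-1 + real j / real m \<le> r)) / real m"

lemma step_close:
  assumes "0 < m" "\<bar>r\<bar> \<le> 1" shows "\<bar>r - step m r\<bar> \<le> 1 / real m"
proof -
  define t where "t = (r + 1) * real m"
  have t: "0 \<le> t" "t \<le> 2 * real m" using assms by (auto simp: t_def abs_le_iff mult_right_mono)
  have "-1 + real j / real m \<le> r \<longleftrightarrow> real j \<le> t" for j
    using assms(1) by (simp add: t_def field_simps)
  then have "(\<Sum>j=1..2*m. of_bool (-1 + real j / real m \<le> r) :: real) = real (card {j\<in>{1..2*m}. real j \<le> t})"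
    by (simp flip: sum.inter_filter add: of_bool_def if_distrib[of real] sum.If_cases Int_def)
  also have "{j\<in>{1..2*m}. real j \<le> t} = {1..nat \<lfloor>t\<rfloor>}"
    using t by (auto simp: le_nat_iff le_floor_iff)
  finally have "step m r = -1 + \<lfloor>t\<rfloor> / real m" using t by (simp add: step_def)
  moreover have "\<bar>t - \<lfloor>t\<rfloor>\<bar> \<le> 1" by linarith
  moreover have "r - (-1 + \<lfloor>t\<rfloor> / real m) = (t - \<lfloor>t\<rfloor>) / real m" using assms(1) by (simp add: t_def field_simps)
  ultimately show ?thesis using assms(1) by (simp add: divide_right_mono)
qed

text \<open>The weights may fail to be monotone in \<open>j\<close>, as happens for approximated
  threshold sets and for arbitrary sets of codes. The value stays in \<open>[-1,1]\<close> all the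
  same, which keeps the approximants admissible.\<close>

lemma step_sum_bound:
  assumes "0 < m" "\<And>j. 0 \<le> b j" "\<And>j. b j \<le> (1::real)"
  shows "\<bar>-1 + (\<Sum>j=1..2*m. b j) / real m\<bar> \<le> 1"
proof -
  have "(\<Sum>j=1..2*m. b j) \<le> (\<Sum>j=1..2*m. 1)" by (intro sum_mono assms)
  then have "(\<Sum>j=1..2*m. b j) \<le> 2 * real m" by simp
  then have "(\<Sum>j=1..2*m. b j) / real m \<le> 2" using assms(1) by (simp add: divide_le_eq)
  moreover have "0 \<le> (\<Sum>j=1..2*m. b j) / real m" using assms by (intro divide_nonneg_nonneg sum_nonneg) auto
  ultimately show ?thesis by (simp add: abs_le_iff)
qed

locale cylinder_space = prob_space \<Omega> for \<Omega> :: "('i set \<times> 'i set) measure" +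
  assumes sets_\<Omega>: "sets \<Omega> = sigma_sets UNIV cyl1"
begin

lemma space_\<Omega> [simp]: "space \<Omega> = UNIV"
proof -
  have "UNIV \<in> sets \<Omega>" by (simp add: sets_\<Omega> sigma_sets_top)
  then show ?thesis using sets.sets_into_space by blast
qed

lemma atom_measurable:
  assumes "finite J" shows "{z. fst z \<inter> J = S} \<in> sets \<Omega>"
  unfolding sets_\<Omega> using assms by (intro sigma_sets.Basic) (auto simp: cyl1_def)

lemma restriction_measurable:
  assumes "finite J" shows "(\<lambda>z. fst z \<inter> J) \<in> measurable \<Omega> (count_space UNIV)"
  using assms by (intro measurable_finite_range[of "Pow J"]) (auto simp: atom_measurable)

lemma depends_on_measurable:
  assumes "depends_on f J" "finite J" shows "(\<lambda>z. f (fst z)) \<in> measurable \<Omega> (count_space UNIV)"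
proof -
  have "(\<lambda>z. f (fst z \<inter> J)) \<in> measurable \<Omega> (count_space UNIV)"
    by (rule measurable_compose[OF restriction_measurable[OF assms(2)]]) simp
  then show ?thesis by (simp add: depends_onD[OF assms(1)])
qed

lemma depends_on_borel:
  assumes "depends_on (f :: _ \<Rightarrow> real) J" "finite J" shows "(\<lambda>z. f (fst z)) \<in> borel_measurable \<Omega>"
  using measurable_compose[OF depends_on_measurable[OF assms], of "\<lambda>x. x" borel] by simp

lemma depends_on_linf:
  assumes "depends_on (f :: _ \<Rightarrow> real) J" "finite J" shows "(\<lambda>z. f (fst z)) \<in> linf \<Omega>"
proof (rule linfI[where c="Max ((\<lambda>S. \<bar>f S\<bar>) ` Pow J)"])
  fix z
  have "\<bar>f (fst z)\<bar> = \<bar>f (fst z \<inter> J)\<bar>" using assms(1) by (simp add: depends_on_def)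
  also have "\<dots> \<le> Max ((\<lambda>S. \<bar>f S\<bar>) ` Pow J)" using assms(2) by (intro Max_ge) auto
  finally show "\<bar>f (fst z)\<bar> \<le> Max ((\<lambda>S. \<bar>f S\<bar>) ` Pow J)" .
qed (rule depends_on_borel[OF assms])

lemma predicate_measurable:
  assumes "depends_on c J" "finite J" shows "{z. c (fst z)} \<in> sets \<Omega>"
  using measurable_sets[OF depends_on_measurable[OF assms], of "{True}"] by (simp add: vimage_def)

section \<open>L1 approximation by cylinder functions\<close>

text \<open>Induction over the generated sigma-algebra, with the tolerance left arbitrary so that in
  a countable union each of the first \<open>n\<close> members can be given a share of it.\<close>

lemma approximate_set:
  assumes "A \<in> sets \<Omega>" "0 < e"
  shows "\<exists>J c. finite J \<and> depends_on c J \<and> measure \<Omega> {z. (z \<in> A) \<noteq> c (fst z)} < e"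
  using assms(1)[unfolded sets_\<Omega>] assms(2)
proof (induction arbitrary: e)
  case (Basic A)
  then obtain J S where A: "A = {z. fst z \<inter> J = S}" "finite J" by (auto simp: cyl1_def)
  have "measure \<Omega> {z. (z \<in> A) \<noteq> (fst z \<inter> J = S)} < e" using Basic by (simp add: A)
  moreover have "depends_on (\<lambda>x. x \<inter> J = S) J" by (auto simp: depends_on_def)
  ultimately show ?case using A(2) by blast
next
  case Empty
  then show ?case by (intro exI[of _ "{}"] exI[of _ "\<lambda>_. False"]) (auto simp: depends_on_def)
next
  case (Compl A)
  then obtain J c where Jc: "finite J" "depends_on c J" "measure \<Omega> {z. (z \<in> A) \<noteq> c (fst z)} < e" by blast
  have "{z. (z \<in> UNIV - A) \<noteq> (\<not> c (fst z))} = {z. (z \<in> A) \<noteq> c (fst z)}" by auto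
  then have "measure \<Omega> {z. (z \<in> UNIV - A) \<noteq> (\<not> c (fst z))} < e" using Jc(3) by simp
  moreover have "depends_on (\<lambda>x. \<not> c x) J" using Jc(2) by (simp add: depends_on_def)
  ultimately show ?case using Jc(1) by blast
next
  case (Union A)
  have A: "A i \<in> sets \<Omega>" for i using Union(1) by (simp add: sets_\<Omega>)
  define U where "U n = (\<Union>i<n. A i)" for n
  have U: "U n \<in> sets \<Omega>" "(\<Union>i. A i) \<in> sets \<Omega>" for n using A by (auto simp: U_def)
  have "(\<lambda>n. measure \<Omega> (U n)) \<longlonglongrightarrow> measure \<Omega> (\<Union>n. U n)"
    using U(1) by (intro finite_Lim_measure_incseq) (auto simp: U_def incseq_def intro: less_le_trans)
  moreover have "(\<Union>n. U n) = (\<Union>i. A i)" by (auto simp: U_def)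
  ultimately have "(\<lambda>n. measure \<Omega> (U n)) \<longlonglongrightarrow> measure \<Omega> (\<Union>i. A i)" by simp
  then have "eventually (\<lambda>n. measure \<Omega> (\<Union>i. A i) - e/2 < measure \<Omega> (U n)) sequentially"
    using Union(3) by (intro order_tendstoD(1)) auto
  then obtain n where n: "measure \<Omega> (\<Union>i. A i) - e/2 < measure \<Omega> (U n)" by (auto simp: eventually_sequentially)
  \<comment> \<open>With this error \<open>n\<close> members sum to at most \<open>e/2\<close>; the
    \<open>+ 1\<close> keeps the tolerance positive for \<open>n = 0\<close>.\<close>
  have d: "0 < e / (2 * (real n + 1))" using Union(3) by simp
  have "\<forall>i. \<exists>J c. finite J \<and> depends_on c J \<and> measure \<Omega> {z. (z \<in> A i) \<noteq> c (fst z)} < e / (2 * (real n + 1))"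
    using Union(2)[OF d] by blast
  from choice[OF this] obtain J where
    "\<forall>i. \<exists>c. finite (J i) \<and> depends_on c (J i) \<and> measure \<Omega> {z. (z \<in> A i) \<noteq> c (fst z)} < e / (2 * (real n + 1))" ..
  from choice[OF this] obtain c where
    "\<forall>i. finite (J i) \<and> depends_on (c i) (J i) \<and> measure \<Omega> {z. (z \<in> A i) \<noteq> c i (fst z)} < e / (2 * (real n + 1))" ..
  then have Jc: "\<And>i. finite (J i)" "\<And>i. depends_on (c i) (J i)"
    "\<And>i. measure \<Omega> {z. (z \<in> A i) \<noteq> c i (fst z)} < e / (2 * (real n + 1))" by blast+
  define c' where "c' x \<longleftrightarrow> (\<exists>i<n. c i x)" for x
  have c': "depends_on c' (\<Union>i<n. J i)"
    unfolding depends_on_def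
  proof
    fix x
    have "c i x = c i (x \<inter> (\<Union>i<n. J i))" if "i < n" for i
      using depends_on_mono[OF Jc(2)[of i], of "\<Union>i<n. J i"] that by (auto simp: depends_on_def)
    then show "c' x = c' (x \<inter> (\<Union>i<n. J i))" by (auto simp: c'_def)
  qed
  have D: "{z. (z \<in> A i) \<noteq> c i (fst z)} \<in> sets \<Omega>" for i
  proof -
    have "{z. (z \<in> A i) \<noteq> c i (fst z)} = (A i - {z. c i (fst z)}) \<union> ({z. c i (fst z)} - A i)" by auto
    also have "\<dots> \<in> sets \<Omega>" using A predicate_measurable[OF Jc(2,1)] by auto
    finally show ?thesis .
  qed
  have "measure \<Omega> {z. (z \<in> (\<Union>i. A i)) \<noteq> c' (fst z)}
    \<le> measure \<Omega> (((\<Union>i. A i) - U n) \<union> (\<Union>i<n. {z. (z \<in> A i) \<noteq> c i (fst z)}))"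
    using U D by (intro finite_measure_mono) (auto simp: U_def c'_def)
  also have "\<dots> \<le> measure \<Omega> ((\<Union>i. A i) - U n) + measure \<Omega> (\<Union>i<n. {z. (z \<in> A i) \<noteq> c i (fst z)})"
    using U D by (intro measure_Un_le) auto
  also have "measure \<Omega> ((\<Union>i. A i) - U n) = measure \<Omega> (\<Union>i. A i) - measure \<Omega> (U n)"
    using U by (intro finite_measure_Diff) (auto simp: U_def)
  also have "measure \<Omega> (\<Union>i<n. {z. (z \<in> A i) \<noteq> c i (fst z)}) \<le> (\<Sum>i<n. measure \<Omega> {z. (z \<in> A i) \<noteq> c i (fst z)})"
    using D by (intro measure_UNION_le) auto
  also have "\<dots> \<le> (\<Sum>i<n. e / (2 * (real n + 1)))" using Jc(3) by (intro sum_mono) (auto intro: less_imp_le)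
  also have "\<dots> = real n * e / (2 * (real n + 1))" by simp
  also have "\<dots> \<le> e / 2" using Union(3) by (simp add: field_simps)
  finally have "measure \<Omega> {z. (z \<in> (\<Union>i. A i)) \<noteq> c' (fst z)} < e" using n by simp
  then show ?case using c' Jc(1) by (intro exI[of _ "\<Union>i<n. J i"] exI[of _ c']) auto
qed

text \<open>Rounding costs \<open>1/m \<le> e/2\<close>. Replacing each of the \<open>2 * m\<close>
  threshold sets by a cylinder event with error \<open>e/4\<close> costs
  \<open>2 * m * (e/4) / m = e/2\<close>. The bound 1 holds at every set of codes, so
  \<open>f\<close> can be evaluated on other coded spaces and stays admissible there.\<close>

lemma approximate_function:
  fixes v :: "'i set \<times> 'i set \<Rightarrow> real"
  assumes v: "v \<in> borel_measurable \<Omega>" "\<And>z. \<bar>v z\<bar> \<le> 1" and "0 < e"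
  shows "\<exists>J f. finite J \<and> depends_on f J \<and> (\<forall>x. \<bar>f x\<bar> \<le> 1) \<and> (\<integral>z. \<bar>v z - f (fst z)\<bar> \<partial>\<Omega>) \<le> e"
proof -
  obtain m :: nat where m: "2 / e < m" using reals_Archimedean2 by blast
  with assms(3) have "0 < real m" by (smt (verit) divide_pos_pos)
  have m': "1 / m \<le> e / 2" using m assms(3) \<open>0 < real m\<close> by (simp add: field_simps)
  define A where "A j = {z. -1 + real j / real m \<le> v z}" for j
  have A: "A j \<in> sets \<Omega>" for j
    using measurable_sets[OF v(1), of "{-1 + real j / real m..}"] by (simp add: A_def vimage_def)
  have "\<forall>j. \<exists>J c. finite J \<and> depends_on c J \<and> measure \<Omega> {z. (z \<in> A j) \<noteq> c (fst z)} < e / 4"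
    using assms(3) by (intro allI approximate_set A) simp
  from choice[OF this] obtain J where
    "\<forall>j. \<exists>c. finite (J j) \<and> depends_on c (J j) \<and> measure \<Omega> {z. (z \<in> A j) \<noteq> c (fst z)} < e / 4" ..
  from choice[OF this] obtain c where
    "\<forall>j. finite (J j) \<and> depends_on (c j) (J j) \<and> measure \<Omega> {z. (z \<in> A j) \<noteq> c j (fst z)} < e / 4" ..
  then have Jc: "\<And>j. finite (J j)" "\<And>j. depends_on (c j) (J j)"
    "\<And>j. measure \<Omega> {z. (z \<in> A j) \<noteq> c j (fst z)} < e / 4" by blast+
  define f :: "'i set \<Rightarrow> real" where "f x = -1 + (\<Sum>j=1..2*m. of_bool (c j x)) / m" for x
  let ?J = "\<Union>j\<in>{1..2*m}. J j"
  have f_dep: "depends_on f ?J"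
    unfolding depends_on_def
  proof
    fix x
    have "c j x = c j (x \<inter> ?J)" if "j \<in> {1..2*m}" for j
    proof -
      have "J j \<subseteq> ?J" using that by blast
      from depends_on_mono[OF Jc(2) this] show ?thesis by (simp only: depends_on_def)
    qed
    then have "(\<Sum>j=1..2*m. of_bool (c j x) :: real) = (\<Sum>j=1..2*m. of_bool (c j (x \<inter> ?J)))" by (intro sum.cong) simp_all
    then show "f x = f (x \<inter> ?J)" by (simp only: f_def)
  qed
  have f_bound: "\<bar>f x\<bar> \<le> 1" for x unfolding f_def using \<open>0 < real m\<close> by (intro step_sum_bound) auto
  have fm: "(\<lambda>z. f (fst z)) \<in> borel_measurable \<Omega>" using Jc(1) by (intro depends_on_borel[OF f_dep]) auto
  have D: "{z. (z \<in> A j) \<noteq> c j (fst z)} \<in> sets \<Omega>" for j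
  proof -
    have "{z. (z \<in> A j) \<noteq> c j (fst z)} = (A j - {z. c j (fst z)}) \<union> ({z. c j (fst z)} - A j)" by auto
    also have "\<dots> \<in> sets \<Omega>" using A predicate_measurable[OF Jc(2,1)] by auto
    finally show ?thesis .
  qed
  let ?d = "\<lambda>j z. indicator {z. (z \<in> A j) \<noteq> c j (fst z)} z :: real"
  have int_d: "integrable \<Omega> (?d j)" for j using D by (simp add: integrable_indicator_iff emeasure_eq_measure)
  have "\<bar>v z - f (fst z)\<bar> \<le> 1 / m + (\<Sum>j=1..2*m. ?d j z) / m" for z
  proof -
    have "\<bar>v z - step m (v z)\<bar> \<le> 1 / m" using \<open>0 < real m\<close> v(2) by (intro step_close) auto
    moreover have "step m (v z) - f (fst z) = (\<Sum>j=1..2*m. of_bool (z \<in> A j) - of_bool (c j (fst z))) / m"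
      by (simp add: step_def f_def A_def sum_subtractf diff_divide_distrib)
    moreover have "\<bar>\<Sum>j=1..2*m. of_bool (z \<in> A j) - of_bool (c j (fst z)) :: real\<bar> \<le> (\<Sum>j=1..2*m. ?d j z)"
      by (intro order_trans[OF sum_abs] sum_mono) (auto simp: indicator_def)
    then have "\<bar>(\<Sum>j=1..2*m. of_bool (z \<in> A j) - of_bool (c j (fst z)) :: real) / m\<bar> \<le> (\<Sum>j=1..2*m. ?d j z) / m"
      by (simp add: divide_right_mono)
    ultimately show ?thesis by linarith
  qed
  then have "(\<integral>z. \<bar>v z - f (fst z)\<bar> \<partial>\<Omega>) \<le> (\<integral>z. 1 / m + (\<Sum>j=1..2*m. ?d j z) / m \<partial>\<Omega>)"
    using v fm f_bound int_d
    by (intro integral_mono integrable_abs Bochner_Integration.integrable_diff)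
       (auto intro!: integrable_const_bound[where B=1])
  also have "\<dots> = 1 / m + (\<Sum>j=1..2*m. measure \<Omega> {z. (z \<in> A j) \<noteq> c j (fst z)}) / m"
    using int_d D by (simp add: prob_space[unfolded space_\<Omega>])
  also have "(\<Sum>j=1..2*m. measure \<Omega> {z. (z \<in> A j) \<noteq> c j (fst z)}) \<le> (\<Sum>j=1..2*m. e / 4)"
    using Jc(3) by (intro sum_mono) (auto intro: less_imp_le)
  then have "(\<Sum>j=1..2*m. measure \<Omega> {z. (z \<in> A j) \<noteq> c j (fst z)}) / m \<le> (\<Sum>j=1..2*m. e / 4) / m"
    by (rule divide_right_mono) simp
  then have "1 / m + (\<Sum>j=1..2*m. measure \<Omega> {z. (z \<in> A j) \<noteq> c j (fst z)}) / m \<le> e / 2 + e / 2"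
    using m' \<open>0 < real m\<close> by (intro add_mono) simp_all
  finally show ?thesis using f_dep f_bound Jc(1) by (intro exI[of _ ?J] exI[of _ f]) simp
qed

text \<open>If \<open>D\<close> were positive with positive probability, a cylinder event close to
  \<open>{D > 0}\<close> would give a positive integral. This turns inequalities tested on
  cylinders, which pass to limits of forms, into almost sure ones.\<close>

lemma cylinder_sign_test:
  assumes D: "D \<in> linf \<Omega>"
    and test: "\<And>J c. finite J \<Longrightarrow> depends_on c J \<Longrightarrow> (\<integral>z. D z * of_bool (c (fst z)) \<partial>\<Omega>) \<le> 0"
  shows "AE z in \<Omega>. D z \<le> 0"
proof -
  obtain b' where b': "AE z in \<Omega>. \<bar>D z\<bar> \<le> b'" and Dm [measurable]: "D \<in> borel_measurable \<Omega>"
    using D by (rule linfE)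
  \<comment> \<open>At least 1, so that \<open>e / b\<close> is a positive tolerance.\<close>
  define b where "b = max b' 1"
  have b: "AE z in \<Omega>. \<bar>D z\<bar> \<le> b" "0 < b" using b' by (auto simp: b_def elim: eventually_mono)
  define A where "A = {z. 0 < D z}"
  have A: "A \<in> sets \<Omega>" using measurable_sets[OF Dm, of "{0<..}"] by (simp add: A_def vimage_def)
  have int: "integrable \<Omega> (\<lambda>z. D z * g z)" if "g \<in> borel_measurable \<Omega>" "\<And>z. \<bar>g z\<bar> \<le> 1" for g
  proof (rule integrable_const_bound[where B=b])
    show "AE z in \<Omega>. norm (D z * g z) \<le> b"
      using b(1)
    proof eventually_elim
      case (elim z)
      then show ?case using that(2)[of z] mult_mono[of "\<bar>D z\<bar>" b "\<bar>g z\<bar>" 1] b(2) by (simp add: abs_mult)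
    qed
  qed (use that in measurable)
  have "(\<integral>z. D z * indicator A z \<partial>\<Omega>) \<le> 0"
  proof (rule field_le_epsilon)
    fix e :: real assume "0 < e"
    then have "0 < e / b" using b by simp
    from approximate_set[OF A this] obtain J c where
      Jc: "finite J" "depends_on c J" "measure \<Omega> {z. (z \<in> A) \<noteq> c (fst z)} < e / b" by blast
    let ?C = "{z. c (fst z)}"
    have C: "?C \<in> sets \<Omega>" by (rule predicate_measurable[OF Jc(2,1)])
    have "{z. (z \<in> A) \<noteq> c (fst z)} = (A - ?C) \<union> (?C - A)" by auto
    then have S: "{z. (z \<in> A) \<noteq> c (fst z)} \<in> sets \<Omega>" using A C by auto
    \<comment> \<open>Passing from \<open>A\<close> to the cylinder event changes the integrand only
      on the symmetric difference, and there by at most \<open>b\<close>.\<close>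
    have "(\<integral>z. D z * indicator A z \<partial>\<Omega>)
      \<le> (\<integral>z. D z * indicator ?C z + b * indicator {z. (z \<in> A) \<noteq> c (fst z)} z \<partial>\<Omega>)"
    proof (rule integral_mono_AE)
      show "integrable \<Omega> (\<lambda>z. D z * indicator A z)" using A by (intro int) (auto simp: indicator_def)
      show "integrable \<Omega> (\<lambda>z. D z * indicator ?C z + b * indicator {z. (z \<in> A) \<noteq> c (fst z)} z)"
        using S by (intro Bochner_Integration.integrable_add int borel_measurable_indicator C
            integrable_mult_right integrable_real_indicator) (simp_all add: emeasure_eq_measure indicator_def)
      show "AE z in \<Omega>. D z * indicator A z \<le> D z * indicator ?C z + b * indicator {z. (z \<in> A) \<noteq> c (fst z)} z"
        using b(1) by eventually_elim (auto simp: indicator_def)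
    qed
    also have "\<dots> = (\<integral>z. D z * of_bool (c (fst z)) \<partial>\<Omega>) + b * measure \<Omega> {z. (z \<in> A) \<noteq> c (fst z)}"
    proof -
      have "integrable \<Omega> (\<lambda>z. D z * indicator ?C z)" by (intro int borel_measurable_indicator C) (simp add: indicator_def)
      moreover have "integrable \<Omega> (\<lambda>z. b * indicator {z. (z \<in> A) \<noteq> c (fst z)} z)"
        using S by (intro integrable_mult_right integrable_real_indicator) (auto simp: emeasure_eq_measure)
      moreover have "indicator ?C z = (of_bool (c (fst z)) :: real)" for z :: "'i set \<times> 'i set" by (simp add: indicator_def)
      ultimately show ?thesis using S by simp
    qed
    also have "\<dots> \<le> 0 + b * (e / b)"
      using test[OF Jc(1,2)] Jc(3) b(2) by (intro add_mono mult_left_mono) auto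
    also have "\<dots> = 0 + e" using b(2) by simp
    finally show "(\<integral>z. D z * indicator A z \<partial>\<Omega>) \<le> 0 + e" .
  qed
  moreover have nn: "0 \<le> D z * indicator A z" for z by (auto simp: A_def indicator_def)
  then have "0 \<le> (\<integral>z. D z * indicator A z \<partial>\<Omega>)" by simp
  ultimately have "(\<integral>z. D z * indicator A z \<partial>\<Omega>) = 0" by simp
  moreover have "integrable \<Omega> (\<lambda>z. D z * indicator A z)" using A by (intro int) (auto simp: indicator_def)
  ultimately have "AE z in \<Omega>. D z * indicator A z = 0"
    using nn by (subst (asm) integral_nonneg_eq_0_iff_AE) auto
  then show ?thesis by eventually_elim (auto simp: A_def indicator_def split: if_splits)
qed

end

section \<open>The graphop of a symmetric measure on pairs\<close>

locale symmetric_pair = Q: prob_space Q for Q :: "('i set \<times> 'i set) measure" +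
  assumes sets_Q: "sets Q = sigma_sets UNIV cyl2"
    and symmetric: "\<And>J S T. finite J \<Longrightarrow>
      measure Q {(x, y). x \<inter> J = S \<and> y \<inter> J = T} = measure Q {(x, y). x \<inter> J = T \<and> y \<inter> J = S}"
begin

lemma space_Q [simp]: "space Q = UNIV"
proof -
  have "UNIV \<in> sets Q" by (simp add: sets_Q sigma_sets_top)
  then show ?thesis using sets.sets_into_space by blast
qed

lemma cyl2_sets: "finite J \<Longrightarrow> {(x, y). x \<inter> J = S \<and> y \<inter> J = T} \<in> sets Q"
  unfolding sets_Q by (rule sigma_sets.Basic) (auto simp: cyl2_def)

definition F where "F = sigma UNIV (cyl1 :: ('i set \<times> 'i set) set set)"

lemma sets_F: "sets F = sigma_sets UNIV cyl1" and space_F: "space F = UNIV"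
  by (simp_all add: F_def)

text \<open>One pair cylinder for each trace of the second component: for finite \<open>J\<close>
  this makes events on the first component measurable for \<open>Q\<close>, so that \<open>F\<close>
  is a subalgebra.\<close>

lemma first_atom:
  fixes J S :: "'i set"
  shows "{z. fst z \<inter> J = S} = (\<Union>T\<in>Pow J. {(x, y). x \<inter> J = S \<and> y \<inter> J = T})"
proof (intro equalityI subsetI)
  fix z :: "'i set \<times> 'i set" assume "z \<in> {z. fst z \<inter> J = S}"
  then show "z \<in> (\<Union>T\<in>Pow J. {(x, y). x \<inter> J = S \<and> y \<inter> J = T})"
    by (intro UN_I[of "snd z \<inter> J"]) (simp_all add: mem_Times_iff)
next
  fix z :: "'i set \<times> 'i set" assume "z \<in> (\<Union>T\<in>Pow J. {(x, y). x \<inter> J = S \<and> y \<inter> J = T})"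
  then show "z \<in> {z. fst z \<inter> J = S}" by (auto simp: mem_Times_iff)
qed

lemma subalgebra_F: "subalgebra Q F"
  unfolding subalgebra_def
proof
  show "space F = space Q" by (simp add: space_F)
  have "C \<in> sets Q" if "C \<in> cyl1" for C :: "('i set \<times> 'i set) set"
  proof -
    obtain J S where C: "C = {z. fst z \<inter> J = S}" "finite J" using \<open>C \<in> cyl1\<close> by (auto simp: cyl1_def)
    then show ?thesis unfolding C(1) first_atom by (intro sets.finite_UN cyl2_sets) auto
  qed
  then have "sigma_sets (space Q) cyl1 \<subseteq> sets Q" by (intro sets.sigma_sets_subset) auto
  then show "sets F \<subseteq> sets Q" by (simp add: sets_F)
qed

sublocale finite_measure_subalgebra Q F
  by unfold_locales (rule subalgebra_F)

text \<open>The first marginal, kept on the space of pairs: functions on it and on \<open>Q\<close>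
  have the same arguments, so conditional expectation given \<open>F\<close> acts on them directly,
  without a kernel.\<close>

definition \<Omega> where "\<Omega> = restr_to_subalg Q F"

sublocale \<Omega>: cylinder_space \<Omega>
proof (intro cylinder_space.intro cylinder_space_axioms.intro)
  show "prob_space \<Omega>"
    unfolding \<Omega>_def by (rule prob_space_restr_to_subalg[OF subalgebra_F Q.prob_space_axioms])
  show "sets \<Omega> = sigma_sets UNIV cyl1" by (simp add: \<Omega>_def sets_restr_to_subalg[OF subalgebra_F] sets_F)
qed

lemma measurable_\<Omega>: "f \<in> measurable \<Omega> N \<longleftrightarrow> f \<in> measurable F N"
  by (simp add: \<Omega>_def measurable_cong_sets[OF sets_restr_to_subalg[OF subalgebra_F] refl])

lemma measurable_\<Omega>_Q: "f \<in> measurable \<Omega> N \<Longrightarrow> f \<in> measurable Q N"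
  using measurable_from_subalg[OF subalgebra_F] by (simp add: measurable_\<Omega>)

lemma AE_\<Omega>_Q: "AE z in \<Omega>. P z \<Longrightarrow> AE z in Q. P z"
  unfolding \<Omega>_def by (rule AE_restr_to_subalg[OF subalgebra_F])

text \<open>A \<open>Q\<close>-null set need not be covered by a null set of \<open>F\<close>, so
  the way back asks for an \<open>F\<close>-measurable predicate.\<close>

lemma AE_Q_\<Omega>: "AE z in Q. P z \<Longrightarrow> Measurable.pred \<Omega> P \<Longrightarrow> AE z in \<Omega>. P z"
  unfolding \<Omega>_def using measurable_\<Omega>[of P] by (intro AE_restr_to_subalg2[OF subalgebra_F]) (simp_all add: \<Omega>_def)

lemma integral_\<Omega>: "f \<in> borel_measurable \<Omega> \<Longrightarrow> (\<integral>z. f z \<partial>\<Omega>) = (\<integral>z. f z \<partial>Q)" for f :: "_ \<Rightarrow> real"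
  unfolding \<Omega>_def using measurable_\<Omega>[of f] by (intro integral_subalgebra2[OF subalgebra_F]) (simp add: \<Omega>_def)

lemma swap_measurable: "prod.swap \<in> measurable Q Q"
proof -
  have "prod.swap \<in> measurable Q (sigma UNIV cyl2)"
  proof (rule measurable_measure_of)
    fix C :: "('i set \<times> 'i set) set" assume "C \<in> cyl2"
    then obtain J S T where C: "C = {(x, y). x \<inter> J = S \<and> y \<inter> J = T}" "finite J" by (auto simp: cyl2_def)
    have "prod.swap -` C \<inter> space Q = {(x, y). x \<inter> J = T \<and> y \<inter> J = S}" by (auto simp: C)
    then show "prod.swap -` C \<inter> space Q \<in> sets Q" using cyl2_sets[OF C(2)] by simp
  qed auto
  also have "measurable Q (sigma UNIV cyl2) = measurable Q Q"
    by (rule measurable_cong_sets) (simp_all add: sets_Q)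
  finally show ?thesis .
qed

lemma Int_stable_cyl2: "Int_stable (cyl2 :: ('i set \<times> 'i set) set set)"
proof (rule Int_stableI)
  fix C D :: "('i set \<times> 'i set) set" assume "C \<in> cyl2" "D \<in> cyl2"
  then obtain J S T J' S' T' where
    C: "C = {(x, y). x \<inter> J = S \<and> y \<inter> J = T}" "finite J" and
    D: "D = {(x, y). x \<inter> J' = S' \<and> y \<inter> J' = T'}" "finite J'" by (auto simp: cyl2_def)
  show "C \<inter> D \<in> cyl2"
  proof (cases "C \<inter> D = {}")
    case True
    have "{} = {(x, y). x \<inter> {} = {a} \<and> y \<inter> {} = {a}}" for a :: 'i by auto
    then show ?thesis unfolding True cyl2_def by blast
  next
    case False
    then obtain x y where xy: "x \<inter> J = S" "y \<inter> J = T" "x \<inter> J' = S'" "y \<inter> J' = T'" by (auto simp: C D)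
    \<comment> \<open>The common point supplies the traces on the joint index set.\<close>
    have "C \<inter> D = {(x', y'). x' \<inter> (J \<union> J') = x \<inter> (J \<union> J') \<and> y' \<inter> (J \<union> J') = y \<inter> (J \<union> J')}"
      unfolding C D using xy by blast
    moreover have "finite (J \<union> J')" using C D by simp
    ultimately show ?thesis unfolding cyl2_def by blast
  qed
qed

text \<open>Symmetry on atoms spreads to all of \<open>Q\<close>, because the cylinders form an
  intersection-stable generator that contains the whole space.\<close>

lemma distr_swap: "distr Q Q prod.swap = Q"
proof (rule measure_eqI_generator_eq[OF Int_stable_cyl2, where \<Omega>=UNIV and A="\<lambda>_. UNIV"])
  fix C :: "('i set \<times> 'i set) set" assume C': "C \<in> cyl2"
  then obtain J S T where C: "C = {(x, y). x \<inter> J = S \<and> y \<inter> J = T}" "finite J" by (auto simp: cyl2_def)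
  have "prod.swap -` C \<inter> space Q = {(x, y). x \<inter> J = T \<and> y \<inter> J = S}" by (auto simp: C)
  moreover have "C \<in> sets Q" unfolding C by (rule cyl2_sets[OF C(2)])
  ultimately show "emeasure (distr Q Q prod.swap) C = emeasure Q C"
    using symmetric[OF C(2), of S T] by (simp add: emeasure_distr[OF swap_measurable] Q.emeasure_eq_measure C(1))
next
  have "UNIV = {(x, y). x \<inter> {} = ({} :: 'i set) \<and> y \<inter> {} = ({} :: 'i set)}" by auto
  then show "range (\<lambda>_. UNIV) \<subseteq> (cyl2 :: ('i set \<times> 'i set) set set)" unfolding cyl2_def by blast
qed (use Q.prob_space_distr[OF swap_measurable, THEN prob_space.emeasure_space_1] in \<open>auto simp: sets_Q\<close>)

lemma AE_swap: "AE z in Q. P z \<Longrightarrow> AE z in Q. P (prod.swap z)"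
  by (subst (asm) distr_swap[symmetric]) (rule AE_distrD[OF swap_measurable])

lemma integral_swap:
  "f \<in> borel_measurable Q \<Longrightarrow> (\<integral>z. f (prod.swap z) \<partial>Q) = (\<integral>z. f z \<partial>Q)" for f :: "_ \<Rightarrow> real"
  using integral_distr[OF swap_measurable, of f] by (simp add: distr_swap)

text \<open>\<open>v\<close> reads only the first component, so after the swap it is evaluated at
  the second; conditioning on \<open>F\<close> leaves a function of the first.\<close>

definition B where "B v = real_cond_exp Q F (\<lambda>z. v (prod.swap z))"

lemma linf_Q:
  assumes "v \<in> linf \<Omega>"
  shows "v \<in> linf Q" "(\<lambda>z. v (prod.swap z)) \<in> linf Q"
proof -
  obtain c where c: "AE z in \<Omega>. \<bar>v z\<bar> \<le> c" "v \<in> borel_measurable \<Omega>" using assms by (rule linfE)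
  note c' = AE_\<Omega>_Q[OF c(1)] measurable_\<Omega>_Q[OF c(2)]
  show "v \<in> linf Q" by (rule linfI_AE[OF c'(2,1)])
  show "(\<lambda>z. v (prod.swap z)) \<in> linf Q"
    by (rule linfI_AE[OF measurable_compose[OF swap_measurable c'(2)] AE_swap[OF c'(1)]])
qed

lemma linf_Q_integrable: "v \<in> linf Q \<Longrightarrow> integrable Q v"
  by (elim linfE) (rule Q.integrable_const_bound, auto)

lemma linf_Q_integrable_mult: "v \<in> linf Q \<Longrightarrow> w \<in> linf Q \<Longrightarrow> integrable Q (\<lambda>z. v z * w z)"
proof (elim linfE)
  fix c d assume *: "AE x in Q. \<bar>v x\<bar> \<le> c" "v \<in> borel_measurable Q" "AE x in Q. \<bar>w x\<bar> \<le> d" "w \<in> borel_measurable Q"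
  show ?thesis
  proof (rule Q.integrable_const_bound[where B="c * d"])
    show "AE x in Q. norm (v x * w x) \<le> c * d"
      using *(1,3) by eventually_elim (auto simp: abs_mult intro!: mult_mono)
  qed (use * in measurable)
qed

lemma B_measurable [measurable]: "B v \<in> borel_measurable \<Omega>"
  unfolding B_def measurable_\<Omega> by (rule borel_measurable_cond_exp)

lemma B_integrable:
  assumes "v \<in> linf \<Omega>" shows "integrable \<Omega> (B v)"
  unfolding \<Omega>_def B_def
  by (intro integrable_in_subalg[OF subalgebra_F] borel_measurable_cond_exp real_cond_exp_int(1)
      linf_Q_integrable linf_Q(2)[OF assms])

lemma B_pairing:
  assumes "v \<in> linf \<Omega>" "w \<in> linf \<Omega>"
  shows "(\<integral>z. B v z * w z \<partial>\<Omega>) = (\<integral>z. v (prod.swap z) * w z \<partial>Q)"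
proof -
  note w = linf_measurable[OF assms(2)]
  have wF: "w \<in> borel_measurable F" using w by (simp add: measurable_\<Omega>)
  have "(\<integral>z. B v z * w z \<partial>\<Omega>) = (\<integral>z. B v z * w z \<partial>Q)"
    by (intro integral_\<Omega> borel_measurable_times B_measurable w)
  also have "\<dots> = (\<integral>z. w z * B v z \<partial>Q)" by (simp add: mult.commute)
  also have "\<dots> = (\<integral>z. w z * v (prod.swap z) \<partial>Q)"
    unfolding B_def using linf_Q[OF assms(1)] linf_Q[OF assms(2)]
    by (intro real_cond_exp_intg(2) linf_Q_integrable_mult wF) (auto simp: linf_measurable)
  finally show ?thesis by (simp add: mult.commute)
qed

text \<open>Positivity, regularity and the norm constant 1 come from conditional expectation.
  Self-adjointness is the invariance of \<open>Q\<close> under the swap, applied to the integral in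
  \<open>B_pairing\<close>.\<close>

lemma markov_graphop_B: "markov_graphop \<Omega> B"
  unfolding markov_graphop_def
proof (intro conjI)
  show "P_operator \<Omega> B"
    unfolding P_operator_def
  proof (intro conjI ballI allI impI \<Omega>.prob_space_axioms B_measurable B_integrable)
    fix v w assume v: "v \<in> linf \<Omega>" and w: "w \<in> linf \<Omega>"
    note m = linf_measurable[OF linf_Q(2)[OF v]] linf_measurable[OF linf_Q(2)[OF w]]
    note i = linf_Q_integrable[OF linf_Q(2)[OF v]] linf_Q_integrable[OF linf_Q(2)[OF w]]
    { assume "AE z in \<Omega>. v z = w z"
      from AE_swap[OF AE_\<Omega>_Q[OF this]] have "AE z in Q. B v z = B w z"
        unfolding B_def by (intro real_cond_exp_cong m)
      then show "AE z in \<Omega>. B v z = B w z" by (rule AE_Q_\<Omega>) measurable }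
    fix a b :: real
    have "AE z in Q. B (\<lambda>y. a * v y + b * w y) z = real_cond_exp Q F (\<lambda>z. a * v (prod.swap z)) z + real_cond_exp Q F (\<lambda>z. b * w (prod.swap z)) z"
      unfolding B_def using i by (intro real_cond_exp_add) auto
    moreover have "AE z in Q. real_cond_exp Q F (\<lambda>z. a * v (prod.swap z)) z = a * B v z"
      unfolding B_def by (rule real_cond_exp_cmult[OF i(1)])
    moreover have "AE z in Q. real_cond_exp Q F (\<lambda>z. b * w (prod.swap z)) z = b * B w z"
      unfolding B_def by (rule real_cond_exp_cmult[OF i(2)])
    ultimately have "AE z in Q. B (\<lambda>y. a * v y + b * w y) z = a * B v z + b * B w z"
      by eventually_elim simp
    then show "AE z in \<Omega>. B (\<lambda>y. a * v y + b * w y) z = a * B v z + b * B w z" by (rule AE_Q_\<Omega>) measurable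
  next
    show "\<exists>C. \<forall>v\<in>linf \<Omega>. \<forall>c. (AE z in \<Omega>. \<bar>v z\<bar> \<le> c) \<longrightarrow> (\<integral>z. \<bar>B v z\<bar> \<partial>\<Omega>) \<le> C * c"
    proof (intro exI[of _ 1] ballI allI impI)
      fix v and c :: real assume v: "v \<in> linf \<Omega>" and "AE z in \<Omega>. \<bar>v z\<bar> \<le> c"
      note c = AE_swap[OF AE_\<Omega>_Q[OF this(2)]]
      note i = linf_Q_integrable[OF linf_Q(2)[OF v]]
      have "AE z in Q. B v z \<le> c"
        unfolding B_def by (rule real_cond_exp_le_c[OF i]) (use c in auto)
      moreover have "AE z in Q. -c \<le> B v z"
        unfolding B_def by (rule real_cond_exp_ge_c[OF i]) (use c in auto)
      ultimately have "AE z in Q. \<bar>B v z\<bar> \<le> c" by eventually_elim auto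
      then have "AE z in \<Omega>. \<bar>B v z\<bar> \<le> c" by (rule AE_Q_\<Omega>) measurable
      then have "(\<integral>z. \<bar>B v z\<bar> \<partial>\<Omega>) \<le> (\<integral>z. c \<partial>\<Omega>)"
        using B_integrable[OF v] by (intro integral_mono_AE) auto
      then show "(\<integral>z. \<bar>B v z\<bar> \<partial>\<Omega>) \<le> 1 * c" using \<Omega>.prob_space by simp
    qed
  qed
  show "self_adjoint_op \<Omega> B"
    unfolding self_adjoint_op_def
  proof (intro ballI)
    fix v w assume v: "v \<in> linf \<Omega>" and w: "w \<in> linf \<Omega>"
    have "(\<integral>z. B v z * w z \<partial>\<Omega>) = (\<integral>z. v (prod.swap z) * w z \<partial>Q)" by (rule B_pairing[OF v w])
    also have "\<dots> = (\<integral>z. (\<lambda>z. v z * w (prod.swap z)) (prod.swap z) \<partial>Q)" by simp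
    also have "\<dots> = (\<integral>z. v z * w (prod.swap z) \<partial>Q)"
      using linf_Q[OF v] linf_Q[OF w] by (intro integral_swap borel_measurable_times linf_measurable)
    also have "\<dots> = (\<integral>z. B w z * v z \<partial>\<Omega>)" by (subst B_pairing[OF w v]) (simp add: mult.commute)
    finally show "(\<integral>z. B v z * w z \<partial>\<Omega>) = (\<integral>z. B w z * v z \<partial>\<Omega>)" .
  qed
  show "positivity_preserving \<Omega> B"
    unfolding positivity_preserving_def
  proof (intro ballI impI)
    fix v assume v: "v \<in> linf \<Omega>" and "AE z in \<Omega>. 0 \<le> v z"
    from AE_swap[OF AE_\<Omega>_Q[OF this(2)]] have "AE z in Q. 0 \<le> B v z"
      unfolding B_def by (intro real_cond_exp_pos linf_measurable linf_Q(2)[OF v])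
    then show "AE z in \<Omega>. 0 \<le> B v z" by (rule AE_Q_\<Omega>) measurable
  qed
  show "one_regular \<Omega> B"
    unfolding one_regular_def
  proof -
    have "AE z in Q. B (\<lambda>_. 1) z = 1"
      unfolding B_def by (rule real_cond_exp_F_meas) auto
    then show "AE z in \<Omega>. B (\<lambda>_. 1) z = 1" by (rule AE_Q_\<Omega>) measurable
  qed
qed

text \<open>Atom expansion, with \<open>c\<close> on the first component and \<open>f\<close> on the
  second. The formula matches \<open>cylinder_pairing\<close> for the given operators with
  \<open>measure Q\<close> in place of \<open>pairing\<close>, so convergence of forms is
  convergence of coefficients.\<close>

lemma B_cylinder_pairing:
  assumes J: "finite J" and f: "depends_on (f :: _ \<Rightarrow> real) J" and c: "depends_on (c :: _ \<Rightarrow> real) J"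
  shows "(\<integral>z. B (\<lambda>z. f (fst z)) z * c (fst z) \<partial>\<Omega>) =
    (\<Sum>(S, T)\<in>Pow J \<times> Pow J. c S * f T * measure Q {(x, y). x \<inter> J = S \<and> y \<inter> J = T})"
proof -
  let ?C = "\<lambda>(S, T). {(x, y). x \<inter> J = S \<and> y \<inter> J = T}"
  have "(\<integral>z. B (\<lambda>z. f (fst z)) z * c (fst z) \<partial>\<Omega>) = (\<integral>z. f (fst (prod.swap z)) * c (fst z) \<partial>Q)"
    using \<Omega>.depends_on_linf[OF f J] \<Omega>.depends_on_linf[OF c J] by (rule B_pairing)
  also have "\<dots> = (\<integral>z. (\<Sum>ST\<in>Pow J \<times> Pow J. c (fst ST) * f (snd ST) * indicator (?C ST) z) \<partial>Q)"
  proof (intro Bochner_Integration.integral_cong refl)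
    fix z :: "'i set \<times> 'i set"
    obtain x y where z: "z = (x, y)" by (cases z)
    have "f (fst (prod.swap z)) * c (fst z) = c x * f y" by (simp add: z)
    also have "\<dots> = (\<Sum>S\<in>Pow J. c S * of_bool (x \<inter> J = S)) * (\<Sum>T\<in>Pow J. f T * of_bool (y \<inter> J = T))"
      by (simp only: depends_on_atoms[OF c J, symmetric] depends_on_atoms[OF f J, symmetric])
    also have "\<dots> = (\<Sum>ST\<in>Pow J \<times> Pow J. c (fst ST) * f (snd ST) * indicator (?C ST) z)"
      by (simp add: sum_product sum.cartesian_product z indicator_def of_bool_def split_beta if_distrib cong: if_cong)
         (intro sum.cong; auto)
    finally show "f (fst (prod.swap z)) * c (fst z) = (\<Sum>ST\<in>Pow J \<times> Pow J. c (fst ST) * f (snd ST) * indicator (?C ST) z)" .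
  qed
  also have "\<dots> = (\<Sum>ST\<in>Pow J \<times> Pow J. c (fst ST) * f (snd ST) * measure Q (?C ST))"
    using cyl2_sets[OF J] by (subst Bochner_Integration.integral_sum)
      (auto intro!: integrable_mult_right integrable_real_indicator simp: Q.emeasure_eq_measure)
  finally show ?thesis by (simp add: split_beta)
qed

end

section \<open>Coding points by threshold sets\<close>

text \<open>\<open>Init a q\<close> codes the set \<open>{V a \<ge> q}\<close>, and \<open>Deriv J S q\<close> codes \<open>{A 1\<^sub>C \<ge> q}\<close> for the
  cylinder \<open>C\<close> of points whose coded sets among \<open>J\<close> are exactly those in \<open>S\<close>. Since the images
  of cylinders are themselves coded, convergence of the bilinear forms on cylinders forces
  convergence of the joint laws.\<close>

datatype ix = Init nat rat | Deriv "ix list" "ix list" rat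

instance ix :: countable
  by countable_datatype

text \<open>A derived bit consults only the bits in the list \<open>J\<close>, which are smaller
  codes. \<open>A\<close> acts on representatives, so bits are defined at every point although
  images are determined only almost everywhere.\<close>

fun bit :: "(('a \<Rightarrow> real) \<Rightarrow> 'a \<Rightarrow> real) \<Rightarrow> (nat \<Rightarrow> 'a \<Rightarrow> real) \<Rightarrow> ix \<Rightarrow> 'a \<Rightarrow> bool" where
  "bit A V (Init a q) x \<longleftrightarrow> real_of_rat q \<le> V a x"
| "bit A V (Deriv J S q) x \<longleftrightarrow>
     real_of_rat q \<le> A (\<lambda>y. of_bool (\<forall>i\<in>set J. bit A V i y \<longleftrightarrow> i \<in> set S)) x"

definition code :: "(('a \<Rightarrow> real) \<Rightarrow> 'a \<Rightarrow> real) \<Rightarrow> (nat \<Rightarrow> 'a \<Rightarrow> real) \<Rightarrow> 'a \<Rightarrow> ix set" where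
  "code A V x = {i. bit A V i x}"

text \<open>\<open>step\<close> with its thresholds read from a set of codes: \<open>K q\<close>
  codes the question whether the value is at least \<open>q\<close>. It makes sense for every set of
  codes, in particular on the limit space, whose points need not code a point of any given
  space.\<close>

definition digit_step :: "nat \<Rightarrow> (rat \<Rightarrow> ix) \<Rightarrow> ix set \<Rightarrow> real" where
  "digit_step m K s = -1 + (\<Sum>j=1..2*m. of_bool (K (-1 + of_nat j / of_nat m) \<in> s)) / real m"

lemma digit_step_eq:
  assumes "\<And>q. K q \<in> s \<longleftrightarrow> real_of_rat q \<le> r" shows "digit_step m K s = step m r"
proof -
  have "real_of_rat (-1 + of_nat j / of_nat m) = -1 + real j / real m" for j
    by (simp add: of_rat_diff of_rat_divide)
  then show ?thesis by (simp only: digit_step_def step_def assms)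
qed

lemma digit_step_depends: "\<exists>J. finite J \<and> depends_on (digit_step m K) J"
proof (intro exI conjI)
  let ?J = "(\<lambda>j. K (-1 + of_nat j / of_nat m)) ` {1..2*m}"
  show "finite ?J" by simp
  have "(K (-1 + of_nat j / of_nat m) \<in> s) = (K (-1 + of_nat j / of_nat m) \<in> s \<inter> ?J)" if "j \<in> {1..2*m}" for j s
    using that by blast
  then have "(\<Sum>j=1..2*m. of_bool (K (-1 + of_nat j / of_nat m) \<in> s) :: real) =
    (\<Sum>j=1..2*m. of_bool (K (-1 + of_nat j / of_nat m) \<in> s \<inter> ?J))" for s
    by (intro sum.cong refl arg_cong[where f=of_bool]) 
  then show "depends_on (digit_step m K) ?J" unfolding depends_on_def digit_step_def by metis
qed

lemma digit_step_bound: "0 < m \<Longrightarrow> \<bar>digit_step m K s\<bar> \<le> 1"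
  unfolding digit_step_def by (rule step_sum_bound) auto

locale coded_op = markov_op M A for M :: "'a measure" and A +
  fixes V :: "nat \<Rightarrow> 'a \<Rightarrow> real"
  assumes V_measurable: "V a \<in> borel_measurable M"
    and V_bound: "x \<in> space M \<Longrightarrow> \<bar>V a x\<bar> \<le> 1"
begin

abbreviation "\<phi> \<equiv> code A V"

lemma Int_code_eq_iff: "S \<subseteq> J \<Longrightarrow> \<phi> x \<inter> J = S \<longleftrightarrow> (\<forall>i\<in>J. bit A V i x \<longleftrightarrow> i \<in> S)"
  by (auto simp: code_def)

lemma bit_measurable: "{x\<in>space M. bit A V i x} \<in> sets M"
proof (induction i)
  case (Init a q)
  show ?case using V_measurable[of a] by simp
next
  case (Deriv J S q)
  have "{y\<in>space M. \<forall>i\<in>set J. bit A V i y \<longleftrightarrow> i \<in> set S} \<in> sets M"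
  proof (intro sets.sets_Collect_finite_All)
    fix i assume "i \<in> set J"
    from Deriv(1)[OF this] show "{y\<in>space M. bit A V i y \<longleftrightarrow> i \<in> set S} \<in> sets M"
      by (cases "i \<in> set S") (auto intro: sets.sets_Collect_neg)
  qed auto
  then have "(\<lambda>y. of_bool (\<forall>i\<in>set J. bit A V i y \<longleftrightarrow> i \<in> set S)) \<in> linf M"
    by (intro linfI[where c=1]) (auto simp: of_bool_def pred_def intro!: measurable_If)
  from op_measurable[OF this] show ?case by simp
qed

lemma code_atom_measurable:
  assumes "finite J" shows "{x\<in>space M. \<phi> x \<inter> J = S} \<in> sets M"
proof (cases "S \<subseteq> J")
  case True
  have "{x\<in>space M. \<forall>i\<in>J. bit A V i x \<longleftrightarrow> i \<in> S} \<in> sets M"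
  proof (intro sets.sets_Collect_finite_All assms)
    fix i show "{y\<in>space M. bit A V i y \<longleftrightarrow> i \<in> S} \<in> sets M"
      using bit_measurable[of i] by (cases "i \<in> S") (auto intro: sets.sets_Collect_neg)
  qed
  then show ?thesis by (simp add: Int_code_eq_iff[OF True])
next
  case False
  then have "{x\<in>space M. \<phi> x \<inter> J = S} = {}" by blast
  then show ?thesis by (simp only: sets.empty_sets)
qed

lemma code_Int_measurable:
  assumes "finite J" shows "(\<lambda>x. \<phi> x \<inter> J) \<in> measurable M (count_space UNIV)"
  using assms by (intro measurable_finite_range[of "Pow J"]) (auto simp: code_atom_measurable)

lemma code_linf:
  assumes "depends_on (f :: _ \<Rightarrow> real) J" "finite J" shows "(\<lambda>x. f (\<phi> x)) \<in> linf M"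
proof (rule linfI[where c="Max ((\<lambda>S. \<bar>f S\<bar>) ` Pow J)"])
  fix x
  have "\<bar>f (\<phi> x)\<bar> = \<bar>f (\<phi> x \<inter> J)\<bar>" by (simp add: depends_onD[OF assms(1)])
  also have "\<dots> \<le> Max ((\<lambda>S. \<bar>f S\<bar>) ` Pow J)" using assms(2) by (intro Max_ge) auto
  finally show "\<bar>f (\<phi> x)\<bar> \<le> Max ((\<lambda>S. \<bar>f S\<bar>) ` Pow J)" .
next
  have "(\<lambda>x. f (\<phi> x \<inter> J)) \<in> borel_measurable M"
    by (rule measurable_compose[OF code_Int_measurable[OF assms(2)]]) simp
  then show "(\<lambda>x. f (\<phi> x)) \<in> borel_measurable M" by (simp add: depends_onD[OF assms(1)])
qed

lemma V_approx:
  assumes "0 < m" "x \<in> space M" shows "\<bar>V a x - digit_step m (Init a) (\<phi> x)\<bar> \<le> 1 / real m"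
proof -
  have "digit_step m (Init a) (\<phi> x) = step m (V a x)" by (rule digit_step_eq) (simp add: code_def)
  then show ?thesis using step_close[OF assms(1) V_bound[OF assms(2)]] by simp
qed

text \<open>The purpose of \<open>Deriv\<close>: the image of an atom indicator can be read off from
  the code up to \<open>1/m\<close>. Rounding needs the image to lie in \<open>[-1,1]\<close>, which
  holds almost everywhere.\<close>

lemma op_atom_approx:
  assumes "0 < m" "set S \<subseteq> set J"
  shows "AE x in M. \<bar>A (\<lambda>y. of_bool (\<phi> y \<inter> set J = set S)) x - digit_step m (Deriv J S) (\<phi> x)\<bar> \<le> 1 / real m"
proof -
  let ?f = "\<lambda>y. of_bool (\<phi> y \<inter> set J = set S) :: real"
  have "?f \<in> linf M" by (rule code_linf[OF depends_on_atom]) simp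
  then have "AE x in M. \<bar>A ?f x\<bar> \<le> 1" by (rule op_bound) auto
  moreover have "digit_step m (Deriv J S) (\<phi> x) = step m (A ?f x)" for x
  proof (rule digit_step_eq)
    show "Deriv J S q \<in> \<phi> x \<longleftrightarrow> real_of_rat q \<le> A ?f x" for q
      unfolding Int_code_eq_iff[OF assms(2)] by (simp add: code_def)
  qed
  ultimately show ?thesis using step_close[OF assms(1)] by (auto elim!: eventually_mono)
qed

text \<open>The test function comes first and the function acted on second, to match a pair
  \<open>(x, y)\<close> under \<open>Q\<close> with \<open>x\<close> the point and \<open>y\<close>
  its random neighbour.\<close>

definition pairing :: "ix set \<Rightarrow> ix set \<Rightarrow> ix set \<Rightarrow> real" where
  "pairing J S T = (\<integral>x. A (\<lambda>y. of_bool (\<phi> y \<inter> J = T)) x * of_bool (\<phi> x \<inter> J = S) \<partial>M)"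

lemma atom_linf: "finite J \<Longrightarrow> (\<lambda>x. of_bool (\<phi> x \<inter> J = S) :: real) \<in> linf M"
  by (rule code_linf[OF depends_on_atom])

lemma op_cylinder:
  assumes "depends_on f J" "finite J"
  shows "AE x in M. A (\<lambda>y. f (\<phi> y)) x = (\<Sum>T\<in>Pow J. f T * A (\<lambda>y. of_bool (\<phi> y \<inter> J = T)) x)"
proof -
  have "(\<lambda>y. f (\<phi> y)) = (\<lambda>y. \<Sum>T\<in>Pow J. f T * of_bool (\<phi> y \<inter> J = T))"
    by (rule ext) (rule depends_on_atoms[OF assms])
  moreover have "AE x in M. A (\<lambda>y. \<Sum>T\<in>Pow J. f T * of_bool (\<phi> y \<inter> J = T)) x = (\<Sum>T\<in>Pow J. f T * A (\<lambda>y. of_bool (\<phi> y \<inter> J = T)) x)"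
    using op_sum[of "Pow J" "\<lambda>T y. of_bool (\<phi> y \<inter> J = T)" f] assms(2) atom_linf by simp
  ultimately show ?thesis by simp
qed

lemma cylinder_pairing:
  assumes J: "finite J" and f: "depends_on f J" and c: "depends_on c J"
  shows "(\<integral>x. A (\<lambda>y. f (\<phi> y)) x * c (\<phi> x) \<partial>M) = (\<Sum>(S, T)\<in>Pow J \<times> Pow J. c S * f T * pairing J S T)"
proof -
  let ?a = "\<lambda>S x. of_bool (\<phi> x \<inter> J = S) :: real"
  have int: "integrable M (\<lambda>x. A (?a T) x * ?a S x)" for S T
    by (intro linf_integrable linf_mult op_linf atom_linf J)
  have m: "(\<lambda>x. c (\<phi> x)) \<in> borel_measurable M" by (rule linf_measurable[OF code_linf[OF c J]])
  have "(\<integral>x. A (\<lambda>y. f (\<phi> y)) x * c (\<phi> x) \<partial>M) =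
    (\<integral>x. (\<Sum>ST\<in>Pow J \<times> Pow J. c (fst ST) * f (snd ST) * (A (?a (snd ST)) x * ?a (fst ST) x)) \<partial>M)"
  proof (rule integral_cong_AE)
    show "AE x in M. A (\<lambda>y. f (\<phi> y)) x * c (\<phi> x) =
      (\<Sum>ST\<in>Pow J \<times> Pow J. c (fst ST) * f (snd ST) * (A (?a (snd ST)) x * ?a (fst ST) x))"
      using op_cylinder[OF f J]
    proof eventually_elim
      case (elim x)
      have "c (\<phi> x) = (\<Sum>S\<in>Pow J. c S * ?a S x)" by (rule depends_on_atoms[OF c J])
      with elim have "A (\<lambda>y. f (\<phi> y)) x * c (\<phi> x) = (\<Sum>S\<in>Pow J. c S * ?a S x) * (\<Sum>T\<in>Pow J. f T * A (?a T) x)" by simp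
      also have "\<dots> = (\<Sum>ST\<in>Pow J \<times> Pow J. c (fst ST) * f (snd ST) * (A (?a (snd ST)) x * ?a (fst ST) x))"
        unfolding sum_product sum.cartesian_product by (rule sum.cong) (auto simp: mult_ac)
      finally show ?case .
    qed
    show "(\<lambda>x. A (\<lambda>y. f (\<phi> y)) x * c (\<phi> x)) \<in> borel_measurable M"
      using m code_linf[OF f J] by simp
    show "(\<lambda>x. \<Sum>ST\<in>Pow J \<times> Pow J. c (fst ST) * f (snd ST) * (A (?a (snd ST)) x * ?a (fst ST) x)) \<in> borel_measurable M"
      by (intro borel_measurable_sum borel_measurable_times borel_measurable_const op_measurable linf_measurable[OF atom_linf[OF J]] atom_linf J)
  qed
  also have "\<dots> = (\<Sum>ST\<in>Pow J \<times> Pow J. c (fst ST) * f (snd ST) * pairing J (fst ST) (snd ST))"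
    unfolding pairing_def using int by (subst Bochner_Integration.integral_sum) auto
  finally show ?thesis by (simp add: split_beta)
qed

lemma pairing_nonneg: "finite J \<Longrightarrow> 0 \<le> pairing J S T"
proof -
  assume J: "finite J"
  have "AE x in M. 0 \<le> A (\<lambda>y. of_bool (\<phi> y \<inter> J = T)) x"
    by (rule markov_graphopD(7)[OF markov atom_linf[OF J]]) auto
  then have "AE x in M. 0 \<le> A (\<lambda>y. of_bool (\<phi> y \<inter> J = T)) x * of_bool (\<phi> x \<inter> J = S)"
    by eventually_elim auto
  then show ?thesis unfolding pairing_def by (rule integral_nonneg_AE)
qed

lemma pairing_commute: "finite J \<Longrightarrow> pairing J S T = pairing J T S"
  unfolding pairing_def by (rule markov_graphopD(6)[OF markov atom_linf atom_linf])

text \<open>Atoms over \<open>J\<close> are cylinder functions over the larger \<open>H\<close>;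
  expanding them there gives the consistency that the extension theorem demands.\<close>

lemma pairing_consistent:
  assumes H: "finite H" and "J \<subseteq> H" and S: "S \<subseteq> J" and T: "T \<subseteq> J"
  shows "pairing J S T = (\<Sum>(S', T')\<in>{S'\<in>Pow H. S' \<inter> J = S} \<times> {T'\<in>Pow H. T' \<inter> J = T}. pairing H S' T')"
proof -
  have dep: "depends_on (\<lambda>x. of_bool (x \<inter> J = S) :: real) H" for S
    by (rule depends_on_mono[OF depends_on_atom \<open>J \<subseteq> H\<close>])
  have "pairing J S T = (\<Sum>(S', T')\<in>Pow H \<times> Pow H. of_bool (S' \<inter> J = S) * of_bool (T' \<inter> J = T) * pairing H S' T')"
    unfolding pairing_def[of J] by (rule cylinder_pairing[OF H dep dep])
  also have "\<dots> = (\<Sum>(S', T')\<in>{S'\<in>Pow H. S' \<inter> J = S} \<times> {T'\<in>Pow H. T' \<inter> J = T}. pairing H S' T')"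
    using H by (intro sum.mono_neutral_cong_right) auto
  finally show ?thesis .
qed

text \<open>Testing \<open>A 1 = 1\<close> against an atom shows that the law of the code is the
  first marginal of the pairing. For \<open>S\<close> not contained in \<open>J\<close> both sides
  vanish.\<close>

lemma measure_code_atom:
  assumes J: "finite J"
  shows "measure M {x\<in>space M. \<phi> x \<inter> J = S} = (\<Sum>T\<in>Pow J. pairing J S T)"
proof -
  have "depends_on (\<lambda>_. 1 :: real) J" by (rule depends_on_const)
  from cylinder_pairing[OF J this depends_on_atom[of J S]]
  have "(\<integral>x. A (\<lambda>y. 1) x * of_bool (\<phi> x \<inter> J = S) \<partial>M) = (\<Sum>(S', T)\<in>Pow J \<times> Pow J. of_bool (S' \<inter> J = S) * 1 * pairing J S' T)" .
  also have "\<dots> = (\<Sum>S'\<in>Pow J. of_bool (S' \<inter> J = S) * (\<Sum>T\<in>Pow J. pairing J S' T))"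
    by (simp add: sum.cartesian_product[symmetric] sum_distrib_left)
  also have "\<dots> = (if S \<subseteq> J then (\<Sum>T\<in>Pow J. pairing J S T) else 0)"
  proof -
    have "of_bool (S' \<inter> J = S) * (\<Sum>T\<in>Pow J. pairing J S' T) = (if S' = S then (\<Sum>T\<in>Pow J. pairing J S T) else 0)" if "S' \<in> Pow J" for S'
      using that by (auto simp: of_bool_def Int_absorb2)
    then have "(\<Sum>S'\<in>Pow J. of_bool (S' \<inter> J = S) * (\<Sum>T\<in>Pow J. pairing J S' T))
      = (\<Sum>S'\<in>Pow J. if S' = S then (\<Sum>T\<in>Pow J. pairing J S T) else 0)" by (rule sum.cong[OF refl])
    then show ?thesis using J by simp
  qed
  finally have *: "(\<integral>x. A (\<lambda>y. 1) x * of_bool (\<phi> x \<inter> J = S) \<partial>M) = (if S \<subseteq> J then (\<Sum>T\<in>Pow J. pairing J S T) else 0)" .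
  have "(\<integral>x. A (\<lambda>y. 1) x * of_bool (\<phi> x \<inter> J = S) \<partial>M) = (\<integral>x. indicator {x\<in>space M. \<phi> x \<inter> J = S} x \<partial>M)"
  proof (rule integral_cong_AE)
    show "AE x in M. A (\<lambda>y. 1) x * of_bool (\<phi> x \<inter> J = S) = indicator {x\<in>space M. \<phi> x \<inter> J = S} x"
      using markov_graphopD(8)[OF markov] AE_space by eventually_elim (auto simp: indicator_def)
    show "(\<lambda>x. A (\<lambda>y. 1) x * of_bool (\<phi> x \<inter> J = S)) \<in> borel_measurable M"
      by (intro borel_measurable_times op_measurable linf_const linf_measurable[OF atom_linf[OF J]])
  qed (use code_atom_measurable[OF J, of S] in simp)
  also have "\<dots> = measure M {x\<in>space M. \<phi> x \<inter> J = S}"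
    using code_atom_measurable[OF J, of S] by (simp add: sets.Int_space_eq2)
  finally have **: "measure M {x\<in>space M. \<phi> x \<inter> J = S} = (if S \<subseteq> J then (\<Sum>T\<in>Pow J. pairing J S T) else 0)"
    using * by simp
  show ?thesis
  proof (cases "S \<subseteq> J")
    case False
    then have "(of_bool (\<phi> x \<inter> J = S) :: real) = 0" for x by auto
    then have "pairing J S T = 0" for T by (simp add: pairing_def)
    with ** False show ?thesis by simp
  qed (simp add: **)
qed

lemma pairing_empty: "pairing {} {} {} = 1"
  using measure_code_atom[of "{}" "{}"] prob_space by simp

lemma pairing_le_one:
  assumes J: "finite J" shows "pairing J S T \<le> 1"
proof -
  have "AE x in M. \<bar>A (\<lambda>y. of_bool (\<phi> y \<inter> J = T)) x\<bar> \<le> 1"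
    by (rule op_bound[OF atom_linf[OF J]]) auto
  then have "AE x in M. A (\<lambda>y. of_bool (\<phi> y \<inter> J = T)) x * of_bool (\<phi> x \<inter> J = S) \<le> 1"
    by eventually_elim (auto simp: of_bool_def)
  then have "pairing J S T \<le> (\<integral>x. 1 \<partial>M)" unfolding pairing_def
    by (intro integral_mono_AE linf_integrable linf_mult op_linf atom_linf J) auto
  then show ?thesis using prob_space by simp
qed

end

text \<open>The operators are quantified inside: one cylinder function \<open>g\<close> has to serve a whole
  sequence of operators and its limit.\<close>

lemma op_cylinder_approx:
  assumes J: "finite J" and f: "depends_on f J" and "0 < e"
  shows "\<exists>J' g. finite J' \<and> depends_on g J' \<and>
    (\<forall>(M :: 'a measure) A V. coded_op M A V \<longrightarrow>
      (AE x in M. \<bar>A (\<lambda>y. f (code A V y)) x - g (code A V x)\<bar> \<le> e))"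
proof -
  \<comment> \<open>Each atom image is rounded with error \<open>1/m\<close> and enters with weight
    \<open>|f T|\<close>, so the total error is at most \<open>b / m\<close>.\<close>
  define b where "b = (\<Sum>T\<in>Pow J. \<bar>f T\<bar>)"
  have "0 \<le> b" by (simp add: b_def sum_nonneg)
  obtain m :: nat where m: "b / e < m" using reals_Archimedean2 by blast
  have "0 < real m" using m \<open>0 \<le> b\<close> \<open>0 < e\<close> by (smt (verit) divide_nonneg_pos)
  have m': "b * (1 / m) \<le> e" using m \<open>0 < e\<close> \<open>0 < real m\<close> by (simp add: field_simps)
  \<comment> \<open>\<open>Deriv\<close> takes lists, so one enumeration of each finite set is fixed
    for all operators.\<close>
  have "\<exists>l. set l = T" if "finite T" for T :: "ix set" using finite_list[OF that] .
  then obtain l :: "ix set \<Rightarrow> ix list" where l: "\<And>T. finite T \<Longrightarrow> set (l T) = T" by metis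
  define g where "g s = (\<Sum>T\<in>Pow J. f T * digit_step m (Deriv (l J) (l T)) s)" for s
  have "\<forall>K. \<exists>J. finite J \<and> depends_on (digit_step m K) J" using digit_step_depends by blast
  from choice[OF this] obtain D where D: "\<And>K. finite (D K)" "\<And>K. depends_on (digit_step m K) (D K)" by blast
  let ?J' = "\<Union>T\<in>Pow J. D (Deriv (l J) (l T))"
  have "depends_on g ?J'"
    unfolding g_def using J
    by (intro depends_on_sum depends_on_mono[OF D(2)]) auto
  moreover have "finite ?J'" using J D(1) by auto
  moreover have "AE x in M. \<bar>A (\<lambda>y. f (code A V y)) x - g (code A V x)\<bar> \<le> e"
    if "coded_op M A V" for M :: "'a measure" and A V
  proof -
    interpret coded_op M A V by fact
    have "AE x in M. \<forall>T\<in>Pow J. \<bar>A (\<lambda>y. of_bool (\<phi> y \<inter> J = T)) x - digit_step m (Deriv (l J) (l T)) (\<phi> x)\<bar> \<le> 1 / m"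
    proof (rule AE_finite_allI)
      fix T assume "T \<in> Pow J"
      then have "set (l J) = J" "set (l T) = T" using J l finite_subset by auto
      with op_atom_approx[of m "l T" "l J"] \<open>T \<in> Pow J\<close> \<open>0 < real m\<close>
      show "AE x in M. \<bar>A (\<lambda>y. of_bool (\<phi> y \<inter> J = T)) x - digit_step m (Deriv (l J) (l T)) (\<phi> x)\<bar> \<le> 1 / m" by simp
    qed (use J in simp)
    with op_cylinder[OF f J] show ?thesis
    proof eventually_elim
      case (elim x)
      have "\<bar>A (\<lambda>y. f (\<phi> y)) x - g (\<phi> x)\<bar> =
        \<bar>\<Sum>T\<in>Pow J. f T * (A (\<lambda>y. of_bool (\<phi> y \<inter> J = T)) x - digit_step m (Deriv (l J) (l T)) (\<phi> x))\<bar>"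
        unfolding elim(1) g_def by (simp add: sum_subtractf right_diff_distrib)
      also have "\<dots> \<le> (\<Sum>T\<in>Pow J. \<bar>f T\<bar> * (1 / m))"
      proof (intro order_trans[OF sum_abs] sum_mono)
        fix T assume "T \<in> Pow J"
        with elim(2) have "\<bar>A (\<lambda>y. of_bool (\<phi> y \<inter> J = T)) x - digit_step m (Deriv (l J) (l T)) (\<phi> x)\<bar> \<le> 1 / m" by blast
        then show "\<bar>f T * (A (\<lambda>y. of_bool (\<phi> y \<inter> J = T)) x - digit_step m (Deriv (l J) (l T)) (\<phi> x))\<bar> \<le> \<bar>f T\<bar> * (1 / m)"
          unfolding abs_mult by (rule mult_left_mono) simp
      qed
      also have "\<dots> = b * (1 / m)" unfolding b_def by (rule sum_distrib_right[symmetric])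
      finally show ?case using m' by simp
    qed
  qed
  ultimately show ?thesis by blast
qed

section \<open>The limit graphop\<close>

locale coded_sequence =
  fixes M :: "nat \<Rightarrow> 'a measure" and A :: "nat \<Rightarrow> ('a \<Rightarrow> real) \<Rightarrow> 'a \<Rightarrow> real"
    and V :: "nat \<Rightarrow> nat \<Rightarrow> 'a \<Rightarrow> real" and Q :: "(ix set \<times> ix set) measure"
  assumes coded: "coded_op (M n) (A n) (V n)"
    and pair: "symmetric_pair Q"
    and pairing_limit: "finite J \<Longrightarrow> S \<subseteq> J \<Longrightarrow> T \<subseteq> J \<Longrightarrow>
      (\<lambda>n. coded_op.pairing (M n) (A n) (V n) J S T) \<longlonglongrightarrow> measure Q {(x, y). x \<inter> J = S \<and> y \<inter> J = T}"

text \<open>A diagonal subsequence makes all pairings on finite sets converge. Nonnegativity,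
  consistency, total mass and symmetry are closed conditions, so the limits inherit them and come
  from a symmetric measure.\<close>

lemma coded_sequence_exists:
  fixes M :: "nat \<Rightarrow> 'a measure"
  assumes "\<And>n. coded_op (M n) (A n) (V n)"
  shows "\<exists>r Q. strict_mono r \<and> coded_sequence (\<lambda>n. M (r n)) (\<lambda>n. A (r n)) (\<lambda>n. V (r n)) Q"
proof -
  interpret C: coded_op "M n" "A n" "V n" for n by (rule assms)
  \<comment> \<open>Lists stand in for finite sets because the diagonal argument needs a countable
    index type.\<close>
  define u where "u n = (\<lambda>(js, ss, ts). C.pairing n (set js) (set ss) (set ts))" for n
  have "norm (u n x) \<le> 1" for n x
    using C.pairing_nonneg C.pairing_le_one by (auto simp: u_def abs_le_iff split: prod.split intro: order_trans[of _ 0])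
  then obtain r where r: "strict_mono r" "\<And>x. \<exists>l. (\<lambda>n. u (r n) x) \<longlonglongrightarrow> l"
    using function_convergent_subsequence[of "UNIV :: (ix list \<times> ix list \<times> ix list) set" u 1]
    by (metis UNIV_I countableI_type)
  define p where "p J S T = lim (\<lambda>n. C.pairing (r n) J S T)" for J S T
  have p: "(\<lambda>n. C.pairing (r n) J S T) \<longlonglongrightarrow> p J S T" if J: "finite J" "S \<subseteq> J" "T \<subseteq> J" for J S T
  proof -
    obtain js ss ts where "set js = J" "set ss = S" "set ts = T"
      using J by (meson finite_list finite_subset)
    with r(2)[of "(js, ss, ts)"] have "convergent (\<lambda>n. C.pairing (r n) J S T)"
      by (auto simp: u_def convergent_def)
    then show ?thesis unfolding p_def by (simp add: convergent_LIMSEQ_iff)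
  qed
  have "\<exists>Q. prob_space Q \<and> sets Q = sigma_sets UNIV cyl2 \<and>
    (\<forall>J S T. finite J \<longrightarrow> S \<subseteq> J \<longrightarrow> T \<subseteq> J \<longrightarrow>
      measure Q {(x, y). x \<inter> J = S \<and> y \<inter> J = T} = p J S T)"
  proof (rule kolmogorov_set_pairs)
    show "0 \<le> p J S T" if "finite J" "S \<subseteq> J" "T \<subseteq> J" for J S T
      using C.pairing_nonneg that(1) by (intro LIMSEQ_le_const[OF p[OF that]]) auto
    show "p {} {} {} = 1"
      using p[of "{}" "{}" "{}"] by (simp add: C.pairing_empty LIMSEQ_const_iff)
    fix H J S T :: "ix set" assume *: "finite H" "J \<subseteq> H" "S \<subseteq> J" "T \<subseteq> J"
    have "(\<lambda>n. \<Sum>(S', T')\<in>{S'\<in>Pow H. S' \<inter> J = S} \<times> {T'\<in>Pow H. T' \<inter> J = T}. C.pairing (r n) H S' T')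
      \<longlonglongrightarrow> (\<Sum>(S', T')\<in>{S'\<in>Pow H. S' \<inter> J = S} \<times> {T'\<in>Pow H. T' \<inter> J = T}. p H S' T')"
      unfolding split_beta using *(1) by (intro tendsto_sum p) auto
    then have "(\<lambda>n. C.pairing (r n) J S T)
      \<longlonglongrightarrow> (\<Sum>(S', T')\<in>{S'\<in>Pow H. S' \<inter> J = S} \<times> {T'\<in>Pow H. T' \<inter> J = T}. p H S' T')"
      by (simp only: C.pairing_consistent[OF *])
    then show "p J S T = (\<Sum>(S', T')\<in>{S'\<in>Pow H. S' \<inter> J = S} \<times> {T'\<in>Pow H. T' \<inter> J = T}. p H S' T')"
      using p[OF finite_subset[OF *(2,1)] *(3,4)] LIMSEQ_unique by blast
  qed
  then obtain Q where Q: "prob_space Q" "sets Q = sigma_sets UNIV cyl2"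
    and Qp: "\<And>J S T. finite J \<Longrightarrow> S \<subseteq> J \<Longrightarrow> T \<subseteq> J \<Longrightarrow> measure Q {(x, y). x \<inter> J = S \<and> y \<inter> J = T} = p J S T"
    by blast
  have "coded_sequence (\<lambda>n. M (r n)) (\<lambda>n. A (r n)) (\<lambda>n. V (r n)) Q"
  proof (intro coded_sequence.intro)
    show "coded_op (M (r n)) (A (r n)) (V (r n))" for n by (rule assms)
    show "(\<lambda>n. C.pairing (r n) J S T) \<longlonglongrightarrow> measure Q {(x, y). x \<inter> J = S \<and> y \<inter> J = T}"
      if "finite J" "S \<subseteq> J" "T \<subseteq> J" for J S T
      using p[OF that] by (simp only: Qp[OF that])
    show "symmetric_pair Q"
    proof (intro symmetric_pair.intro symmetric_pair_axioms.intro Q)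
      fix J S T :: "ix set" assume J: "finite J"
      show "measure Q {(x, y). x \<inter> J = S \<and> y \<inter> J = T} = measure Q {(x, y). x \<inter> J = T \<and> y \<inter> J = S}"
      proof (cases "S \<subseteq> J \<and> T \<subseteq> J")
        case True
        then have ST: "S \<subseteq> J" "T \<subseteq> J" by auto
        have "(\<lambda>n. C.pairing (r n) J S T) \<longlonglongrightarrow> p J T S"
          using p[OF J ST(2,1)] by (simp only: C.pairing_commute[OF J, of _ T S])
        from LIMSEQ_unique[OF p[OF J ST] this] show ?thesis by (simp only: Qp[OF J ST] Qp[OF J ST(2,1)])
      next
        case False
        then have "{(x, y). x \<inter> J = S \<and> y \<inter> J = T} = {}" "{(x, y). x \<inter> J = T \<and> y \<inter> J = S} = {}" by blast+
        then show ?thesis by (simp only:)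
      qed
    qed
  qed
  with r(1) show ?thesis by blast
qed

context markov_op begin

lemma pairing_one:
  assumes "w \<in> linf M" shows "(\<integral>x. A (\<lambda>_. 1) x * w x \<partial>M) = (\<integral>x. w x \<partial>M)"
  using markov_graphopD(6)[OF markov linf_const assms, of 1] op_integral[OF assms] by simp

end

context coded_sequence begin

sublocale C: coded_op "M n" "A n" "V n" for n by (rule coded)
sublocale S: symmetric_pair Q by (rule pair)
sublocale B: markov_op S.\<Omega> S.B by unfold_locales (rule S.markov_graphop_B)

abbreviation "\<phi> n \<equiv> code (A n) (V n)"

text \<open>Over a common index set both forms are the same finite combination, of pairings on one
  side and of cylinder probabilities on the other.\<close>

lemma cylinder_pairing_limit:
  assumes "finite J" "depends_on f J" "finite K" "depends_on c K"
  shows "(\<lambda>n. \<integral>x. A n (\<lambda>y. f (\<phi> n y)) x * c (\<phi> n x) \<partial>M n)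
    \<longlonglongrightarrow> (\<integral>z. S.B (\<lambda>z. f (fst z)) z * c (fst z) \<partial>S.\<Omega>)"
proof -
  let ?H = "J \<union> K"
  have H: "finite ?H" and f: "depends_on f ?H" and c: "depends_on c ?H"
    using assms by (auto intro: depends_on_mono)
  have "(\<lambda>n. \<Sum>(S, T)\<in>Pow ?H \<times> Pow ?H. c S * f T * C.pairing n ?H S T)
    \<longlonglongrightarrow> (\<Sum>(S, T)\<in>Pow ?H \<times> Pow ?H. c S * f T * measure Q {(x, y). x \<inter> ?H = S \<and> y \<inter> ?H = T})"
  proof (rule tendsto_sum)
    fix ST assume "ST \<in> Pow ?H \<times> Pow ?H"
    then obtain S T where ST: "ST = (S, T)" "S \<subseteq> ?H" "T \<subseteq> ?H" by auto
    show "(\<lambda>n. case ST of (S, T) \<Rightarrow> c S * f T * C.pairing n ?H S T)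
      \<longlonglongrightarrow> (case ST of (S, T) \<Rightarrow> c S * f T * measure Q {(x, y). x \<inter> ?H = S \<and> y \<inter> ?H = T})"
      unfolding ST(1) prod.case by (rule tendsto_mult_left[OF pairing_limit[OF H ST(2,3)]])
  qed
  then show ?thesis by (simp only: C.cylinder_pairing[OF H f c] S.B_cylinder_pairing[OF H f c])
qed

lemma cylinder_integral_limit:
  fixes c :: "ix set \<Rightarrow> real"
  assumes "finite K" "depends_on c K"
  shows "(\<lambda>n. \<integral>x. c (\<phi> n x) \<partial>M n) \<longlonglongrightarrow> (\<integral>z. c (fst z) \<partial>S.\<Omega>)"
  using cylinder_pairing_limit[OF finite.emptyI depends_on_const[of "1 :: real"] assms]
  by (simp add: C.pairing_one[OF C.code_linf[OF assms(2,1)]] B.pairing_one[OF S.\<Omega>.depends_on_linf[OF assms(2,1)]])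

lemma atom_limit:
  assumes "finite J"
  shows "(\<lambda>n. measure (M n) {x\<in>space (M n). \<phi> n x \<inter> J = S}) \<longlonglongrightarrow> measure S.\<Omega> {z\<in>space S.\<Omega>. fst z \<inter> J = S}"
proof -
  have "(\<integral>x. of_bool (\<phi> n x \<inter> J = S) \<partial>M n) = measure (M n) {x\<in>space (M n). \<phi> n x \<inter> J = S}" for n
  proof -
    have "(\<integral>x. of_bool (\<phi> n x \<inter> J = S) \<partial>M n) = (\<integral>x. indicat_real {x\<in>space (M n). \<phi> n x \<inter> J = S} x \<partial>M n)"
      by (rule Bochner_Integration.integral_cong) (auto simp: indicator_def)
    then show ?thesis using C.code_atom_measurable[OF assms, of n S] by (simp add: sets.Int_space_eq2)
  qed
  moreover have "(\<integral>z. of_bool (fst z \<inter> J = S) \<partial>S.\<Omega>) = measure S.\<Omega> {z\<in>space S.\<Omega>. fst z \<inter> J = S}"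
  proof -
    have "(\<integral>z. of_bool (fst z \<inter> J = S) \<partial>S.\<Omega>) = (\<integral>z. indicat_real {z. fst z \<inter> J = S} z \<partial>S.\<Omega>)"
      by (rule Bochner_Integration.integral_cong) (auto simp: indicator_def)
    then show ?thesis by simp
  qed
  ultimately show ?thesis using cylinder_integral_limit[OF assms depends_on_atom[of J S]] by simp
qed

text \<open>Tested against a cylinder event, closeness of the image to a fixed cylinder function is
  an inequality between quantities that converge; \<open>cylinder_sign_test\<close> then removes the
  test. The limit operator thus has its images read from the code by the same \<open>g\<close> as
  the sequence.\<close>

lemma limit_approx:
  assumes J: "finite J" and f: "depends_on f J" and K: "finite K" and g: "depends_on g K"
    and le: "\<And>n. AE x in M n. \<bar>A n (\<lambda>y. f (\<phi> n y)) x - g (\<phi> n x)\<bar> \<le> e"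
  shows "AE z in S.\<Omega>. \<bar>S.B (\<lambda>z. f (fst z)) z - g (fst z)\<bar> \<le> e"
proof -
  have Bf: "S.B (\<lambda>z. f (fst z)) \<in> linf S.\<Omega>" by (intro B.op_linf S.\<Omega>.depends_on_linf[OF f J])
  \<comment> \<open>The sign \<open>s\<close> proves both one-sided bounds together; the factor 1
    gives the expression the shape of \<open>linf_lincomb\<close>.\<close>
  have half: "AE z in S.\<Omega>. s * S.B (\<lambda>z. f (fst z)) z + 1 * (- s * g (fst z) - e) \<le> 0" if s: "\<bar>s\<bar> = 1" for s :: real
  proof (rule S.\<Omega>.cylinder_sign_test)
    have "depends_on (\<lambda>x. - s * g x - e) K" using g by (simp add: depends_on_def)
    then have lin: "(\<lambda>z. - s * g (fst z) - e) \<in> linf S.\<Omega>" by (rule S.\<Omega>.depends_on_linf[OF _ K])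
    then show "(\<lambda>z. s * S.B (\<lambda>z. f (fst z)) z + 1 * (- s * g (fst z) - e)) \<in> linf S.\<Omega>"
      by (rule linf_lincomb[OF Bf])
    fix L and c :: "ix set \<Rightarrow> bool" assume L: "finite L" and c': "depends_on c L"
    let ?c = "\<lambda>x. of_bool (c x) :: real"
    have c: "depends_on ?c L" using c' by (simp add: depends_on_def)
    have gc: "depends_on (\<lambda>x. (s * g x + e) * ?c x) (K \<union> L)"
      using depends_on_mono[OF g, of "K \<union> L"] depends_on_mono[OF c, of "K \<union> L"] by (auto simp: depends_on_def)
    have KL: "finite (K \<union> L)" using K L by simp
    have conv: "(\<lambda>n. s * (\<integral>x. A n (\<lambda>y. f (\<phi> n y)) x * ?c (\<phi> n x) \<partial>M n) - (\<integral>x. (s * g (\<phi> n x) + e) * ?c (\<phi> n x) \<partial>M n))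
      \<longlonglongrightarrow> s * (\<integral>z. S.B (\<lambda>z. f (fst z)) z * ?c (fst z) \<partial>S.\<Omega>) - (\<integral>z. (s * g (fst z) + e) * ?c (fst z) \<partial>S.\<Omega>)"
      by (intro tendsto_diff tendsto_mult_left cylinder_pairing_limit[OF J f L c] cylinder_integral_limit[OF KL gc])
    have nonpos: "s * (\<integral>x. A n (\<lambda>y. f (\<phi> n y)) x * ?c (\<phi> n x) \<partial>M n) - (\<integral>x. (s * g (\<phi> n x) + e) * ?c (\<phi> n x) \<partial>M n) \<le> 0" for n
    proof -
      have int1: "integrable (M n) (\<lambda>x. A n (\<lambda>y. f (\<phi> n y)) x * ?c (\<phi> n x))"
        by (intro C.linf_integrable C.linf_mult C.op_linf C.code_linf[OF f J] C.code_linf[OF c L])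
      have int2: "integrable (M n) (\<lambda>x. (s * g (\<phi> n x) + e) * ?c (\<phi> n x))"
        using C.linf_integrable[OF C.code_linf[OF gc KL]] .
      have "(\<integral>x. s * (A n (\<lambda>y. f (\<phi> n y)) x * ?c (\<phi> n x)) \<partial>M n) \<le> (\<integral>x. (s * g (\<phi> n x) + e) * ?c (\<phi> n x) \<partial>M n)"
      proof (rule integral_mono_AE)
        show "AE x in M n. s * (A n (\<lambda>y. f (\<phi> n y)) x * ?c (\<phi> n x)) \<le> (s * g (\<phi> n x) + e) * ?c (\<phi> n x)"
          using le[of n]
        proof eventually_elim
          case (elim x)
          have "s * (A n (\<lambda>y. f (\<phi> n y)) x - g (\<phi> n x)) \<le> \<bar>s * (A n (\<lambda>y. f (\<phi> n y)) x - g (\<phi> n x))\<bar>" by simp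
          also have "\<dots> \<le> e" using elim s by (simp add: abs_mult)
          finally show ?case by (auto simp: of_bool_def algebra_simps)
        qed
      qed (use int1 int2 in auto)
      then show ?thesis by simp
    qed
    have "s * (\<integral>z. S.B (\<lambda>z. f (fst z)) z * ?c (fst z) \<partial>S.\<Omega>) - (\<integral>z. (s * g (fst z) + e) * ?c (fst z) \<partial>S.\<Omega>) \<le> 0"
      by (rule LIMSEQ_le_const2[OF conv]) (use nonpos in auto)
    moreover have "(\<integral>z. (s * S.B (\<lambda>z. f (fst z)) z + 1 * (- s * g (fst z) - e)) * ?c (fst z) \<partial>S.\<Omega>)
      = s * (\<integral>z. S.B (\<lambda>z. f (fst z)) z * ?c (fst z) \<partial>S.\<Omega>) - (\<integral>z. (s * g (fst z) + e) * ?c (fst z) \<partial>S.\<Omega>)"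
    proof -
      have "integrable S.\<Omega> (\<lambda>z. S.B (\<lambda>z. f (fst z)) z * ?c (fst z))"
        by (intro B.linf_integrable B.linf_mult Bf S.\<Omega>.depends_on_linf[OF c L])
      moreover have "integrable S.\<Omega> (\<lambda>z. (s * g (fst z) + e) * ?c (fst z))"
        using B.linf_integrable[OF S.\<Omega>.depends_on_linf[OF gc KL]] .
      ultimately have "s * (\<integral>z. S.B (\<lambda>z. f (fst z)) z * ?c (fst z) \<partial>S.\<Omega>) - (\<integral>z. (s * g (fst z) + e) * ?c (fst z) \<partial>S.\<Omega>)
        = (\<integral>z. s * (S.B (\<lambda>z. f (fst z)) z * ?c (fst z)) - (s * g (fst z) + e) * ?c (fst z) \<partial>S.\<Omega>)"
        by simp
      also have "\<dots> = (\<integral>z. (s * S.B (\<lambda>z. f (fst z)) z + 1 * (- s * g (fst z) - e)) * ?c (fst z) \<partial>S.\<Omega>)"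
        by (intro Bochner_Integration.integral_cong refl) (simp add: algebra_simps)
      finally show ?thesis by simp
    qed
    ultimately show "(\<integral>z. (s * S.B (\<lambda>z. f (fst z)) z + 1 * (- s * g (fst z) - e)) * ?c (fst z) \<partial>S.\<Omega>) \<le> 0" by simp
  qed
  from half[of 1] half[of "-1"] show ?thesis
    by simp (auto elim!: eventually_elim2)
qed

text \<open>The trace of the code on a common finite \<open>H\<close> determines every
  \<open>f i\<close>, and through \<open>g i\<close> the images up to \<open>\<delta>\<close>.
  Traces therefore serve as labels on all spaces at once, and their distributions converge.\<close>

lemma cylinder_law_limit:
  assumes J: "\<And>i. i < k \<Longrightarrow> finite (J i)" and f: "\<And>i. i < k \<Longrightarrow> depends_on (f i) (J i)" and "0 < e"
  shows "eventually (\<lambda>n. levy_prokhorov k (law k (M n) (A n) (\<lambda>i x. f i (\<phi> n x)))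
    (law k S.\<Omega> S.B (\<lambda>i z. f i (fst z))) \<le> e) sequentially"
proof -
  define d where "d = e / 2"
  \<comment> \<open>Error \<open>\<delta>\<close> in \<open>2 * k\<close> coordinates stays strictly
    below \<open>d\<close>; the \<open>+ 1\<close> covers \<open>k = 0\<close>.\<close>
  define \<delta> where "\<delta> = d / (2 * real k + 1)"
  have "0 < d" "0 < \<delta>" using \<open>0 < e\<close> by (auto simp: d_def \<delta>_def)
  have \<delta>: "2 * real k * \<delta> < d" using \<open>0 < d\<close> by (simp add: \<delta>_def field_simps)
  have "\<exists>K g. i < k \<longrightarrow> finite K \<and> depends_on g K \<and>
    (\<forall>(M :: 'a measure) A V. coded_op M A V \<longrightarrow> (AE x in M. \<bar>A (\<lambda>y. f i (code A V y)) x - g (code A V x)\<bar> \<le> \<delta>))" for i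
  proof (cases "i < k")
    case True
    from op_cylinder_approx[OF J[OF True] f[OF True] \<open>0 < \<delta>\<close>] show ?thesis by (simp only: True simp_thms)
  qed simp
  then have "\<forall>i. \<exists>K g. i < k \<longrightarrow> finite K \<and> depends_on g K \<and>
    (\<forall>(M :: 'a measure) A V. coded_op M A V \<longrightarrow> (AE x in M. \<bar>A (\<lambda>y. f i (code A V y)) x - g (code A V x)\<bar> \<le> \<delta>))" ..
  from choice[OF this] obtain K where "\<forall>i. \<exists>g. i < k \<longrightarrow> finite (K i) \<and> depends_on g (K i) \<and>
    (\<forall>(M :: 'a measure) A V. coded_op M A V \<longrightarrow> (AE x in M. \<bar>A (\<lambda>y. f i (code A V y)) x - g (code A V x)\<bar> \<le> \<delta>))"
    ..
  from choice[OF this] obtain g where Kg: "\<forall>i. i < k \<longrightarrow> finite (K i) \<and> depends_on (g i) (K i) \<and>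
    (\<forall>(M :: 'a measure) A V. coded_op M A V \<longrightarrow> (AE x in M. \<bar>A (\<lambda>y. f i (code A V y)) x - g i (code A V x)\<bar> \<le> \<delta>))"
    ..
  then have K: "\<And>i. i < k \<Longrightarrow> finite (K i)" and g: "\<And>i. i < k \<Longrightarrow> depends_on (g i) (K i)"
    by simp_all
  have fg: "AE x in M n. \<bar>A n (\<lambda>y. f i (\<phi> n y)) x - g i (\<phi> n x)\<bar> \<le> \<delta>" if "i < k" for i n
    using Kg[rule_format, OF that, THEN conjunct2, THEN conjunct2, rule_format, OF coded] .
  define H where "H = (\<Union>i<k. J i \<union> K i)"
  have H: "finite H" using J K by (auto simp: H_def)
  have fH: "f i (x \<inter> H) = f i x" and gH: "g i (x \<inter> H) = g i x" if "i < k" for i x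
    using that by (auto simp: H_def intro!: depends_onD depends_on_mono[OF f] depends_on_mono[OF g])
  \<comment> \<open>The point attached to a trace: exact values of the functions, then approximate
    values of their images.\<close>
  define h where "h S j = (if j < k then f j S else g (j - k) S)" for S j
  have close: "dist_k k (tuple k vs ws x) (h s) < d"
    if "\<And>i. i < k \<Longrightarrow> vs i x = f i s" "\<And>i. i < k \<Longrightarrow> \<bar>ws i x - g i s\<bar> \<le> \<delta>" for vs ws s and x :: "'z"
  proof -
    have "dist_k k (tuple k vs ws x) (h s) \<le> 2 * real k * \<delta>"
      using that \<open>0 < \<delta>\<close> by (intro dist_k_le_const) (auto simp: tuple_def h_def)
    then show ?thesis using \<delta> by simp
  qed
  have lin_n: "(\<lambda>x. f i (\<phi> n x)) \<in> linf (M n)" if "i < k" for i n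
    by (rule C.code_linf[OF f[OF that] J[OF that]])
  have lin: "(\<lambda>z. f i (fst z)) \<in> linf S.\<Omega>" if "i < k" for i
    by (rule S.\<Omega>.depends_on_linf[OF f[OF that] J[OF that]])
  have "(\<lambda>n. \<Sum>T\<in>Pow H. \<bar>measure (M n) {x\<in>space (M n). \<phi> n x \<inter> H = T} - measure S.\<Omega> {z\<in>space S.\<Omega>. fst z \<inter> H = T}\<bar>)
    \<longlonglongrightarrow> (\<Sum>T\<in>Pow H. \<bar>measure S.\<Omega> {z\<in>space S.\<Omega>. fst z \<inter> H = T} - measure S.\<Omega> {z\<in>space S.\<Omega>. fst z \<inter> H = T}\<bar>)"
    by (intro tendsto_sum tendsto_rabs tendsto_diff tendsto_const atom_limit H)
  then have "eventually (\<lambda>n. (\<Sum>T\<in>Pow H. \<bar>measure (M n) {x\<in>space (M n). \<phi> n x \<inter> H = T} - measure S.\<Omega> {z\<in>space S.\<Omega>. fst z \<inter> H = T}\<bar>) < 2 * d) sequentially"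
    using \<open>0 < d\<close> by (intro order_tendstoD(2)) auto
  then show ?thesis
  proof eventually_elim
    case (elim n)
    have "levy_prokhorov k (law k (M n) (A n) (\<lambda>i x. f i (\<phi> n x))) (law k S.\<Omega> S.B (\<lambda>i z. f i (fst z))) \<le> 2 * d"
      unfolding law_def
    proof (rule levy_prokhorov_labels[where P="\<lambda>x. \<phi> n x \<inter> H" and Q="\<lambda>z. fst z \<inter> H" and J="Pow H" and h=h])
      have "AE x in M n. \<forall>i\<in>{..<k}. \<bar>A n (\<lambda>y. f i (\<phi> n y)) x - g i (\<phi> n x)\<bar> \<le> \<delta>"
        by (intro AE_finite_allI fg) auto
      then show "AE x in M n. dist_k k (tuple k (\<lambda>i x. f i (\<phi> n x)) (\<lambda>i. A n (\<lambda>x. f i (\<phi> n x))) x) (h (\<phi> n x \<inter> H)) < d"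
        by eventually_elim (rule close; simp add: fH gH)
      have "AE z in S.\<Omega>. \<forall>i\<in>{..<k}. \<bar>S.B (\<lambda>z. f i (fst z)) z - g i (fst z)\<bar> \<le> \<delta>"
        by (intro AE_finite_allI limit_approx[OF J f K g fg]) auto
      then show "AE z in S.\<Omega>. dist_k k (tuple k (\<lambda>i z. f i (fst z)) (\<lambda>i. S.B (\<lambda>z. f i (fst z))) z) (h (fst z \<inter> H)) < d"
        by eventually_elim (rule close; simp add: fH gH)
      show "tuple k (\<lambda>i x. f i (\<phi> n x)) (\<lambda>i. A n (\<lambda>x. f i (\<phi> n x))) \<in> measurable (M n) borel"
        by (rule tuple_op_measurable[OF C.markov lin_n])
      show "tuple k (\<lambda>i z. f i (fst z)) (\<lambda>i. S.B (\<lambda>z. f i (fst z))) \<in> measurable S.\<Omega> borel"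
        by (rule tuple_op_measurable[OF B.markov lin])
    qed (use \<open>0 < d\<close> H elim C.prob_space_axioms S.\<Omega>.prob_space_axioms C.code_Int_measurable[OF H]
          S.\<Omega>.restriction_measurable[OF H] in auto)
    then show ?case by (simp add: d_def)
  qed
qed

lemma admissible_cylinder:
  assumes "\<And>i. i < k \<Longrightarrow> finite (J i)" "\<And>i. i < k \<Longrightarrow> depends_on (f i) (J i)" "\<And>i x. i < k \<Longrightarrow> \<bar>f i x\<bar> \<le> 1"
  shows "admissible k (M n) (\<lambda>i x. f i (\<phi> n x))" "admissible k S.\<Omega> (\<lambda>i z. f i (fst z))"
  using assms(3) by (auto simp: admissible_def
      intro!: linf_measurable C.code_linf[OF assms(2,1)] S.\<Omega>.depends_on_linf[OF assms(2,1)])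

text \<open>Rounding \<open>V n (a i)\<close> uses the same cylinder functions for all
  \<open>n\<close>, with an error independent of \<open>n\<close>, so one law of the limit serves
  the whole sequence. It may vary with \<open>e\<close>; the Hausdorff distance asks for no
  more.\<close>

lemma coded_law_limit:
  assumes "0 < e"
  shows "\<exists>\<mu>\<in>profile k S.\<Omega> S.B. eventually (\<lambda>n. levy_prokhorov k (law k (M n) (A n) (\<lambda>i. V n (a i))) \<mu> \<le> e) sequentially"
proof -
  \<comment> \<open>Uniform error \<open>1/m\<close> has to satisfy the hypothesis of
    \<open>law_close_L1\<close> at tolerance \<open>e/2\<close>.\<close>
  obtain m :: nat where m: "2 * real k / (e / 2)\<^sup>2 < m" using reals_Archimedean2 by blast
  have "0 \<le> 2 * real k / (e / 2)\<^sup>2" by simp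
  with m have "0 < real m" by linarith
  have m': "2 * real k * (1 / m) \<le> (e / 2)\<^sup>2" using m assms \<open>0 < real m\<close> by (simp add: field_simps)
  define f where "f i = digit_step m (Init (a i))" for i
  have "\<forall>i. \<exists>J. finite J \<and> depends_on (f i) J" unfolding f_def using digit_step_depends by blast
  from choice[OF this] obtain J where J: "\<And>i. finite (J i)" "\<And>i. depends_on (f i) (J i)" by blast
  have f1: "\<bar>f i x\<bar> \<le> 1" for i x unfolding f_def using \<open>0 < real m\<close> by (intro digit_step_bound) simp
  note adm = admissible_cylinder[of k J f, OF J f1]
  let ?\<mu> = "law k S.\<Omega> S.B (\<lambda>i z. f i (fst z))"
  have linV: "V n (a i) \<in> linf (M n)" for n i
    using C.V_measurable C.V_bound by (rule linfI)
  have near: "levy_prokhorov k (law k (M n) (A n) (\<lambda>i. V n (a i))) (law k (M n) (A n) (\<lambda>i x. f i (\<phi> n x))) \<le> e / 2" for n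
  proof (rule C.law_close_L1[OF _ linV C.code_linf[OF J(2,1)] _ m'])
    fix i
    have "(\<integral>x. \<bar>V n (a i) x - f i (\<phi> n x)\<bar> \<partial>M n) \<le> (\<integral>x. 1 / m \<partial>M n)"
    proof (rule integral_mono)
      show "integrable (M n) (\<lambda>x. \<bar>V n (a i) x - f i (\<phi> n x)\<bar>)"
        by (intro C.linf_integrable C.linf_abs C.op_diff(1) linV C.code_linf[OF J(2,1)])
      show "\<bar>V n (a i) x - f i (\<phi> n x)\<bar> \<le> 1 / m" if "x \<in> space (M n)" for x
        unfolding f_def using \<open>0 < real m\<close> that by (intro C.V_approx) auto
    qed auto
    then show "(\<integral>x. \<bar>V n (a i) x - f i (\<phi> n x)\<bar> \<partial>M n) \<le> 1 / m" using C.prob_space by simp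
  qed (use assms in simp)
  have conv: "eventually (\<lambda>n. levy_prokhorov k (law k (M n) (A n) (\<lambda>i x. f i (\<phi> n x))) ?\<mu> \<le> e / 2) sequentially"
    using J assms by (intro cylinder_law_limit[where J=J]) auto
  have bp: "law k (M n) (A n) (\<lambda>i. V n (a i)) \<in> borel_prob" "law k (M n) (A n) (\<lambda>i x. f i (\<phi> n x)) \<in> borel_prob"
    "?\<mu> \<in> borel_prob" for n
    by (intro law_borel_prob C.markov B.markov linV C.code_linf[OF J(2,1)] S.\<Omega>.depends_on_linf[OF J(2,1)])+
  from conv have "eventually (\<lambda>n. levy_prokhorov k (law k (M n) (A n) (\<lambda>i. V n (a i))) ?\<mu> \<le> e) sequentially"
  proof eventually_elim
    case (elim n)
    then show ?case
      using levy_prokhorov_triangle[OF bp(1)[of n] bp(2)[of n] bp(3), of k] near[of n] by linarith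
  qed
  moreover have "?\<mu> \<in> profile k S.\<Omega> S.B" using adm(2) by (auto simp: profile_eq)
  ultimately show ?thesis by blast
qed

text \<open>A tuple on the limit space is replaced by cylinder functions, which can be evaluated on
  the codes of every \<open>M n\<close>. The threshold for \<open>n\<close> depends on
  \<open>\<mu>\<close>; it becomes uniform once only finitely many \<open>\<mu>\<close>
  matter.\<close>

lemma limit_law_approx:
  assumes \<mu>: "\<mu> \<in> profile k S.\<Omega> S.B" and "0 < e"
  shows "eventually (\<lambda>n. \<exists>\<nu>\<in>profile k (M n) (A n). levy_prokhorov k \<nu> \<mu> \<le> e) sequentially"
proof -
  obtain vs where vs: "\<mu> = law k S.\<Omega> S.B vs" "admissible k S.\<Omega> vs" using \<mu> by (auto simp: profile_eq)
  define d where "d = (e / 2)\<^sup>2 / (2 * real k + 1)"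
  have "0 < d" using \<open>0 < e\<close> by (simp add: d_def)
  have d: "2 * real k * d \<le> (e / 2)\<^sup>2" using \<open>0 < e\<close> by (simp add: d_def field_simps)
  have "\<exists>J f. i < k \<longrightarrow> finite J \<and> depends_on f J \<and> (\<forall>x. \<bar>f x\<bar> \<le> 1) \<and> (\<integral>z. \<bar>vs i z - f (fst z)\<bar> \<partial>S.\<Omega>) \<le> d" for i
  proof (cases "i < k")
    case True
    then have "vs i \<in> borel_measurable S.\<Omega>" "\<And>z. \<bar>vs i z\<bar> \<le> 1" using vs(2) by (auto simp: admissible_def)
    from S.\<Omega>.approximate_function[OF this \<open>0 < d\<close>] show ?thesis by (simp only: True simp_thms)
  qed simp
  then have "\<forall>i. \<exists>J f. i < k \<longrightarrow> finite J \<and> depends_on f J \<and> (\<forall>x. \<bar>f x\<bar> \<le> 1) \<and> (\<integral>z. \<bar>vs i z - f (fst z)\<bar> \<partial>S.\<Omega>) \<le> d" ..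
  from choice[OF this] obtain J where
    "\<forall>i. \<exists>f. i < k \<longrightarrow> finite (J i) \<and> depends_on f (J i) \<and> (\<forall>x. \<bar>f x\<bar> \<le> 1) \<and> (\<integral>z. \<bar>vs i z - f (fst z)\<bar> \<partial>S.\<Omega>) \<le> d"
    ..
  from choice[OF this] obtain f where
    "\<forall>i. i < k \<longrightarrow> finite (J i) \<and> depends_on (f i) (J i) \<and> (\<forall>x. \<bar>f i x\<bar> \<le> 1) \<and> (\<integral>z. \<bar>vs i z - f i (fst z)\<bar> \<partial>S.\<Omega>) \<le> d" ..
  then have J: "\<And>i. i < k \<Longrightarrow> finite (J i)" and f: "\<And>i. i < k \<Longrightarrow> depends_on (f i) (J i)"
    and f1: "\<And>i x. i < k \<Longrightarrow> \<bar>f i x\<bar> \<le> 1" and fd: "\<And>i. i < k \<Longrightarrow> (\<integral>z. \<bar>vs i z - f i (fst z)\<bar> \<partial>S.\<Omega>) \<le> d"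
    by simp_all
  note adm = admissible_cylinder[of k J f, OF J f f1]
  let ?\<rho> = "law k S.\<Omega> S.B (\<lambda>i z. f i (fst z))"
  have near: "levy_prokhorov k \<mu> ?\<rho> \<le> e / 2"
    unfolding vs(1) using \<open>0 < e\<close> fd d
    by (intro B.law_close_L1 admissible_linf[OF vs(2)] S.\<Omega>.depends_on_linf[OF f J]) auto
  have bp: "law k (M n) (A n) (\<lambda>i x. f i (\<phi> n x)) \<in> borel_prob" "?\<rho> \<in> borel_prob" "\<mu> \<in> borel_prob" for n
    unfolding vs(1)
    by (intro law_borel_prob C.markov B.markov C.code_linf[OF f J] S.\<Omega>.depends_on_linf[OF f J] admissible_linf[OF vs(2)]; assumption)+
  have "eventually (\<lambda>n. levy_prokhorov k (law k (M n) (A n) (\<lambda>i x. f i (\<phi> n x))) ?\<rho> \<le> e / 2) sequentially"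
    using J f \<open>0 < e\<close> by (intro cylinder_law_limit[where J=J]) auto
  then show ?thesis
  proof eventually_elim
    case (elim n)
    have "levy_prokhorov k (law k (M n) (A n) (\<lambda>i x. f i (\<phi> n x))) \<mu> \<le> e"
      using levy_prokhorov_triangle[OF bp(1)[of n] bp(2,3), of k] elim near levy_prokhorov_commute[of k \<mu> ?\<rho>] by linarith
    moreover have "law k (M n) (A n) (\<lambda>i x. f i (\<phi> n x)) \<in> profile k (M n) (A n)"
      using adm(1) by (auto simp: profile_eq)
    ultimately show ?case by blast
  qed
qed

end

section \<open>Uniformity over profiles and compactness\<close>

lemma law_cong: "(\<And>i. i < k \<Longrightarrow> vs i = ws i) \<Longrightarrow> law k M A vs = law k M A ws"
  unfolding law_def tuple_def by (intro arg_cong[where f="distr M borel"] ext) auto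

lemma finite_types_uniform:
  fixes P :: "nat \<Rightarrow> nat \<Rightarrow> bool"
  assumes "\<And>l. l < L \<Longrightarrow> eventually (P l) sequentially"
  shows "eventually (\<lambda>n. \<forall>l<L. P l n) sequentially"
  using assms eventually_ball_finite[of "{..<L}" "\<lambda>n l. P l n" sequentially] by (simp add: Ball_def)

text \<open>The disjoint sum merges two sets into one, enumeration makes it a set of naturals, and
  these are equinumerous with the reals.\<close>

lemma inj_set_pair_real: "\<exists>s :: ('i::countable) set \<times> 'i set \<Rightarrow> real. inj s"
proof -
  obtain g :: "nat set \<Rightarrow> real" where g: "inj g"
    using eqpoll_imp_lepoll[OF nat_sets_eqpoll_reals] by (auto simp: lepoll_def)
  have "inj (\<lambda>p :: 'i set \<times> 'i set. g (to_nat ` (fst p <+> snd p)))"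
  proof (rule injI)
    fix p q :: "'i set \<times> 'i set" assume "g (to_nat ` (fst p <+> snd p)) = g (to_nat ` (fst q <+> snd q))"
    then have "fst p <+> snd p = fst q <+> snd q" using g by (simp add: inj_eq inj_image_eq_iff)
    then show "p = q" by (auto simp: Plus_def prod_eq_iff)
  qed
  then show ?thesis by blast
qed

text \<open>A law of one profile reaches the other profile in two legs of at most
  \<open>e/2\<close>: to a selected law of the same type in its own profile, then across by
  convergence. There are finitely many types, so from some index on the second leg holds for all of
  them.\<close>

lemma markov_graphops_sequentially_compact:
  fixes M :: "nat \<Rightarrow> 'a measure"
  assumes markov: "\<And>n. markov_graphop (M n) (A n)"
  shows "\<exists>r (N::real measure) B. strict_mono r \<and> markov_graphop N B \<and>
    (\<lambda>n. dM (M (r n)) (A (r n)) N B) \<longlonglongrightarrow> 0"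
proof -
  have "\<exists>(L::nat) \<tau>. (\<forall>\<mu>. \<tau> \<mu> < L) \<and> (\<forall>\<mu>\<in>cube_laws (fst km). \<forall>\<nu>\<in>cube_laws (fst km).
    \<tau> \<mu> = \<tau> \<nu> \<longrightarrow> levy_prokhorov (fst km) \<mu> \<nu> \<le> inverse (real (Suc (snd km))))" for km
    by (rule totally_bounded_cube_laws) simp
  then have "\<forall>km. \<exists>(L::nat) \<tau>. (\<forall>\<mu>. \<tau> \<mu> < L) \<and> (\<forall>\<mu>\<in>cube_laws (fst km). \<forall>\<nu>\<in>cube_laws (fst km).
    \<tau> \<mu> = \<tau> \<nu> \<longrightarrow> levy_prokhorov (fst km) \<mu> \<nu> \<le> inverse (real (Suc (snd km))))" ..
  from choice[OF this] obtain L :: "nat \<times> nat \<Rightarrow> nat" where "\<forall>km. \<exists>\<tau>. (\<forall>\<mu>. \<tau> \<mu> < L km) \<and> (\<forall>\<mu>\<in>cube_laws (fst km). \<forall>\<nu>\<in>cube_laws (fst km).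
    \<tau> \<mu> = \<tau> \<nu> \<longrightarrow> levy_prokhorov (fst km) \<mu> \<nu> \<le> inverse (real (Suc (snd km))))" ..
  from choice[OF this] obtain \<tau> :: "nat \<times> nat \<Rightarrow> (nat \<Rightarrow> real) measure \<Rightarrow> nat" where \<tau>: "\<forall>km. (\<forall>\<mu>. \<tau> km \<mu> < L km) \<and> (\<forall>\<mu>\<in>cube_laws (fst km). \<forall>\<nu>\<in>cube_laws (fst km).
    \<tau> km \<mu> = \<tau> km \<nu> \<longrightarrow> levy_prokhorov (fst km) \<mu> \<nu> \<le> inverse (real (Suc (snd km))))" ..
  have \<tau>L: "\<tau> (k, m) \<mu> < L (k, m)" for k m \<mu> using \<tau> by blast
  have \<tau>e: "levy_prokhorov k \<mu> \<nu> \<le> inverse (real (Suc m))"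
    if "\<mu> \<in> cube_laws k" "\<nu> \<in> cube_laws k" "\<tau> (k, m) \<mu> = \<tau> (k, m) \<nu>" for k m \<mu> \<nu>
    using \<tau>[THEN spec, of "(k, m)", THEN conjunct2, unfolded fst_conv snd_conv] that by blast
  \<comment> \<open>\<open>W n k m l\<close> realises the type \<open>l\<close> whenever the profile of \<open>A n\<close> does. There are only finitely
    many types, so convergence of the laws of these tuples approximates all profile elements at once.\<close>
  define good where "good n k m l vs \<longleftrightarrow> admissible k (M n) vs \<and> \<tau> (k, m) (law k (M n) (A n) vs) = l" for n k m l vs
  define W where "W n k m l = (if \<exists>vs. good n k m l vs then SOME vs. good n k m l vs else (\<lambda>_ _. 0))" for n k m l
  have W_adm: "admissible k (M n) (W n k m l)" for n k m l
  proof (cases "\<exists>vs. good n k m l vs")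
    case True
    from someI_ex[OF True] have "good n k m l (W n k m l)" by (simp add: W_def True)
    then show ?thesis by (simp add: good_def)
  qed (simp add: W_def admissible_def)
  have W_good: "\<tau> (k, m) (law k (M n) (A n) (W n k m l)) = l" if "good n k m l vs" for n k m l vs
  proof -
    have ex: "\<exists>vs. good n k m l vs" using that by blast
    from someI_ex[OF ex] have "good n k m l (W n k m l)" by (simp add: W_def ex)
    then show ?thesis by (simp add: good_def)
  qed
  \<comment> \<open>All functions of all selected tuples in one sequence. Positions with
    \<open>i \<ge> k\<close> are filled by 0, which keeps measurability and the bound.\<close>
  define V where "V n a = (case from_nat a of (k, m, l, i) \<Rightarrow> if i < k then W n k m l i else (\<lambda>_. 0))" for n and a :: nat
  have V_W: "V n (to_nat (k, m, l, i)) = W n k m l i" if "i < k" for n k m l i using that by (simp add: V_def)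
  have "coded_op (M n) (A n) (V n)" for n
  proof (intro coded_op.intro coded_op_axioms.intro markov_op.intro markov)
    fix a
    obtain k m l i where a: "from_nat a = (k :: nat, m :: nat, l :: nat, i :: nat)" by (metis prod_cases4)
    show "V n a \<in> borel_measurable (M n)"
      using W_adm[of k n m l] by (simp add: V_def a admissible_def)
    show "\<bar>V n a x\<bar> \<le> 1" if "x \<in> space (M n)" for x
      using W_adm[of k n m l] that by (simp add: V_def a admissible_def)
  qed
  from coded_sequence_exists[of M A V, OF this] obtain r Q where r: "strict_mono r"
    and coded: "coded_sequence (\<lambda>n. M (r n)) (\<lambda>n. A (r n)) (\<lambda>n. V (r n)) Q" by blast
  interpret coded_sequence "\<lambda>n. M (r n)" "\<lambda>n. A (r n)" "\<lambda>n. V (r n)" Q by (rule coded)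
  note P_n = profile_borel_prob[OF markov] and P_lim = profile_borel_prob[OF B.markov]
  have cube_n: "\<nu> \<in> cube_laws k" if "\<nu> \<in> profile k (M (r n)) (A (r n))" for \<nu> k n
    using that C.law_in_cube by (auto simp: profile_eq)
  have cube_lim: "\<mu> \<in> cube_laws k" if "\<mu> \<in> profile k S.\<Omega> S.B" for \<mu> k
    using that B.law_in_cube by (auto simp: profile_eq)
  have bound: "eventually (\<lambda>n. hausdorff_LP k (profile k (M (r n)) (A (r n))) (profile k S.\<Omega> S.B) \<le> e) sequentially"
    if "0 < e" for k e
  proof -
    obtain m where m: "inverse (real (Suc m)) < e / 2" using reals_Archimedean[of "e / 2"] \<open>0 < e\<close> by auto
    let ?l = "L (k, m)"
    have "\<forall>l::nat. \<exists>\<mu>. \<mu> \<in> profile k S.\<Omega> S.B \<and> eventually (\<lambda>n. levy_prokhorov k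
      (law k (M (r n)) (A (r n)) (\<lambda>i. V (r n) (to_nat (k, m, l, i)))) \<mu> \<le> e / 2) sequentially"
      using coded_law_limit[of "e / 2" k] \<open>0 < e\<close> by (simp add: Bex_def)
    from choice[OF this] obtain \<mu> where \<mu>: "\<And>l::nat. \<mu> l \<in> profile k S.\<Omega> S.B" and
      "\<And>l. eventually (\<lambda>n. levy_prokhorov k
      (law k (M (r n)) (A (r n)) (\<lambda>i. V (r n) (to_nat (k, m, l, i)))) (\<mu> l) \<le> e / 2) sequentially"
      by blast
    then have ev1: "eventually (\<lambda>n. \<forall>l<?l. levy_prokhorov k
      (law k (M (r n)) (A (r n)) (\<lambda>i. V (r n) (to_nat (k, m, l, i)))) (\<mu> l) \<le> e / 2) sequentially"
      by (intro finite_types_uniform)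
    \<comment> \<open>One limit law for each type that the limit profile realises; for other types
      \<open>\<mu> l\<close> merely keeps \<open>\<rho> l\<close> in the profile.\<close>
    define \<rho> where "\<rho> l = (if \<exists>\<mu>\<in>profile k S.\<Omega> S.B. \<tau> (k, m) \<mu> = l then
      SOME \<mu>. \<mu> \<in> profile k S.\<Omega> S.B \<and> \<tau> (k, m) \<mu> = l else \<mu> l)" for l
    have \<rho>: "\<rho> l \<in> profile k S.\<Omega> S.B" for l
      unfolding \<rho>_def using \<mu> someI_ex[of "\<lambda>\<mu>. \<mu> \<in> profile k S.\<Omega> S.B \<and> \<tau> (k, m) \<mu> = l"] by auto
    have \<rho>_type: "\<tau> (k, m) (\<rho> (\<tau> (k, m) \<mu>)) = \<tau> (k, m) \<mu>" if "\<mu> \<in> profile k S.\<Omega> S.B" for \<mu>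
      using that someI[of "\<lambda>\<mu>'. \<mu>' \<in> profile k S.\<Omega> S.B \<and> \<tau> (k, m) \<mu>' = \<tau> (k, m) \<mu>" \<mu>]
      unfolding \<rho>_def by auto
    have ev2: "eventually (\<lambda>n. \<forall>l<?l. \<exists>\<nu>\<in>profile k (M (r n)) (A (r n)). levy_prokhorov k \<nu> (\<rho> l) \<le> e / 2) sequentially"
      using \<open>0 < e\<close> by (intro finite_types_uniform limit_law_approx \<rho>) simp
    from ev1 ev2 show ?thesis
    proof eventually_elim
      case (elim n)
      show ?case
      proof (rule hausdorff_LP_leI[OF P_n P_lim])
        fix \<nu> assume \<nu>: "\<nu> \<in> profile k (M (r n)) (A (r n))"
        then obtain vs where vs: "\<nu> = law k (M (r n)) (A (r n)) vs" "admissible k (M (r n)) vs" by (auto simp: profile_eq)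
        define l where "l = \<tau> (k, m) \<nu>"
        let ?W = "law k (M (r n)) (A (r n)) (W (r n) k m l)"
        have W: "?W \<in> profile k (M (r n)) (A (r n))" using W_adm by (auto simp: profile_eq)
        have "good (r n) k m l vs" using vs by (simp add: good_def l_def)
        then have "\<tau> (k, m) ?W = \<tau> (k, m) \<nu>" using W_good by (simp add: l_def)
        then have "levy_prokhorov k \<nu> ?W \<le> inverse (real (Suc m))"
          by (intro \<tau>e cube_n[OF \<nu>] cube_n[OF W]) simp
        moreover have W_eq: "law k (M (r n)) (A (r n)) (\<lambda>i. V (r n) (to_nat (k, m, l, i))) = ?W"
          by (rule law_cong) (rule V_W)
        have "l < ?l" unfolding l_def by (rule \<tau>L)
        with elim(1) have "levy_prokhorov k ?W (\<mu> l) \<le> e / 2" unfolding W_eq[symmetric] by blast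
        ultimately have "levy_prokhorov k \<nu> (\<mu> l) \<le> e"
          using levy_prokhorov_triangle[of \<nu> ?W "\<mu> l" k] \<nu> W \<mu>[of l] P_n(1) P_lim(1) m by (smt (verit) field_sum_of_halves subsetD)
        then show "\<exists>\<mu>\<in>profile k S.\<Omega> S.B. levy_prokhorov k \<nu> \<mu> \<le> e" using \<mu> by blast
      next
        fix \<mu>' assume \<mu>': "\<mu>' \<in> profile k S.\<Omega> S.B"
        define l where "l = \<tau> (k, m) \<mu>'"
        have "levy_prokhorov k (\<rho> l) \<mu>' \<le> inverse (real (Suc m))"
          using \<rho>_type[OF \<mu>'] by (intro \<tau>e cube_lim \<rho> \<mu>') (simp add: l_def)
        moreover obtain \<nu> where \<nu>: "\<nu> \<in> profile k (M (r n)) (A (r n))" "levy_prokhorov k \<nu> (\<rho> l) \<le> e / 2"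
          using elim(2) \<tau>L[of k m \<mu>'] by (auto simp: l_def)
        ultimately have "levy_prokhorov k \<nu> \<mu>' \<le> e"
          using levy_prokhorov_triangle[of \<nu> "\<rho> l" \<mu>' k] \<mu>' \<rho>[of l] P_n(1) P_lim(1) m by (smt (verit) field_sum_of_halves subsetD)
        then show "\<exists>\<nu>\<in>profile k (M (r n)) (A (r n)). levy_prokhorov k \<nu> \<mu>' \<le> e" using \<nu> by blast
      qed
    qed
  qed
  have lim: "(\<lambda>n. hausdorff_LP k (profile k (M (r n)) (A (r n))) (profile k S.\<Omega> S.B)) \<longlonglongrightarrow> 0" for k
  proof (rule tendstoI)
    fix e :: real assume "0 < e"
    then have "eventually (\<lambda>n. hausdorff_LP k (profile k (M (r n)) (A (r n))) (profile k S.\<Omega> S.B) \<le> e / 2) sequentially"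
      by (intro bound) simp
    then show "eventually (\<lambda>n. dist (hausdorff_LP k (profile k (M (r n)) (A (r n))) (profile k S.\<Omega> S.B)) 0 < e) sequentially"
      by eventually_elim (use \<open>0 < e\<close> hausdorff_LP_bounds(1)[OF P_n P_lim] in \<open>simp add: dist_real_def\<close>)
  qed
  obtain s :: "ix set \<times> ix set \<Rightarrow> real" where "inj s" using inj_set_pair_real by blast
  from markov_graphop_transport[OF B.markov S.\<Omega>.space_\<Omega> this]
  obtain N :: "real measure" and B' where N: "markov_graphop N B'" "\<And>k. profile k N B' = profile k S.\<Omega> S.B" by blast
  have "(\<lambda>n. dM (M (r n)) (A (r n)) N B') \<longlonglongrightarrow> 0"
    by (intro dM_tendsto_0 markov N(1)) (simp add: N(2) lim)
  with r N(1) show ?thesis by blast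
qed

text \<open>Weak equivalence is distance zero, so the pseudometric laws become the metric laws on
  classes, and in a metric space sequential compactness is compactness. Limits are represented on
  the reals, whatever the carrier type of the sequence.\<close>

theorem theorem3p6:
  shows "(\<forall>(M::'a measure) A. markov_graphop M A \<longrightarrow> dM M A M A = 0)
    \<and> (\<forall>(M::'a measure) A (N::'b measure) B. markov_graphop M A \<longrightarrow> markov_graphop N B \<longrightarrow>
         0 \<le> dM M A N B \<and> dM M A N B = dM N B M A)
    \<and> (\<forall>(M::'a measure) A (N::'b measure) B (L::'c measure) C.
         markov_graphop M A \<longrightarrow> markov_graphop N B \<longrightarrow> markov_graphop L C \<longrightarrow>
         dM M A L C \<le> dM M A N B + dM N B L C)
    \<and> (\<forall>(M::nat \<Rightarrow> 'a measure) A. (\<forall>n. markov_graphop (M n) (A n)) \<longrightarrow>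
         (\<exists>r (N::real measure) B. strict_mono r \<and> markov_graphop N B \<and>
            (\<lambda>n. dM (M (r n)) (A (r n)) N B) \<longlonglongrightarrow> 0))"
  by (intro conjI allI impI dM_self dM_nonneg dM_commute dM_triangle markov_graphops_sequentially_compact)
     auto

end
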